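(* Let $(\pi,V)$ be an irreducible, $\mathcal N$-compact, $\mathcal N$-cogenerated and $\mathcal N$-characteristic representation of $G$, let $\mathscr S$ be its localization with respect to the plumbing system $\mathcal N$, and identify $V$ with $H_c^0(X,\mathscr S)$ via the localization isomorphism. Let $B$ be a minimal support-ball for $\mathscr S$, centered at a vertex $x$ or an edge $e$. Let $K=G_B$ be the (setwise) stabilizer of $B$ in $G$ and let $W=H_B^0(X,\mathscr S)$ be the geometrically minimal $K$-type. Then $W$ is an irreducible representation of $K$, and the inclusion of $K$-representations $W\hookrightarrow V$ extends to an isomorphism of $G$-representations $\mathrm{cInd}_K^G W\xrightarrow{\sim}V$.
   Context: $k$ is a fixed field. $X$ is a locally finite tree with vertex set $X^0$ and nonempty edge set $X^1$; $x<e$ means the vertex $x$ is an endpoint of the edge $e$; $[x,y]$ is the simple path joining $x,y\in X^0$. A group $G$ acts on $X^0$ and $X^1$ preserving the relation $<$, and transitively on $X^1$. $G_x, G_e$ are stabilizers ($G_e$ may swap the endpoints of $e$). Plumbing system: a family $\mathcal N=(N_x)_{x\in X^0}$ of subgroups of $G$ with: (Stabilizing) $N_x\subset G_x$, and if $e$ has endpoints $x,y$ then $N_x,N_y\subset G_e$; (Equivariance) $gN_xg^{-1}=N_{gx}$; (Locality) if $e$ has endpoints $x,y$ then $N_xN_y=N_yN_x$, and one sets $N_e=N_xN_y$; (Convexity) if $y\in[x,z]$ then $N_y\subset N_xN_z$. Fix such $\mathcal N$. Representations: a representation $(\pi,V)$ of $G$ is a $k$-vector space $V$ (possibly infinite-dimensional)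 with a homomorphism $\pi:G\to GL(V)$. For a subgroup $H$, $V^H$ is the space of invariants, $V[H]=\mathrm{span}\{\pi(h)v-v: h\in H,v\in V\}$, $V_H=V/V[H]$. $V$ is $H$-characteristic if $V=V^H\oplus V[H]$. $V$ is $\mathcal N$-characteristic if it is $N_x$-characteristic for all $x\in X^0$. $V$ is $\mathcal N$-cogenerated if $V\to\prod_{x\in X^0}V_{N_x}$ is injective. For $f\in V$ let $f_x\in V_{N_x}$, $f_e\in V_{N_e}$ be its images; $\mathrm{Supp}_{\mathcal N}(f)=\{x: f_x\ne0\}\cup\{e:f_e\neq0\}$. $V$ is $\mathcal N$-compact if $\mathrm{Supp}_{\mathcal N}(f)$ is finite for all $f\in V$. Sheaves: a sheaf $\mathscr S$ on $X$ consists of $k$-vector spaces $\mathscr S_x$, $\mathscr S_e$ and linear maps $\mathrm{Res}_{x,e}:\mathscr S_x\to\mathscr S_e$ for all $x<e$. A $G$-equivariant structure is a family of linear isomorphisms $\rho(g,x):\mathscr S_x\to\mathscr S_{gx}$, $\rho(g,e):\mathscr S_e\to\mathscr S_{ge}$ commuting with restrictions and satisfying $\rho(g,hx)\rho(h,x)=\rho(gh,x)$, $\rho(g,he)\rho(h,e)=\rho(gh,e)$. $H_c^0(X,\mathscr S)$ is the space of $(f_x)\in\bigoplus_{x\in X^0}\mathscr S_x$ with $\mathrm{Res}_{x,e}f_x=\mathrm{Res}_{y,e}f_y=:f_e$ for each edge $e$ with endpoints $x,y$, with $G$ acting by $(gf)_{gx}=\rho(g,x)f_x$; $\mathrm{Supp}(f)=\{x:f_x\ne0\}\cup\{e:f_e\neq0\}$.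 For a finite subset $B$ of $X^0\sqcup X^1$, $H^0_B(X,\mathscr S)$ is the space of $f\in H^0_c(X,\mathscr S)$ with $\mathrm{Supp}(f)\subset B$; it is a representation of the setwise stabilizer $G_B$. Localization of $(\pi,V)$: the equivariant sheaf with $\mathscr S_x=V_{N_x}$, $\mathscr S_e=V_{N_e}$, restriction maps the natural quotient maps, equivariant structure induced by $\pi(g)$. When $(\pi,V)$ is $\mathcal N$-compact, $\mathcal N$-cogenerated and $\mathcal N$-characteristic, $f\mapsto(f_x)_x$ is a $G$-isomorphism $V\to H_c^0(X,\mathscr S)$ (the localization isomorphism). Balls: $B(x;r)$ is the closed ball of radius $r$ about a vertex $x$ (vertices at distance $\le r$ and the edges joining them); for an edge $e$ with endpoints $x,y$, $B(e;r)=B(x;r)\cup B(y;r)\cup\{e\}$. $\rho(f)$ is the smallest integer $r$ such that $\mathrm{Supp}(f)$ lies in a ball (centered at a vertex or an edge) of radius $r$; the support radius is $\rho(\mathscr S)=\min\{\rho(f):0\ne f\in H^0_c(X,\mathscr S)\}$. A minimal support-ball for $\mathscr S$ is a ball $B=B(x;r)$ or $B=B(e;r)$ with $r=\rho(\mathscr S)$ and $H_B^0(X,\mathscr S)\ne0$ which is minimal in the sense that no ball properly contained in $B$ supports a nonzero section (so if $x<e$ and $B(x;r)$ is a minimal support-ball then $B(e;r)$ is not). The pair $(G_B,H_B^0(X,\mathscr S))$ is called a geometrically minimal $K$-type for $(\pi,V)$. Compact induction: $\mathrm{cInd}_K^GW=k[G]\otimes_{k[K]}W$ (equivalently, the induced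 functions supported on finitely many cosets of $K$); the extension of $W\hookrightarrow V$ is $g\otimes w\mapsto\pi(g)w$. *)

theory Defs
  imports "HOL-Algebra.Group_Action" "HOL-Algebra.Module" "HOL-Algebra.AbelCoset"
begin

section \<open>Trees\<close>

text \<open>An edge is the set of its two endpoints, so the incidence relation \<open>x < e\<close> is \<open>x \<in> e\<close>.\<close>

record 'x graph =
  verts :: "'x set"
  edges :: "'x set set"

definition simple_path :: "'x graph \<Rightarrow> 'x \<Rightarrow> 'x \<Rightarrow> 'x list \<Rightarrow> bool" where
  "simple_path X x y p \<longleftrightarrow>
     p \<noteq> [] \<and> hd p = x \<and> last p = y \<and> set p \<subseteq> verts X \<and> distinct p \<and>
     successively (\<lambda>a b. {a, b} \<in> edges X) p"

definition tree :: "'x graph \<Rightarrow> bool" where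
  "tree X \<longleftrightarrow>
     (\<forall>e\<in>edges X. e \<subseteq> verts X \<and> card e = 2) \<and>
     (\<forall>x\<in>verts X. \<forall>y\<in>verts X. \<exists>!p. simple_path X x y p)"

definition locally_finite :: "'x graph \<Rightarrow> bool" where
  "locally_finite X \<longleftrightarrow> (\<forall>x\<in>verts X. finite {e\<in>edges X. x \<in> e})"

definition tree_path :: "'x graph \<Rightarrow> 'x \<Rightarrow> 'x \<Rightarrow> 'x list" where
  "tree_path X x y = (THE p. simple_path X x y p)"

definition tree_dist :: "'x graph \<Rightarrow> 'x \<Rightarrow> 'x \<Rightarrow> nat" where
  "tree_dist X x y = length (tree_path X x y) - 1"

definition edge_action :: "'x graph \<Rightarrow> ('g \<Rightarrow> 'x \<Rightarrow> 'x) \<Rightarrow> 'g \<Rightarrow> 'x set \<Rightarrow> 'x set" where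
  "edge_action X \<phi> g = (\<lambda>e\<in>edges X. \<phi> g ` e)"

text \<open>Subsets of the disjoint union of vertices and edges are sets of type \<open>('x + 'x set) set\<close>.\<close>

definition vertex_ball :: "'x graph \<Rightarrow> 'x \<Rightarrow> nat \<Rightarrow> ('x + 'x set) set" where
  "vertex_ball X x r =
     Inl ` {y\<in>verts X. tree_dist X x y \<le> r} \<union>
     Inr ` {e\<in>edges X. \<forall>y\<in>e. tree_dist X x y \<le> r}"

definition edge_ball :: "'x graph \<Rightarrow> 'x set \<Rightarrow> nat \<Rightarrow> ('x + 'x set) set" where
  "edge_ball X e r = (\<Union>x\<in>e. vertex_ball X x r) \<union> {Inr e}"

definition is_ball :: "'x graph \<Rightarrow> nat \<Rightarrow> ('x + 'x set) set \<Rightarrow> bool" where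
  "is_ball X r B \<longleftrightarrow>
     (\<exists>x\<in>verts X. B = vertex_ball X x r) \<or> (\<exists>e\<in>edges X. B = edge_ball X e r)"

definition setwise_stabilizer ::
    "'g monoid \<Rightarrow> ('g \<Rightarrow> 'x \<Rightarrow> 'x) \<Rightarrow> ('x + 'x set) set \<Rightarrow> 'g set" where
  "setwise_stabilizer G \<phi> = stabilizer G (\<lambda>g A. map_sum (\<phi> g) ((`) (\<phi> g)) ` A)"


section \<open>Plumbing systems\<close>

locale plumbing_system =
  fixes G :: "'g monoid" (structure) and X :: "'x graph"
    and \<phi> :: "'g \<Rightarrow> 'x \<Rightarrow> 'x" and N :: "'x \<Rightarrow> 'g set"
  assumes is_subgroup: "x \<in> verts X \<Longrightarrow> subgroup (N x) G"
    and stabilizing_vertex: "x \<in> verts X \<Longrightarrow> N x \<subseteq> stabilizer G \<phi> x"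
    and stabilizing_edge:
      "\<lbrakk>e \<in> edges X; x \<in> e\<rbrakk> \<Longrightarrow> N x \<subseteq> stabilizer G (edge_action X \<phi>) e"
    and equivariance:
      "\<lbrakk>g \<in> carrier G; x \<in> verts X\<rbrakk> \<Longrightarrow> g <# N x #> inv g = N (\<phi> g x)"
    and locality: "{x, y} \<in> edges X \<Longrightarrow> N x <#> N y = N y <#> N x"
    and convexity:
      "\<lbrakk>x \<in> verts X; z \<in> verts X; y \<in> set (tree_path X x z)\<rbrakk> \<Longrightarrow> N y \<subseteq> N x <#> N z"

text \<open>The subgroup \<open>N\<^sub>e = N\<^sub>x N\<^sub>y\<close>; by locality it does not depend on the order of the endpoints.\<close>

definition edge_subgroup :: "'g monoid \<Rightarrow> ('x \<Rightarrow> 'g set) \<Rightarrow> 'x set \<Rightarrow> 'g set" where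
  "edge_subgroup G N e = (THE H. \<exists>x y. e = {x, y} \<and> H = N x <#>\<^bsub>G\<^esub> N y)"


section \<open>Vector spaces and representations\<close>

definition linear_maps :: "'k ring \<Rightarrow> ('k, 'v) module \<Rightarrow> ('k, 'w) module \<Rightarrow> ('v \<Rightarrow> 'w) set" where
  "linear_maps k V W =
     {T \<in> hom (add_monoid V) (add_monoid W).
        \<forall>c\<in>carrier k. \<forall>v\<in>carrier V. T (c \<odot>\<^bsub>V\<^esub> v) = c \<odot>\<^bsub>W\<^esub> T v}"

definition linear_span :: "'k ring \<Rightarrow> ('k, 'v) module \<Rightarrow> 'v set \<Rightarrow> 'v set" where
  "linear_span k V A = \<Inter>{U. submodule U k V \<and> A \<subseteq> U}"

text \<open>The quotient space. Vector spaces are \<open>module\<close> records, whose ring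
  multiplication and unit play no role.\<close>

definition quotient_module :: "('k, 'v) module \<Rightarrow> 'v set \<Rightarrow> ('k, 'v set) module" where
  "quotient_module V U =
     \<lparr>carrier = a_rcosets\<^bsub>V\<^esub> U, mult = undefined, one = undefined,
      zero = U, add = (<+>\<^bsub>V\<^esub>),
      smult = (\<lambda>c C. \<Union>v\<in>C. U +>\<^bsub>V\<^esub> (c \<odot>\<^bsub>V\<^esub> v))\<rparr>"

text \<open>A homomorphism from \<open>G\<close> to \<open>GL(V)\<close> is an action on \<open>carrier V\<close> by linear maps.
  As for every \<open>group_action\<close>, the maps \<open>\<pi> g\<close> are extensional.\<close>

definition representation ::
    "'k ring \<Rightarrow> 'g monoid \<Rightarrow> ('k, 'v) module \<Rightarrow> ('g \<Rightarrow> 'v \<Rightarrow> 'v) \<Rightarrow> bool" where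
  "representation k G V \<pi> \<longleftrightarrow>
     field k \<and> module k V \<and> group_action G (carrier V) \<pi> \<and>
     (\<forall>g\<in>carrier G. \<pi> g \<in> linear_maps k V V)"

definition irreducible_representation ::
    "'k ring \<Rightarrow> 'g monoid \<Rightarrow> ('k, 'v) module \<Rightarrow> ('g \<Rightarrow> 'v \<Rightarrow> 'v) \<Rightarrow> bool" where
  "irreducible_representation k G V \<pi> \<longleftrightarrow>
     representation k G V \<pi> \<and> carrier V \<noteq> {\<zero>\<^bsub>V\<^esub>} \<and>
     (\<forall>U. submodule U k V \<and> (\<forall>g\<in>carrier G. \<forall>u\<in>U. \<pi> g u \<in> U)
        \<longrightarrow> U = {\<zero>\<^bsub>V\<^esub>} \<or> U = carrier V)"

definition rep_isomorphism ::
    "'k ring \<Rightarrow> 'g monoid \<Rightarrow> ('k, 'v) module \<Rightarrow> ('g \<Rightarrow> 'v \<Rightarrow> 'v) \<Rightarrow>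
     ('k, 'w) module \<Rightarrow> ('g \<Rightarrow> 'w \<Rightarrow> 'w) \<Rightarrow> ('v \<Rightarrow> 'w) \<Rightarrow> bool" where
  "rep_isomorphism k G V \<pi> W \<sigma> T \<longleftrightarrow>
     T \<in> linear_maps k V W \<and> bij_betw T (carrier V) (carrier W) \<and>
     (\<forall>g\<in>carrier G. \<forall>v\<in>carrier V. T (\<pi> g v) = \<sigma> g (T v))"

text \<open>For a subgroup \<open>H\<close>: the invariants \<open>V\<^sup>H\<close>, the subspace \<open>V[H]\<close>, and the
  coinvariants \<open>V / V[H]\<close>.\<close>

definition inv_space ::
    "('k, 'v) module \<Rightarrow> ('g \<Rightarrow> 'v \<Rightarrow> 'v) \<Rightarrow> 'g set \<Rightarrow> 'v set" where
  "inv_space V \<pi> H = {v\<in>carrier V. \<forall>h\<in>H. \<pi> h v = v}"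

definition aug_space ::
    "'k ring \<Rightarrow> ('k, 'v) module \<Rightarrow> ('g \<Rightarrow> 'v \<Rightarrow> 'v) \<Rightarrow> 'g set \<Rightarrow> 'v set" where
  "aug_space k V \<pi> H = linear_span k V {\<pi> h v \<ominus>\<^bsub>V\<^esub> v | h v. h \<in> H \<and> v \<in> carrier V}"

definition coinvariants ::
    "'k ring \<Rightarrow> ('k, 'v) module \<Rightarrow> ('g \<Rightarrow> 'v \<Rightarrow> 'v) \<Rightarrow> 'g set \<Rightarrow> ('k, 'v set) module" where
  "coinvariants k V \<pi> H = quotient_module V (aug_space k V \<pi> H)"

definition coinv_class ::
    "'k ring \<Rightarrow> ('k, 'v) module \<Rightarrow> ('g \<Rightarrow> 'v \<Rightarrow> 'v) \<Rightarrow> 'g set \<Rightarrow> 'v \<Rightarrow> 'v set" where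
  "coinv_class k V \<pi> H v = aug_space k V \<pi> H +>\<^bsub>V\<^esub> v"

definition characteristic_for ::
    "'k ring \<Rightarrow> ('k, 'v) module \<Rightarrow> ('g \<Rightarrow> 'v \<Rightarrow> 'v) \<Rightarrow> 'g set \<Rightarrow> bool" where
  "characteristic_for k V \<pi> H \<longleftrightarrow>
     inv_space V \<pi> H <+>\<^bsub>V\<^esub> aug_space k V \<pi> H = carrier V \<and>
     inv_space V \<pi> H \<inter> aug_space k V \<pi> H = {\<zero>\<^bsub>V\<^esub>}"

definition N_characteristic ::
    "'k ring \<Rightarrow> 'x graph \<Rightarrow> ('x \<Rightarrow> 'g set) \<Rightarrow> ('k, 'v) module \<Rightarrow> ('g \<Rightarrow> 'v \<Rightarrow> 'v) \<Rightarrow> bool" where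
  "N_characteristic k X N V \<pi> \<longleftrightarrow> (\<forall>x\<in>verts X. characteristic_for k V \<pi> (N x))"

definition localization_map ::
    "'k ring \<Rightarrow> 'x graph \<Rightarrow> ('x \<Rightarrow> 'g set) \<Rightarrow> ('k, 'v) module \<Rightarrow> ('g \<Rightarrow> 'v \<Rightarrow> 'v) \<Rightarrow>
     'v \<Rightarrow> 'x \<Rightarrow> 'v set" where
  "localization_map k X N V \<pi> v = (\<lambda>x\<in>verts X. coinv_class k V \<pi> (N x) v)"

definition N_cogenerated ::
    "'k ring \<Rightarrow> 'x graph \<Rightarrow> ('x \<Rightarrow> 'g set) \<Rightarrow> ('k, 'v) module \<Rightarrow> ('g \<Rightarrow> 'v \<Rightarrow> 'v) \<Rightarrow> bool" where
  "N_cogenerated k X N V \<pi> \<longleftrightarrow> inj_on (localization_map k X N V \<pi>) (carrier V)"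

definition N_support ::
    "'k ring \<Rightarrow> 'g monoid \<Rightarrow> 'x graph \<Rightarrow> ('x \<Rightarrow> 'g set) \<Rightarrow> ('k, 'v) module \<Rightarrow>
     ('g \<Rightarrow> 'v \<Rightarrow> 'v) \<Rightarrow> 'v \<Rightarrow> ('x + 'x set) set" where
  "N_support k G X N V \<pi> v =
     Inl ` {x\<in>verts X. coinv_class k V \<pi> (N x) v \<noteq> \<zero>\<^bsub>coinvariants k V \<pi> (N x)\<^esub>} \<union>
     Inr ` {e\<in>edges X. coinv_class k V \<pi> (edge_subgroup G N e) v
                         \<noteq> \<zero>\<^bsub>coinvariants k V \<pi> (edge_subgroup G N e)\<^esub>}"

definition N_compact ::
    "'k ring \<Rightarrow> 'g monoid \<Rightarrow> 'x graph \<Rightarrow> ('x \<Rightarrow> 'g set) \<Rightarrow> ('k, 'v) module \<Rightarrow>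
     ('g \<Rightarrow> 'v \<Rightarrow> 'v) \<Rightarrow> bool" where
  "N_compact k G X N V \<pi> \<longleftrightarrow> (\<forall>v\<in>carrier V. finite (N_support k G X N V \<pi> v))"


section \<open>Equivariant sheaves on a tree\<close>

text \<open>\<open>vact S g x\<close> maps the stalk at \<open>x\<close> to the stalk at \<open>g x\<close>, and similarly for \<open>eact\<close>.\<close>

record ('g, 'x, 'k, 's) sheaf_data =
  vstalk :: "'x \<Rightarrow> ('k, 's) module"
  estalk :: "'x set \<Rightarrow> ('k, 's) module"
  res :: "'x \<Rightarrow> 'x set \<Rightarrow> 's \<Rightarrow> 's"
  vact :: "'g \<Rightarrow> 'x \<Rightarrow> 's \<Rightarrow> 's"
  eact :: "'g \<Rightarrow> 'x set \<Rightarrow> 's \<Rightarrow> 's"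

locale equivariant_sheaf =
  fixes k :: "'k ring" and G :: "'g monoid" (structure) and X :: "'x graph"
    and \<phi> :: "'g \<Rightarrow> 'x \<Rightarrow> 'x" and S :: "('g, 'x, 'k, 's) sheaf_data"
  assumes vstalk_module: "x \<in> verts X \<Longrightarrow> module k (vstalk S x)"
    and estalk_module: "e \<in> edges X \<Longrightarrow> module k (estalk S e)"
    and res_linear:
      "\<lbrakk>e \<in> edges X; x \<in> e\<rbrakk> \<Longrightarrow> res S x e \<in> linear_maps k (vstalk S x) (estalk S e)"
    and vact_linear:
      "\<lbrakk>g \<in> carrier G; x \<in> verts X\<rbrakk> \<Longrightarrow>
         vact S g x \<in> linear_maps k (vstalk S x) (vstalk S (\<phi> g x)) \<and>
         bij_betw (vact S g x) (carrier (vstalk S x)) (carrier (vstalk S (\<phi> g x)))"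
    and eact_linear:
      "\<lbrakk>g \<in> carrier G; e \<in> edges X\<rbrakk> \<Longrightarrow>
         eact S g e \<in> linear_maps k (estalk S e) (estalk S (\<phi> g ` e)) \<and>
         bij_betw (eact S g e) (carrier (estalk S e)) (carrier (estalk S (\<phi> g ` e)))"
    and res_equivariant:
      "\<lbrakk>g \<in> carrier G; e \<in> edges X; x \<in> e; s \<in> carrier (vstalk S x)\<rbrakk> \<Longrightarrow>
         res S (\<phi> g x) (\<phi> g ` e) (vact S g x s) = eact S g e (res S x e s)"
    and vact_mult:
      "\<lbrakk>g \<in> carrier G; h \<in> carrier G; x \<in> verts X; s \<in> carrier (vstalk S x)\<rbrakk> \<Longrightarrow>
         vact S g (\<phi> h x) (vact S h x s) = vact S (g \<otimes> h) x s"
    and eact_mult: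
      "\<lbrakk>g \<in> carrier G; h \<in> carrier G; e \<in> edges X; s \<in> carrier (estalk S e)\<rbrakk> \<Longrightarrow>
         eact S g (\<phi> h ` e) (eact S h e s) = eact S (g \<otimes> h) e s"

definition compact_sections ::
    "'x graph \<Rightarrow> ('g, 'x, 'k, 's) sheaf_data \<Rightarrow> ('k, 'x \<Rightarrow> 's) module" where
  "compact_sections X S =
     \<lparr>carrier = {f \<in> (\<Pi>\<^sub>E x\<in>verts X. carrier (vstalk S x)).
                   finite {x\<in>verts X. f x \<noteq> \<zero>\<^bsub>vstalk S x\<^esub>} \<and>
                   (\<forall>e\<in>edges X. \<forall>x\<in>e. \<forall>y\<in>e. res S x e (f x) = res S y e (f y))},
      mult = undefined, one = undefined,
      zero = (\<lambda>x\<in>verts X. \<zero>\<^bsub>vstalk S x\<^esub>),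
      add = (\<lambda>f f'. \<lambda>x\<in>verts X. f x \<oplus>\<^bsub>vstalk S x\<^esub> f' x),
      smult = (\<lambda>c f. \<lambda>x\<in>verts X. c \<odot>\<^bsub>vstalk S x\<^esub> f x)\<rparr>"

text \<open>\<open>(g f)\<^sub>y = \<rho>(g, x) f\<^sub>x\<close> for \<open>y = g x\<close>.\<close>

definition section_action ::
    "'g monoid \<Rightarrow> 'x graph \<Rightarrow> ('g \<Rightarrow> 'x \<Rightarrow> 'x) \<Rightarrow> ('g, 'x, 'k, 's) sheaf_data \<Rightarrow>
     'g \<Rightarrow> ('x \<Rightarrow> 's) \<Rightarrow> 'x \<Rightarrow> 's" where
  "section_action G X \<phi> S g f =
     (\<lambda>y\<in>verts X. vact S g (\<phi> (inv\<^bsub>G\<^esub> g) y) (f (\<phi> (inv\<^bsub>G\<^esub> g) y)))"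

definition edge_value ::
    "('g, 'x, 'k, 's) sheaf_data \<Rightarrow> ('x \<Rightarrow> 's) \<Rightarrow> 'x set \<Rightarrow> 's" where
  "edge_value S f e = (THE s. \<forall>x\<in>e. res S x e (f x) = s)"

definition section_support ::
    "'x graph \<Rightarrow> ('g, 'x, 'k, 's) sheaf_data \<Rightarrow> ('x \<Rightarrow> 's) \<Rightarrow> ('x + 'x set) set" where
  "section_support X S f =
     Inl ` {x\<in>verts X. f x \<noteq> \<zero>\<^bsub>vstalk S x\<^esub>} \<union>
     Inr ` {e\<in>edges X. edge_value S f e \<noteq> \<zero>\<^bsub>estalk S e\<^esub>}"

definition sections_in ::
    "'x graph \<Rightarrow> ('g, 'x, 'k, 's) sheaf_data \<Rightarrow> ('x + 'x set) set \<Rightarrow>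
     ('k, 'x \<Rightarrow> 's) module" where
  "sections_in X S B =
     (compact_sections X S)
       \<lparr>carrier := {f \<in> carrier (compact_sections X S). section_support X S f \<subseteq> B}\<rparr>"

definition section_radius ::
    "'x graph \<Rightarrow> ('g, 'x, 'k, 's) sheaf_data \<Rightarrow> ('x \<Rightarrow> 's) \<Rightarrow> nat" where
  "section_radius X S f = (LEAST r. \<exists>B. is_ball X r B \<and> section_support X S f \<subseteq> B)"

definition support_radius :: "'x graph \<Rightarrow> ('g, 'x, 'k, 's) sheaf_data \<Rightarrow> nat" where
  "support_radius X S =
     (LEAST r. \<exists>f\<in>carrier (compact_sections X S).
        f \<noteq> \<zero>\<^bsub>compact_sections X S\<^esub> \<and> r = section_radius X S f)"

definition supports_nonzero_section ::
    "'x graph \<Rightarrow> ('g, 'x, 'k, 's) sheaf_data \<Rightarrow> ('x + 'x set) set \<Rightarrow> bool" where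
  "supports_nonzero_section X S B \<longleftrightarrow>
     (\<exists>f\<in>carrier (sections_in X S B). f \<noteq> \<zero>\<^bsub>compact_sections X S\<^esub>)"

text \<open>In the minimality condition, the smaller ball may have any center and any radius.\<close>

definition minimal_support_ball ::
    "'x graph \<Rightarrow> ('g, 'x, 'k, 's) sheaf_data \<Rightarrow> ('x + 'x set) set \<Rightarrow> bool" where
  "minimal_support_ball X S B \<longleftrightarrow>
     is_ball X (support_radius X S) B \<and> supports_nonzero_section X S B \<and>
     (\<forall>r B'. is_ball X r B' \<and> B' \<subset> B \<longrightarrow> \<not> supports_nonzero_section X S B')"


section \<open>The localization of a representation\<close>

definition localization ::
    "'k ring \<Rightarrow> 'g monoid \<Rightarrow> ('x \<Rightarrow> 'g set) \<Rightarrow> ('k, 'v) module \<Rightarrow> ('g \<Rightarrow> 'v \<Rightarrow> 'v) \<Rightarrow>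
     ('g, 'x, 'k, 'v set) sheaf_data" where
  "localization k G N V \<pi> =
     \<lparr>vstalk = (\<lambda>x. coinvariants k V \<pi> (N x)),
      estalk = (\<lambda>e. coinvariants k V \<pi> (edge_subgroup G N e)),
      res = (\<lambda>x e C. \<Union>v\<in>C. coinv_class k V \<pi> (edge_subgroup G N e) v),
      vact = (\<lambda>g x C. \<pi> g ` C),
      eact = (\<lambda>g e C. \<pi> g ` C)\<rparr>"


section \<open>Compact induction\<close>

text \<open>The function model: \<open>g \<otimes> w\<close> in \<open>k[G] \<otimes>\<^bsub>k[H]\<^esub> W\<close> corresponds to the function supported on
  the left coset \<open>g H\<close> whose value at \<open>g h\<close> is \<open>\<sigma>(h)\<^sup>-\<^sup>1 w\<close>.\<close>

definition cInd ::
    "'g monoid \<Rightarrow> 'g set \<Rightarrow> ('k, 'w) module \<Rightarrow> ('g \<Rightarrow> 'w \<Rightarrow> 'w) \<Rightarrow> ('k, 'g \<Rightarrow> 'w) module" where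
  "cInd G H W \<sigma> =
     \<lparr>carrier = {F \<in> carrier G \<rightarrow>\<^sub>E carrier W.
                   (\<forall>g\<in>carrier G. \<forall>h\<in>H. F (g \<otimes>\<^bsub>G\<^esub> h) = \<sigma> (inv\<^bsub>G\<^esub> h) (F g)) \<and>
                   finite {g <#\<^bsub>G\<^esub> H | g. g \<in> carrier G \<and> F g \<noteq> \<zero>\<^bsub>W\<^esub>}},
      mult = undefined, one = undefined,
      zero = (\<lambda>g\<in>carrier G. \<zero>\<^bsub>W\<^esub>),
      add = (\<lambda>F F'. \<lambda>g\<in>carrier G. F g \<oplus>\<^bsub>W\<^esub> F' g),
      smult = (\<lambda>c F. \<lambda>g\<in>carrier G. c \<odot>\<^bsub>W\<^esub> F g)\<rparr>"

definition cInd_action :: "'g monoid \<Rightarrow> 'g \<Rightarrow> ('g \<Rightarrow> 'w) \<Rightarrow> 'g \<Rightarrow> 'w" where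
  "cInd_action G g F = (\<lambda>a\<in>carrier G. F (inv\<^bsub>G\<^esub> g \<otimes>\<^bsub>G\<^esub> a))"

definition cInd_tensor ::
    "'g monoid \<Rightarrow> 'g set \<Rightarrow> ('k, 'w) module \<Rightarrow> ('g \<Rightarrow> 'w \<Rightarrow> 'w) \<Rightarrow> 'g \<Rightarrow> 'w \<Rightarrow> 'g \<Rightarrow> 'w" where
  "cInd_tensor G H W \<sigma> g w =
     (\<lambda>a\<in>carrier G. if inv\<^bsub>G\<^esub> g \<otimes>\<^bsub>G\<^esub> a \<in> H then \<sigma> (inv\<^bsub>G\<^esub> (inv\<^bsub>G\<^esub> g \<otimes>\<^bsub>G\<^esub> a)) w else \<zero>\<^bsub>W\<^esub>)"


section \<open>The localization is an equivariant sheaf\<close>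

lemma submodule_linear_span:
  assumes "module k V" "A \<subseteq> carrier V"
  shows "submodule (linear_span k V A) k V"
proof -
  interpret module k V by fact
  have car: "carrier V \<in> {U. submodule U k V \<and> A \<subseteq> U}"
    using assms(2) carrier_is_submodule by simp
  show ?thesis
  proof (rule submoduleI)
    show "linear_span k V A \<subseteq> carrier V"
      using car unfolding linear_span_def by blast
    show "\<zero>\<^bsub>V\<^esub> \<in> linear_span k V A"
      unfolding linear_span_def
    proof clarify
      fix U assume "submodule U k V"
      then show "\<zero>\<^bsub>V\<^esub> \<in> U"
        using subgroup.one_closed[OF submodule.axioms(1)] by fastforce
    qed
  next
    fix a assume "a \<in> linear_span k V A"
    then show "\<ominus>\<^bsub>V\<^esub> a \<in> linear_span k V A"
      unfolding linear_span_def using submoduleE(3) by blast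
  next
    fix a b assume "a \<in> linear_span k V A" "b \<in> linear_span k V A"
    then show "a \<oplus>\<^bsub>V\<^esub> b \<in> linear_span k V A"
      unfolding linear_span_def using submoduleE(5) by blast
  next
    fix a b assume "a \<in> carrier k" "b \<in> linear_span k V A"
    then show "a \<odot>\<^bsub>V\<^esub> b \<in> linear_span k V A"
      unfolding linear_span_def using submoduleE(4) by blast
  qed
qed

lemma linear_span_superset: "A \<subseteq> linear_span k V A"
  unfolding linear_span_def by blast

lemma linear_span_least: "submodule U k V \<Longrightarrow> A \<subseteq> U \<Longrightarrow> linear_span k V A \<subseteq> U"
  unfolding linear_span_def by blast

context
  fixes k :: "'k ring" and V :: "('k, 'v) module" and U
  assumes m: "module k V" and sub: "submodule U k V"
begin

interpretation module k V by (rule m)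

lemma sub_abelian: "abelian_subgroup U V"
proof -
  have "additive_subgroup U V"
    using sub by (simp add: submodule.axioms(1) additive_subgroupI)
  then show ?thesis
    by (simp add: abelian_subgroupI3 abelian_group_axioms)
qed

interpretation abelian_subgroup U V by (rule sub_abelian)

lemma coset_eq_if_mem:
  "w \<in> U +>\<^bsub>V\<^esub> v \<Longrightarrow> v \<in> carrier V \<Longrightarrow> U +>\<^bsub>V\<^esub> w = U +>\<^bsub>V\<^esub> v"
  by (metis M.a_repr_independence a_subgroup)

lemma quotient_smult:
  assumes "c \<in> carrier k" "v \<in> carrier V"
  shows "c \<odot>\<^bsub>quotient_module V U\<^esub> (U +>\<^bsub>V\<^esub> v) = U +>\<^bsub>V\<^esub> (c \<odot>\<^bsub>V\<^esub> v)"
proof -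
  have "U +>\<^bsub>V\<^esub> (c \<odot>\<^bsub>V\<^esub> w) = U +>\<^bsub>V\<^esub> (c \<odot>\<^bsub>V\<^esub> v)" if w: "w \<in> U +>\<^bsub>V\<^esub> v" for w
  proof -
    from w obtain u where u: "u \<in> U" "w = u \<oplus>\<^bsub>V\<^esub> v"
      by (auto simp: a_r_coset_def')
    then have "c \<odot>\<^bsub>V\<^esub> w = (c \<odot>\<^bsub>V\<^esub> u) \<oplus>\<^bsub>V\<^esub> (c \<odot>\<^bsub>V\<^esub> v)"
      using assms a_subset by (auto simp: smult_r_distr)
    moreover have "c \<odot>\<^bsub>V\<^esub> u \<in> U"
      using assms u sub submoduleE(4) by blast
    ultimately have "c \<odot>\<^bsub>V\<^esub> w \<in> U +>\<^bsub>V\<^esub> (c \<odot>\<^bsub>V\<^esub> v)"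
      by (auto simp: a_r_coset_def')
    then show ?thesis
      using coset_eq_if_mem assms by simp
  qed
  moreover have "v \<in> U +>\<^bsub>V\<^esub> v"
    using assms by (simp add: a_rcos_self)
  ultimately have "(\<Union>w\<in>U +>\<^bsub>V\<^esub> v. U +>\<^bsub>V\<^esub> (c \<odot>\<^bsub>V\<^esub> w)) = U +>\<^bsub>V\<^esub> (c \<odot>\<^bsub>V\<^esub> v)"
    by blast
  then show ?thesis
    by (simp add: quotient_module_def)
qed

lemma quotient_add:
  assumes "v \<in> carrier V" "w \<in> carrier V"
  shows "(U +>\<^bsub>V\<^esub> v) \<oplus>\<^bsub>quotient_module V U\<^esub> (U +>\<^bsub>V\<^esub> w) = U +>\<^bsub>V\<^esub> (v \<oplus>\<^bsub>V\<^esub> w)"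
  using assms by (simp add: quotient_module_def a_rcos_sum)

lemma quotient_carrier: "carrier (quotient_module V U) = (\<lambda>v. U +>\<^bsub>V\<^esub> v) ` carrier V"
  by (auto simp: quotient_module_def A_RCOSETS_def')

lemma module_quotient: "module k (quotient_module V U)"
proof (rule moduleI)
  show "cring k" by (rule R.is_cring)
  show "abelian_group (quotient_module V U)"
  proof (rule abelian_groupI)
    have z: "\<zero>\<^bsub>quotient_module V U\<^esub> = U +>\<^bsub>V\<^esub> \<zero>\<^bsub>V\<^esub>"
      using a_coset_add_zero[OF a_subset] by (simp add: quotient_module_def)
    show "\<zero>\<^bsub>quotient_module V U\<^esub> \<in> carrier (quotient_module V U)"
      by (auto simp: z quotient_carrier)
    show "\<zero>\<^bsub>quotient_module V U\<^esub> \<oplus>\<^bsub>quotient_module V U\<^esub> x = x"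
      if "x \<in> carrier (quotient_module V U)" for x
      using that by (auto simp: z quotient_carrier quotient_add)
    show "\<exists>y\<in>carrier (quotient_module V U). y \<oplus>\<^bsub>quotient_module V U\<^esub> x = \<zero>\<^bsub>quotient_module V U\<^esub>"
      if x: "x \<in> carrier (quotient_module V U)" for x
    proof -
      from x obtain v where v: "v \<in> carrier V" "x = U +>\<^bsub>V\<^esub> v"
        by (auto simp: quotient_carrier)
      then have "(U +>\<^bsub>V\<^esub> (\<ominus>\<^bsub>V\<^esub> v)) \<oplus>\<^bsub>quotient_module V U\<^esub> x = \<zero>\<^bsub>quotient_module V U\<^esub>"
        by (simp add: quotient_add z M.l_neg)
      with v show ?thesis by (auto simp: quotient_carrier)
    qed
  qed (auto simp: quotient_carrier quotient_add M.a_ac)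
next
  fix c x assume "c \<in> carrier k" "x \<in> carrier (quotient_module V U)"
  then show "c \<odot>\<^bsub>quotient_module V U\<^esub> x \<in> carrier (quotient_module V U)"
    by (auto simp: quotient_carrier quotient_smult)
next
  fix a b x assume "a \<in> carrier k" "b \<in> carrier k" "x \<in> carrier (quotient_module V U)"
  then show "(a \<oplus>\<^bsub>k\<^esub> b) \<odot>\<^bsub>quotient_module V U\<^esub> x =
    a \<odot>\<^bsub>quotient_module V U\<^esub> x \<oplus>\<^bsub>quotient_module V U\<^esub> b \<odot>\<^bsub>quotient_module V U\<^esub> x"
    by (auto simp: quotient_carrier quotient_smult quotient_add smult_l_distr)
next
  fix a x y
  assume "a \<in> carrier k" "x \<in> carrier (quotient_module V U)" "y \<in> carrier (quotient_module V U)"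
  then show "a \<odot>\<^bsub>quotient_module V U\<^esub> (x \<oplus>\<^bsub>quotient_module V U\<^esub> y) =
    a \<odot>\<^bsub>quotient_module V U\<^esub> x \<oplus>\<^bsub>quotient_module V U\<^esub> a \<odot>\<^bsub>quotient_module V U\<^esub> y"
    by (auto simp: quotient_carrier quotient_smult quotient_add smult_r_distr)
next
  fix a b x assume "a \<in> carrier k" "b \<in> carrier k" "x \<in> carrier (quotient_module V U)"
  then show "(a \<otimes>\<^bsub>k\<^esub> b) \<odot>\<^bsub>quotient_module V U\<^esub> x =
    a \<odot>\<^bsub>quotient_module V U\<^esub> (b \<odot>\<^bsub>quotient_module V U\<^esub> x)"
    by (auto simp: quotient_carrier quotient_smult smult_assoc1)
next
  fix x assume "x \<in> carrier (quotient_module V U)"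
  then show "\<one>\<^bsub>k\<^esub> \<odot>\<^bsub>quotient_module V U\<^esub> x = x"
    by (auto simp: quotient_carrier quotient_smult)
qed

lemma mem_coset_self: "v \<in> carrier V \<Longrightarrow> v \<in> U +>\<^bsub>V\<^esub> v"
  by (simp add: a_rcos_self)

lemma coset_subset: "v \<in> carrier V \<Longrightarrow> U +>\<^bsub>V\<^esub> v \<subseteq> carrier V"
  using a_subset by (auto simp: a_r_coset_def')

lemma quotient_map_linear: "(\<lambda>v. U +>\<^bsub>V\<^esub> v) \<in> linear_maps k V (quotient_module V U)"
  unfolding linear_maps_def hom_def
  using quotient_add quotient_smult quotient_carrier by auto

end

locale rep_setup =
  fixes k :: "'k ring" and G :: "'g monoid" (structure) and V :: "('k, 'v) module" and \<pi>
  assumes rep: "representation k G V \<pi>"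
begin

lemma md: "module k V" and ga: "group_action G (carrier V) \<pi>"
  and lin: "g \<in> carrier G \<Longrightarrow> \<pi> g \<in> linear_maps k V V"
  using rep by (auto simp: representation_def)

sublocale M?: module k V by (rule md)
sublocale A?: group_action G "carrier V" \<pi> by (rule ga)
sublocale G?: group G using ga group_action.group_hom group_hom.axioms(1) by blast

lemma pi_closed [simp]: "g \<in> carrier G \<Longrightarrow> v \<in> carrier V \<Longrightarrow> \<pi> g v \<in> carrier V"
  using A.element_image by blast

lemma pi_add: "g \<in> carrier G \<Longrightarrow> v \<in> carrier V \<Longrightarrow> w \<in> carrier V \<Longrightarrow>
   \<pi> g (v \<oplus>\<^bsub>V\<^esub> w) = \<pi> g v \<oplus>\<^bsub>V\<^esub> \<pi> g w"
  using lin unfolding linear_maps_def hom_def by auto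

lemma pi_smult: "g \<in> carrier G \<Longrightarrow> v \<in> carrier V \<Longrightarrow> c \<in> carrier k \<Longrightarrow>
   \<pi> g (c \<odot>\<^bsub>V\<^esub> v) = c \<odot>\<^bsub>V\<^esub> \<pi> g v"
  using lin unfolding linear_maps_def by auto

lemma pi_zero: "g \<in> carrier G \<Longrightarrow> \<pi> g \<zero>\<^bsub>V\<^esub> = \<zero>\<^bsub>V\<^esub>"
  using pi_smult[of g "\<zero>\<^bsub>V\<^esub>" "\<zero>\<^bsub>k\<^esub>"] by simp

lemma pi_neg: "g \<in> carrier G \<Longrightarrow> v \<in> carrier V \<Longrightarrow> \<pi> g (\<ominus>\<^bsub>V\<^esub> v) = \<ominus>\<^bsub>V\<^esub> \<pi> g v"
  using pi_add[of g "\<ominus>\<^bsub>V\<^esub> v" v] by (simp add: M.l_neg pi_zero M.minus_equality)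

lemma pi_mult: "g \<in> carrier G \<Longrightarrow> h \<in> carrier G \<Longrightarrow> v \<in> carrier V \<Longrightarrow> \<pi> g (\<pi> h v) = \<pi> (g \<otimes> h) v"
  using A.composition_rule by simp

lemma pi_inv: "g \<in> carrier G \<Longrightarrow> v \<in> carrier V \<Longrightarrow> \<pi> (inv g) (\<pi> g v) = v"
  "g \<in> carrier G \<Longrightarrow> v \<in> carrier V \<Longrightarrow> \<pi> g (\<pi> (inv g) v) = v"
  using fun_cong[OF A.id_eq_one, of v] by (auto simp: pi_mult)

lemma aug_submodule: "H \<subseteq> carrier G \<Longrightarrow> submodule (aug_space k V \<pi> H) k V"
  unfolding aug_space_def by (rule submodule_linear_span[OF md]) (auto simp: M.minus_closed)

lemma aug_image_subset:
  assumes "H \<subseteq> carrier G" "g \<in> carrier G"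
  shows "\<pi> g ` aug_space k V \<pi> H \<subseteq> aug_space k V \<pi> (g <# H #> inv g)"
proof -
  let ?H = "g <# H #> inv g"
  have H': "?H \<subseteq> carrier G"
    using assms by (auto simp: l_coset_def r_coset_def)
  have s: "submodule (aug_space k V \<pi> ?H) k V" by (rule aug_submodule[OF H'])
  let ?U = "{u \<in> carrier V. \<pi> g u \<in> aug_space k V \<pi> ?H}"
  have "submodule ?U k V"
    by (rule submoduleI)
      (use assms submoduleE[OF s] submodule.axioms(1)[OF s] in
        \<open>auto simp: pi_zero pi_neg pi_add pi_smult dest: subgroup.one_closed\<close>)
  moreover have "{\<pi> h v \<ominus>\<^bsub>V\<^esub> v | h v. h \<in> H \<and> v \<in> carrier V} \<subseteq> ?U"
  proof clarify
    fix h v assume hv: "h \<in> H" "v \<in> carrier V"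
    then have h: "h \<in> carrier G" using assms by auto
    have "\<pi> g (\<pi> h v \<ominus>\<^bsub>V\<^esub> v) = \<pi> (g \<otimes> h \<otimes> inv g) (\<pi> g v) \<ominus>\<^bsub>V\<^esub> \<pi> g v"
      using h hv assms by (simp add: M.minus_eq pi_add pi_neg pi_mult G.m_assoc)
    moreover have "g \<otimes> h \<otimes> inv g \<in> ?H"
      using hv by (auto simp: l_coset_def r_coset_def)
    ultimately have "\<pi> g (\<pi> h v \<ominus>\<^bsub>V\<^esub> v) \<in> aug_space k V \<pi> ?H"
      unfolding aug_space_def using pi_closed[OF assms(2) hv(2)]
      by (intro subsetD[OF linear_span_superset]) blast
    then show "\<pi> h v \<ominus>\<^bsub>V\<^esub> v \<in> carrier V \<and> \<pi> g (\<pi> h v \<ominus>\<^bsub>V\<^esub> v) \<in> aug_space k V \<pi> ?H"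
      using h hv by (simp add: M.minus_closed)
  qed
  ultimately have "aug_space k V \<pi> H \<subseteq> ?U"
    unfolding aug_space_def[of _ _ _ H] by (rule linear_span_least)
  then show ?thesis by auto
qed

lemma aug_image:
  assumes H: "H \<subseteq> carrier G" and g: "g \<in> carrier G"
  shows "\<pi> g ` aug_space k V \<pi> H = aug_space k V \<pi> (g <# H #> inv g)"
proof
  show "\<pi> g ` aug_space k V \<pi> H \<subseteq> aug_space k V \<pi> (g <# H #> inv g)"
    using assms by (rule aug_image_subset)
  let ?H = "g <# H #> inv g"
  have H': "?H \<subseteq> carrier G"
    using assms by (auto simp: l_coset_def r_coset_def)
  have conj_back: "inv g <# ?H #> inv (inv g) = H"
  proof -
    have "inv g \<otimes> (g \<otimes> h \<otimes> inv g) \<otimes> inv (inv g) = h" if "h \<in> H" for h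
    proof -
      have h: "h \<in> carrier G" using that H by auto
      have "inv g \<otimes> (g \<otimes> h) = h" using h g by (simp add: G.m_assoc[symmetric])
      then show ?thesis using h g by (simp add: G.m_assoc)
    qed
    then show ?thesis by (auto simp: l_coset_def r_coset_def)
  qed
  have "\<pi> (inv g) ` aug_space k V \<pi> ?H \<subseteq> aug_space k V \<pi> H"
    using aug_image_subset[OF H', of "inv g"] g conj_back by simp
  moreover have "aug_space k V \<pi> ?H \<subseteq> carrier V"
    using submoduleE(1)[OF aug_submodule[OF H']] .
  ultimately show "aug_space k V \<pi> ?H \<subseteq> \<pi> g ` aug_space k V \<pi> H"
    using pi_inv(2)[OF g] by (force simp: image_iff subset_iff)
qed

lemma class_image:
  assumes H: "H \<subseteq> carrier G" and g: "g \<in> carrier G" and v: "v \<in> carrier V"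
  shows "\<pi> g ` coinv_class k V \<pi> H v = coinv_class k V \<pi> (g <# H #> inv g) (\<pi> g v)"
proof -
  have sub: "aug_space k V \<pi> H \<subseteq> carrier V"
    using submoduleE(1)[OF aug_submodule[OF H]] .
  have "\<pi> g ` coinv_class k V \<pi> H v = (\<Union>u\<in>aug_space k V \<pi> H. {\<pi> g u \<oplus>\<^bsub>V\<^esub> \<pi> g v})"
    unfolding coinv_class_def a_r_coset_def' using sub g v pi_add by (auto simp: subset_iff image_iff)
  also have "\<dots> = coinv_class k V \<pi> (g <# H #> inv g) (\<pi> g v)"
    unfolding coinv_class_def a_r_coset_def' aug_image[OF H g, symmetric] by auto
  finally show ?thesis .
qed

lemma coinv_module: "H \<subseteq> carrier G \<Longrightarrow> module k (coinvariants k V \<pi> H)"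
  unfolding coinvariants_def by (rule module_quotient[OF md aug_submodule])

lemma coinv_carrier: "H \<subseteq> carrier G \<Longrightarrow>
    carrier (coinvariants k V \<pi> H) = coinv_class k V \<pi> H ` carrier V"
  unfolding coinvariants_def coinv_class_def[abs_def] by (rule quotient_carrier[OF md aug_submodule])

lemma coinv_add: "H \<subseteq> carrier G \<Longrightarrow> v \<in> carrier V \<Longrightarrow> w \<in> carrier V \<Longrightarrow>
    coinv_class k V \<pi> H v \<oplus>\<^bsub>coinvariants k V \<pi> H\<^esub> coinv_class k V \<pi> H w =
    coinv_class k V \<pi> H (v \<oplus>\<^bsub>V\<^esub> w)"
  unfolding coinvariants_def coinv_class_def by (rule quotient_add[OF md aug_submodule])

lemma coinv_smult: "H \<subseteq> carrier G \<Longrightarrow> v \<in> carrier V \<Longrightarrow> c \<in> carrier k \<Longrightarrow>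
    c \<odot>\<^bsub>coinvariants k V \<pi> H\<^esub> coinv_class k V \<pi> H v =
    coinv_class k V \<pi> H (c \<odot>\<^bsub>V\<^esub> v)"
  unfolding coinvariants_def coinv_class_def by (rule quotient_smult[OF md aug_submodule])

lemma class_linear:
  assumes "H \<subseteq> carrier G" "H' \<subseteq> carrier G"
   and "\<And>v. v \<in> carrier V \<Longrightarrow> T (coinv_class k V \<pi> H v) = coinv_class k V \<pi> H' (t v)"
   and "t \<in> linear_maps k V V"
  shows "T \<in> linear_maps k (coinvariants k V \<pi> H) (coinvariants k V \<pi> H')"
proof -
  have t: "t v \<in> carrier V" "t (v \<oplus>\<^bsub>V\<^esub> w) = t v \<oplus>\<^bsub>V\<^esub> t w" "t (c \<odot>\<^bsub>V\<^esub> v) = c \<odot>\<^bsub>V\<^esub> t v"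
    if "v \<in> carrier V" "w \<in> carrier V" "c \<in> carrier k" for v w c
    using assms(4) that by (auto simp: linear_maps_def hom_def)
  have tc: "t v \<in> carrier V" if "v \<in> carrier V" for v
    using assms(4) that by (auto simp: linear_maps_def hom_def)
  note c = coinv_carrier[OF assms(1)] coinv_carrier[OF assms(2)]
    coinv_add[OF assms(1)] coinv_add[OF assms(2)] coinv_smult[OF assms(1)] coinv_smult[OF assms(2)]
  show ?thesis
    unfolding linear_maps_def hom_def
  proof (intro CollectI conjI ballI)
    show "T \<in> carrier (add_monoid (coinvariants k V \<pi> H)) \<rightarrow> carrier (add_monoid (coinvariants k V \<pi> H'))"
      using tc by (auto simp: c assms(3))
  next
    fix x y assume "x \<in> carrier (add_monoid (coinvariants k V \<pi> H))" "y \<in> carrier (add_monoid (coinvariants k V \<pi> H))"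
    then obtain v w where v: "v \<in> carrier V" "x = coinv_class k V \<pi> H v"
        "w \<in> carrier V" "y = coinv_class k V \<pi> H w"
      by (auto simp: c)
    then show "T (x \<otimes>\<^bsub>add_monoid (coinvariants k V \<pi> H)\<^esub> y) = T x \<otimes>\<^bsub>add_monoid (coinvariants k V \<pi> H')\<^esub> T y"
      using t(2)[of v w "\<zero>\<^bsub>k\<^esub>"] tc by (simp add: c assms(3))
  next
    fix a x assume a: "a \<in> carrier k" "x \<in> carrier (coinvariants k V \<pi> H)"
    then obtain v where "v \<in> carrier V" "x = coinv_class k V \<pi> H v"
      by (auto simp: c)
    then show "T (a \<odot>\<^bsub>coinvariants k V \<pi> H\<^esub> x) = a \<odot>\<^bsub>coinvariants k V \<pi> H'\<^esub> T x"
      using t(3)[of v v a] tc a by (simp add: c assms(3))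
  qed
qed

lemma res_class:
  assumes H: "H \<subseteq> H'" "H' \<subseteq> carrier G" and v: "v \<in> carrier V"
  shows "(\<Union>w\<in>coinv_class k V \<pi> H v. coinv_class k V \<pi> H' w) = coinv_class k V \<pi> H' v"
proof -
  have HG: "H \<subseteq> carrier G" using H by auto
  note s = aug_submodule[OF H(2)] and s1 = aug_submodule[OF HG]
  have "aug_space k V \<pi> H \<subseteq> aug_space k V \<pi> H'"
    unfolding aug_space_def[of _ _ _ H]
    by (rule linear_span_least[OF s])
       (use H in \<open>unfold aug_space_def, intro subset_trans[OF _ linear_span_superset], blast\<close>)
  then have "coinv_class k V \<pi> H v \<subseteq> coinv_class k V \<pi> H' v"
    by (auto simp: coinv_class_def a_r_coset_def')
  moreover have "v \<in> coinv_class k V \<pi> H v"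
    unfolding coinv_class_def by (rule mem_coset_self[OF md s1 v])
  moreover have "coinv_class k V \<pi> H' w = coinv_class k V \<pi> H' v" if "w \<in> coinv_class k V \<pi> H' v" for w
    using that v unfolding coinv_class_def by (intro coset_eq_if_mem[OF md s])
  ultimately show ?thesis by blast
qed

lemma class_bij:
  assumes H: "H \<subseteq> carrier G" and g: "g \<in> carrier G"
  shows "bij_betw ((`) (\<pi> g)) (carrier (coinvariants k V \<pi> H))
     (carrier (coinvariants k V \<pi> (g <# H #> inv g)))"
proof -
  have H': "g <# H #> inv g \<subseteq> carrier G"
    using assms by (auto simp: l_coset_def r_coset_def)
  have "inj_on ((`) (\<pi> g)) (Pow (carrier V))"
    using A.inj_prop[OF g] by (rule inj_on_image_Pow)
  moreover have "carrier (coinvariants k V \<pi> H) \<subseteq> Pow (carrier V)"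
    unfolding coinv_carrier[OF H]
    using coset_subset[OF md aug_submodule[OF H]] by (auto simp: coinv_class_def subset_iff)
  ultimately have "inj_on ((`) (\<pi> g)) (carrier (coinvariants k V \<pi> H))"
    by (rule inj_on_subset)
  moreover have "(\<lambda>v. \<pi> g ` coinv_class k V \<pi> H v) ` carrier V =
      coinv_class k V \<pi> (g <# H #> inv g) ` carrier V"
  proof -
    have "(\<lambda>v. \<pi> g ` coinv_class k V \<pi> H v) ` carrier V =
        coinv_class k V \<pi> (g <# H #> inv g) ` (\<pi> g ` carrier V)"
      by (simp add: image_image class_image[OF H g])
    then show ?thesis by (simp only: A.surj_prop[OF g])
  qed
  ultimately show ?thesis
    unfolding bij_betw_def coinv_carrier[OF H] coinv_carrier[OF H'] by (auto simp: image_image)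
qed

end

lemma localization_equivariant_sheaf:
  fixes G (structure)
  assumes "tree X"
    and vact: "group_action G (verts X) \<phi>"
    and eact: "group_action G (edges X) (edge_action X \<phi>)"
    and "plumbing_system G X \<phi> N"
    and "representation k G V \<pi>"
  shows "equivariant_sheaf k G X \<phi> (localization k G N V \<pi>)"
proof -
  interpret plumbing_system G X \<phi> N by fact
  interpret rep_setup k G V \<pi> by unfold_locales fact
  interpret VA: group_action G "verts X" \<phi> by fact
  interpret EA: group_action G "edges X" "edge_action X \<phi>" by fact
  have Ns: "N x \<subseteq> carrier G" if "x \<in> verts X" for x
    using is_subgroup[OF that] subgroup.subset by blast
  have ends: "\<exists>x y. e = {x, y} \<and> x \<noteq> y \<and> x \<in> verts X \<and> y \<in> verts X" if eX: "e \<in> edges X" for e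
  proof -
    have t: "\<forall>e\<in>edges X. e \<subseteq> verts X \<and> card e = 2"
      using \<open>tree X\<close> unfolding tree_def by (rule conjunct1)
    obtain x y where "e = {x, y}" "x \<noteq> y"
      using t eX card_2_iff[of e] by metis
    moreover have "e \<subseteq> verts X" using t eX by metis
    ultimately show ?thesis by blast
  qed
  have Ne: "edge_subgroup G N {x, y} = N x <#> N y" if "{x, y} \<in> edges X" for x y
    unfolding edge_subgroup_def
  proof (rule the_equality)
    show "\<exists>x' y'. {x, y} = {x', y'} \<and> N x <#> N y = N x' <#> N y'" by blast
  next
    fix H assume "\<exists>x' y'. {x, y} = {x', y'} \<and> H = N x' <#> N y'"
    then obtain x' y' where h: "{x, y} = {x', y'}" "H = N x' <#> N y'" by (elim exE conjE)
    from h(1) consider "x = x'" "y = y'" | "x = y'" "y = x'" by (auto simp: doubleton_eq_iff)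
    then show "H = N x <#> N y"
    proof cases
      case 1 with h show ?thesis by simp
    next
      case 2 show ?thesis unfolding h(2) 2[symmetric] by (rule locality[OF that, symmetric])
    qed
  qed
  have Nes: "edge_subgroup G N e \<subseteq> carrier G" if e: "e \<in> edges X" for e
  proof -
    obtain x y where "e = {x,y}" "x \<in> verts X" "y \<in> verts X" using ends[OF e] by blast
    then show ?thesis using Ne e Ns by (auto simp: set_mult_def subset_iff)
  qed
  have Nle: "N x \<subseteq> edge_subgroup G N e" if e: "e \<in> edges X" "x \<in> e" for x e
  proof -
    obtain y where y: "e = {x,y}" "x \<in> verts X" "y \<in> verts X" using ends[OF e(1)] e(2) by blast
    have "\<one> \<in> N y" using is_subgroup[OF y(3)] subgroup.one_closed by blast
    with y show ?thesis using Ne[of x y] e Ns[OF y(2)] by (force simp: set_mult_def)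
  qed
  have ge: "\<phi> g ` e \<in> edges X" if "g \<in> carrier G" "e \<in> edges X" for g e
    using EA.element_image[OF that(1,2) refl] that by (simp add: edge_action_def)
  have Neq: "g <# edge_subgroup G N e #> inv g = edge_subgroup G N (\<phi> g ` e)"
    if g: "g \<in> carrier G" and e: "e \<in> edges X" for g e
  proof -
    obtain x y where xy: "e = {x,y}" "x \<in> verts X" "y \<in> verts X" using ends[OF e] by blast
    have c: "g \<otimes> (a \<otimes> b) \<otimes> inv g = (g \<otimes> a \<otimes> inv g) \<otimes> (g \<otimes> b \<otimes> inv g)"
      if "a \<in> N x" "b \<in> N y" for a b
    proof -
      have ab: "a \<in> carrier G" "b \<in> carrier G" using that Ns xy by auto
      then have "inv g \<otimes> (g \<otimes> (b \<otimes> inv g)) = b \<otimes> inv g"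
        using g by (metis inv_closed m_assoc m_closed l_inv l_one)
      with ab g show ?thesis by (simp add: m_assoc)
    qed
    have "g <# (N x <#> N y) #> inv g = (g <# N x #> inv g) <#> (g <# N y #> inv g)"
      unfolding set_mult_def l_coset_def r_coset_def by (auto simp: c)
    also have "\<dots> = N (\<phi> g x) <#> N (\<phi> g y)"
      using equivariance g xy by simp
    finally show ?thesis using Ne[of x y] Ne[of "\<phi> g x" "\<phi> g y"] ge[OF g e] e xy by simp
  qed
  have inv: "x \<in> verts X" if "e \<in> edges X" "x \<in> e" for x e
    using ends[OF that(1)] that(2) by auto
  have idl: "(\<lambda>v. v) \<in> linear_maps k V V" by (auto simp: linear_maps_def hom_def)
  show ?thesis
  proof (rule equivariant_sheaf.intro, goal_cases)
    case (1 x) then show ?case by (simp add: localization_def coinv_module Ns)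
  next
    case (2 e) then show ?case by (simp add: localization_def coinv_module Nes)
  next
    case (3 e x)
    then show ?case unfolding localization_def
      by simp (rule class_linear[where t="\<lambda>v. v"], auto simp: Ns inv Nes idl res_class Nle)
  next
    case (4 g x)
    then show ?case unfolding localization_def
      using class_linear[OF Ns Ns _ lin, of x "\<phi> g x" "(`) (\<pi> g)" g] class_bij[OF Ns, of x g]
        class_image[OF Ns, of x g] VA.element_image[of g x]
      by (simp add: equivariance)
  next
    case (5 g e)
    then show ?case unfolding localization_def
      using class_linear[OF Nes Nes _ lin, of e "\<phi> g ` e" "(`) (\<pi> g)" g] class_bij[OF Nes, of e g]
        class_image[OF Nes, of e g] ge[of g e]
      by (simp add: Neq)
  next
    case (6 g e x s)
    have x: "x \<in> verts X" using inv 6 by blast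
    from 6 obtain v where v: "v \<in> carrier V" "s = coinv_class k V \<pi> (N x) v"
      by (auto simp: localization_def coinv_carrier Ns x)
    have gx: "\<phi> g x \<in> \<phi> g ` e" using 6 by auto
    show ?case
      using 6 v x gx ge[of g e] res_class[OF Nle Nes, of e x v]
        res_class[OF Nle Nes, of "\<phi> g ` e" "\<phi> g x" "\<pi> g v"]
        class_image[OF Ns, of x g v] class_image[OF Nes, of e g v]
      by (simp add: localization_def equivariance Neq)
  next
    case (7 g h x s)
    then obtain v where v: "v \<in> carrier V" "s = coinv_class k V \<pi> (N x) v"
      by (auto simp: localization_def coinv_carrier Ns)
    have "s \<subseteq> carrier V"
      using v 7 coset_subset[OF md aug_submodule[OF Ns]] by (simp add: coinv_class_def)
    with 7 show ?case
      by (auto simp: localization_def pi_mult subset_iff image_image intro!: image_cong)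
  next
    case (8 g h e s)
    then obtain v where v: "v \<in> carrier V" "s = coinv_class k V \<pi> (edge_subgroup G N e) v"
      by (auto simp: localization_def coinv_carrier Nes)
    have "s \<subseteq> carrier V"
      using v 8 coset_subset[OF md aug_submodule[OF Nes]] by (simp add: coinv_class_def)
    with 8 show ?case
      by (auto simp: localization_def pi_mult subset_iff image_image intro!: image_cong)
  qed
qed

end

theory Submission
  imports Defs
begin

text \<open>Write \<open>e\<^sub>x\<close> for the projection of \<open>V\<close> onto the invariants of \<open>N\<^sub>x\<close> along \<open>V[N\<^sub>x]\<close>. The proof has three
independent parts.

\<^bold>\<open>Localization.\<close> The projections at the endpoints of an edge commute, since \<open>N\<^sub>y\<close> fixes the neighbours of
\<open>y\<close>, and convexity gives \<open>e\<^sub>x e\<^sub>z = e\<^sub>x e\<^sub>y e\<^sub>z\<close> for \<open>y\<close> on the path from \<open>x\<close> to \<open>z\<close>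
(\<open>proj_commute\<close>, \<open>proj_through\<close>, \<open>proj_through_last\<close>). A compactly supported section is a family of
vectors \<open>s\<^sub>x\<close> in \<open>V\<^bsup>N\<^sub>x\<^esup>\<close> with \<open>e\<^sub>y s\<^sub>x = e\<^sub>x s\<^sub>y\<close> for every edge \<open>{x, y}\<close>, and these relations allow it
to be glued, one vertex of a finite subtree after the other, to a vector \<open>v\<close> with \<open>e\<^sub>x v = s\<^sub>x\<close> for all
\<open>x\<close> (\<open>glue\<close>). So every section comes from a vector of \<open>V\<close> (\<open>L_surj\<close>).

\<^bold>\<open>Independence of translates.\<close> Let \<open>B\<close> be a minimal support-ball of radius \<open>r\<close>. The support of a nonzero
section in \<open>B\<close> reaches the boundary of \<open>B\<close> in more than one direction, because otherwise it would lie in a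
ball of smaller radius or in a smaller ball of radius \<open>r\<close> (\<open>far_point_vertex\<close>, \<open>far_point_edge\<close>). Among
finitely many distinct translates of \<open>B\<close>, one has an extreme center: all other centers lie
on one side of an edge there. A nonzero section in that translate has a support point on the boundary
of the opposite side, which no other translate reaches (\<open>private_point\<close>). Hence a sum of sections in distinct
translates vanishes only if every summand does (\<open>translates_independent\<close>).

\<^bold>\<open>Compact induction.\<close> Let \<open>W\<close> be a subrepresentation for a subgroup \<open>K\<close> in an irreducible representation \<open>V\<close>
whose translates along distinct cosets of \<open>K\<close> are independent. The map from the compactly induced
representation to \<open>V\<close> is injective by independence. Its restriction to the functions with values in a
nonzero subrepresentation \<open>U\<close> of \<open>W\<close> is onto, because its image is a nonzero subrepresentation of \<open>V\<close>
(\<open>induced_map_onto\<close>). For \<open>U = W\<close> this is surjectivity; together with injectivity it also forces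
\<open>U = W\<close>, so \<open>W\<close> is irreducible.\<close>

section \<open>Distances in a tree\<close>

lemma simple_path_in_verts:
  "simple_path X x y p \<Longrightarrow> x \<in> verts X \<and> y \<in> verts X"
  unfolding simple_path_def by (metis hd_in_set last_in_set subset_iff)

lemma simple_path_rev:
  "simple_path X x y p \<Longrightarrow> simple_path X y x (rev p)"
  unfolding simple_path_def by (simp add: hd_rev last_rev insert_commute)

lemma simple_path_append:
  "\<lbrakk>simple_path X a x p; simple_path X y b q; {x, y} \<in> edges X; set p \<inter> set q = {}\<rbrakk>
    \<Longrightarrow> simple_path X a b (p @ q)"
  unfolding simple_path_def by (simp add: successively_append_iff)

lemma simple_path_prefix:
  "simple_path X a b (p @ t # q) \<Longrightarrow> simple_path X a t (p @ [t])"
  unfolding simple_path_def by (auto simp: successively_append_iff hd_append)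

lemma simple_path_suffix:
  "simple_path X a b (p @ t # q) \<Longrightarrow> simple_path X t b (t # q)"
  unfolding simple_path_def by (auto simp: successively_append_iff)

lemma simple_path_singleton: "x \<in> verts X \<Longrightarrow> simple_path X x x [x]"
  unfolding simple_path_def by simp

locale tree_graph =
  fixes X :: "'x graph"
  assumes is_tree: "tree X"
begin

lemma edge_endpoints:
  assumes "{x, y} \<in> edges X"
  shows "x \<in> verts X" "y \<in> verts X" "x \<noteq> y"
proof -
  have "{x, y} \<subseteq> verts X \<and> card {x, y} = 2"
    using is_tree assms unfolding tree_def by blast
  then show "x \<in> verts X" "y \<in> verts X" "x \<noteq> y" by (auto simp: card_insert_if split: if_splits)
qed

lemma edge_obtain:
  assumes "e \<in> edges X"
  obtains x y where "e = {x, y}"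
proof -
  have "card e = 2" using is_tree assms unfolding tree_def by blast
  then show ?thesis using that by (auto simp: card_2_iff)
qed

lemma edge_nonempty_finite:
  assumes "e \<in> edges X" shows "e \<noteq> {}" "finite e"
proof -
  obtain x y where "e = {x, y}" by (rule edge_obtain[OF assms])
  then show "e \<noteq> {}" "finite e" by auto
qed

lemma edge_obtain_other:
  assumes "e \<in> edges X" "x \<in> e"
  obtains y where "e = {x, y}"
proof -
  obtain a b where "e = {a, b}" by (rule edge_obtain[OF assms(1)])
  then show ?thesis using that[of a] that[of b] assms(2) by auto
qed

lemma unique_simple_path: "x \<in> verts X \<Longrightarrow> y \<in> verts X \<Longrightarrow> \<exists>!p. simple_path X x y p"
  using is_tree unfolding tree_def by (elim conjE) (rule bspec, erule bspec)

lemma tree_path_simple: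
  assumes "x \<in> verts X" "y \<in> verts X"
  shows "simple_path X x y (tree_path X x y)"
  unfolding tree_path_def using unique_simple_path[OF assms] by (rule theI')

lemma tree_path_eqI:
  assumes "simple_path X x y p" shows "tree_path X x y = p"
  unfolding tree_path_def using simple_path_in_verts[OF assms]
  by (intro the1_equality unique_simple_path assms) auto

lemma tree_path_nonempty: "x \<in> verts X \<Longrightarrow> y \<in> verts X \<Longrightarrow> tree_path X x y \<noteq> []"
  using tree_path_simple[of x y] unfolding simple_path_def by blast

lemma endpoints_in_tree_path:
  assumes "x \<in> verts X" "y \<in> verts X"
  shows "x \<in> set (tree_path X x y)" "y \<in> set (tree_path X x y)"
  using tree_path_simple[OF assms] unfolding simple_path_def by (metis hd_in_set last_in_set)+

lemma tree_path_subset: "x \<in> verts X \<Longrightarrow> y \<in> verts X \<Longrightarrow> set (tree_path X x y) \<subseteq> verts X"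
  using tree_path_simple[of x y] unfolding simple_path_def by blast

lemma tree_path_rev:
  "x \<in> verts X \<Longrightarrow> y \<in> verts X \<Longrightarrow> tree_path X y x = rev (tree_path X x y)"
  by (rule tree_path_eqI[OF simple_path_rev[OF tree_path_simple]])

lemma tree_dist_commute: "x \<in> verts X \<Longrightarrow> y \<in> verts X \<Longrightarrow> tree_dist X x y = tree_dist X y x"
  unfolding tree_dist_def by (simp add: tree_path_rev[of x y])

lemma tree_dist_self [simp]: "x \<in> verts X \<Longrightarrow> tree_dist X x x = 0"
  unfolding tree_dist_def using tree_path_eqI[OF simple_path_singleton] by simp

lemma tree_dist_eq_0: "x \<in> verts X \<Longrightarrow> y \<in> verts X \<Longrightarrow> tree_dist X x y = 0 \<longleftrightarrow> x = y"
proof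
  assume v: "x \<in> verts X" "y \<in> verts X" and "tree_dist X x y = 0"
  then have "length (tree_path X x y) = 1"
    using tree_path_nonempty[OF v] unfolding tree_dist_def by (cases "tree_path X x y") auto
  then obtain a where "tree_path X x y = [a]" by (metis One_nat_def length_0_conv length_Suc_conv)
  then show "x = y" using tree_path_simple[OF v] unfolding simple_path_def by auto
qed simp

text \<open>Prepending \<open>y\<close> to a path that avoids it gives a path again. So one of the two endpoints of an
  edge lies on the path from the other one to \<open>z\<close>, and their distances to \<open>z\<close> differ by one.\<close>

lemma edge_path_step:
  assumes e: "{x, y} \<in> edges X" and z: "z \<in> verts X" and "y \<notin> set (tree_path X x z)"
  shows "tree_path X y z = y # tree_path X x z"
    "tree_dist X y z = Suc (tree_dist X x z)"
proof -
  note v = edge_endpoints[OF e]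
  have "simple_path X y z ([y] @ tree_path X x z)"
    using simple_path_append[OF simple_path_singleton[OF v(2)] tree_path_simple[OF v(1) z]]
      e assms(3) by (simp add: insert_commute)
  then show *: "tree_path X y z = y # tree_path X x z" using tree_path_eqI by simp
  show "tree_dist X y z = Suc (tree_dist X x z)"
    unfolding tree_dist_def * using tree_path_nonempty[OF v(1) z] by (cases "tree_path X x z") auto
qed

lemma edge_path_avoids:
  assumes e: "{x, y} \<in> edges X" and z: "z \<in> verts X" and "y \<in> set (tree_path X x z)"
  shows "x \<notin> set (tree_path X y z)"
proof
  note v = edge_endpoints[OF e]
  assume x: "x \<in> set (tree_path X y z)"
  obtain p q where p: "tree_path X x z = p @ y # q" using assms(3) by (meson split_list)
  have yq: "tree_path X y z = y # q"
    using tree_path_eqI simple_path_suffix tree_path_simple[OF v(1) z] p by metis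
  have "x \<in> set q" using x v(3) yq by simp
  moreover have "x \<in> set p"
    using tree_path_simple[OF v(1) z] v(3) unfolding p simple_path_def
    by (cases p) auto
  moreover have "distinct (p @ y # q)"
    using tree_path_simple[OF v(1) z] unfolding p simple_path_def by blast
  ultimately show False by auto
qed

lemma edge_path_iff:
  assumes e: "{x, y} \<in> edges X" and z: "z \<in> verts X"
  shows "y \<in> set (tree_path X x z) \<longleftrightarrow> tree_dist X y z < tree_dist X x z"
proof
  assume "y \<in> set (tree_path X x z)"
  from edge_path_step(2)[OF _ z edge_path_avoids[OF e z this]] e
  show "tree_dist X y z < tree_dist X x z" by (simp add: insert_commute)
next
  assume "tree_dist X y z < tree_dist X x z"
  then show "y \<in> set (tree_path X x z)" using edge_path_step(2)[OF e z] by fastforce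
qed

lemma edge_dist_cases:
  assumes e: "{x, y} \<in> edges X" and z: "z \<in> verts X"
  obtains "tree_dist X y z = Suc (tree_dist X x z)" | "tree_dist X x z = Suc (tree_dist X y z)"
proof (cases "y \<in> set (tree_path X x z)")
  case True
  then show ?thesis
    using edge_path_step(2)[OF _ z edge_path_avoids[OF e z]] e that by (simp add: insert_commute)
next
  case False
  then show ?thesis using edge_path_step(2)[OF e z] that by blast
qed

text \<open>Removing an edge \<open>{x, y}\<close> leaves two halves, the vertices closer to \<open>x\<close> and those closer to
  \<open>y\<close>. A path from one half to the other crosses the edge: the paths from \<open>a\<close> to \<open>x\<close> and from \<open>y\<close>
  to \<open>b\<close> stay in their halves, so they are disjoint and can be joined.\<close>

lemma path_across_edge:
  assumes e: "{x, y} \<in> edges X" and a: "a \<in> verts X" and b: "b \<in> verts X"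
    and ax: "tree_dist X x a < tree_dist X y a" and yb: "tree_dist X y b < tree_dist X x b"
  shows "tree_path X a b = tree_path X a x @ tree_path X y b"
    and dist_across_edge: "tree_dist X a b = tree_dist X a x + 1 + tree_dist X y b"
proof -
  note v = edge_endpoints[OF e]
  have e': "{y, x} \<in> edges X" using e by (simp add: insert_commute)
  have half: "tree_dist X x' t < tree_dist X y' t"
    if h: "{x', y'} \<in> edges X" "c \<in> verts X" "tree_dist X x' c < tree_dist X y' c"
      "t \<in> set (tree_path X x' c)" for x' y' c t
  proof -
    note v' = edge_endpoints[OF h(1)]
    obtain p q where p: "tree_path X x' c = p @ t # q" using h(4) by (meson split_list)
    have t: "t \<in> verts X" using h(4) tree_path_subset[OF v'(1) h(2)] by blast
    have "tree_path X x' t = p @ [t]"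
      using tree_path_eqI simple_path_prefix tree_path_simple[OF v'(1) h(2)] p by metis
    moreover have "y' \<notin> set (tree_path X x' c)" using edge_path_iff[OF h(1,2)] h(3) by simp
    ultimately have "y' \<notin> set (tree_path X x' t)" using p by auto
    then show ?thesis using edge_path_step(2)[OF h(1) t] by simp
  qed
  have "set (tree_path X a x) \<inter> set (tree_path X y b) = {}"
  proof (intro equals0I, elim IntE)
    fix t assume "t \<in> set (tree_path X a x)" "t \<in> set (tree_path X y b)"
    then have "tree_dist X x t < tree_dist X y t" "tree_dist X y t < tree_dist X x t"
      using half[OF e a ax, of t] half[OF e' b yb, of t] tree_path_rev[OF v(1) a] by auto
    then show False by simp
  qed
  then have "simple_path X a b (tree_path X a x @ tree_path X y b)"
    using simple_path_append[OF tree_path_simple[OF a v(1)] tree_path_simple[OF v(2) b] e] by blast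
  then show *: "tree_path X a b = tree_path X a x @ tree_path X y b" by (rule tree_path_eqI)
  show "tree_dist X a b = tree_dist X a x + 1 + tree_dist X y b"
    unfolding tree_dist_def *
    using tree_path_nonempty[OF a v(1)] tree_path_nonempty[OF v(2) b]
    by (cases "tree_path X a x"; cases "tree_path X y b") auto
qed

lemma tree_dist_edge:
  assumes e: "{x, y} \<in> edges X" shows "tree_dist X x y = 1"
  using edge_endpoints[OF e] by (cases rule: edge_dist_cases[OF e, of y]) auto

lemma first_step:
  assumes x: "x \<in> verts X" and z: "z \<in> verts X" and "x \<noteq> z"
  obtains y where "{x, y} \<in> edges X" "tree_dist X x z = Suc (tree_dist X y z)"
proof -
  have s: "simple_path X x z (tree_path X x z)" by (rule tree_path_simple[OF x z])
  then obtain p where p: "tree_path X x z = x # p"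
    unfolding simple_path_def by (cases "tree_path X x z") auto
  then obtain y q where q: "tree_path X x z = [x] @ y # q"
    using s \<open>x \<noteq> z\<close> unfolding simple_path_def by (cases p) auto
  have xy: "{x, y} \<in> edges X" using s unfolding q simple_path_def by simp
  moreover have "tree_dist X y z < tree_dist X x z" using edge_path_iff[OF xy z] q by simp
  ultimately show ?thesis using that[of y] by (cases rule: edge_dist_cases[OF xy z]) auto
qed

lemma tree_path_initial:
  assumes x: "x \<in> verts X" and z: "z \<in> verts X" and t: "t \<in> set (tree_path X x z)"
  shows "set (tree_path X x t) \<subseteq> set (tree_path X x z)"
    and "t \<noteq> z \<Longrightarrow> tree_dist X x t < tree_dist X x z"
proof -
  have s: "simple_path X x z (tree_path X x z)" by (rule tree_path_simple[OF x z])
  obtain p q where p: "tree_path X x z = p @ t # q" using t by (meson split_list)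
  have t: "tree_path X x t = p @ [t]" using tree_path_eqI simple_path_prefix s p by metis
  show "set (tree_path X x t) \<subseteq> set (tree_path X x z)" unfolding p t by auto
  show "tree_dist X x t < tree_dist X x z" if "t \<noteq> z"
    using that s unfolding tree_dist_def p t simple_path_def by (cases q) auto
qed

text \<open>Take \<open>c\<close> at maximal distance from some vertex \<open>z0\<close> of \<open>C\<close>, and let \<open>y\<close> be the next vertex
  towards \<open>z0\<close>. A vertex of \<open>C\<close> on the other side of the edge \<open>{c, y}\<close> would be farther from \<open>z0\<close>. If \<open>C\<close> is
  a singleton, any edge at \<open>c\<close> will do.\<close>

lemma extreme_vertex:
  assumes "finite C" "C \<noteq> {}" "C \<subseteq> verts X" and ne: "edges X \<noteq> {}"
  obtains c y where "c \<in> C" "{c, y} \<in> edges X"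
    "\<And>c'. \<lbrakk>c' \<in> C; c' \<noteq> c\<rbrakk> \<Longrightarrow> tree_dist X y c' < tree_dist X c c'"
proof -
  obtain z0 where z0: "z0 \<in> C" using assms(2) by blast
  have z0v: "z0 \<in> verts X" using z0 assms(3) by blast
  let ?m = "Max (tree_dist X z0 ` C)"
  have "?m \<in> tree_dist X z0 ` C" using assms(1,2) by (intro Max_in) auto
  then obtain c where c: "c \<in> C" "tree_dist X z0 c = ?m" by (metis imageE)
  have max: "tree_dist X z0 c' \<le> tree_dist X z0 c" if "c' \<in> C" for c'
    unfolding c(2) using that assms(1) by (intro Max_ge) auto
  have cv: "c \<in> verts X" using c assms(3) by blast
  show ?thesis
  proof (cases "c = z0")
    case True
    have all: "c' = c" if "c' \<in> C" for c'
      using max[OF that] tree_dist_eq_0[OF z0v, of c'] True z0v assms(3) that by auto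
    obtain e where e: "e \<in> edges X" using ne by blast
    obtain a b where ab: "e = {a, b}" using edge_obtain[OF e] .
    obtain d where d: "d \<in> verts X" "c \<noteq> d"
      using edge_endpoints[of a b] e ab by (cases "c = a") auto
    obtain y where y: "{c, y} \<in> edges X" by (rule first_step[OF cv d])
    show ?thesis by (rule that[OF c(1) y]) (use all in blast)
  next
    case False
    obtain y where y: "{c, y} \<in> edges X" "tree_dist X c z0 = Suc (tree_dist X y z0)"
      by (rule first_step[OF cv z0v False])
    have beyond: "tree_dist X y c' < tree_dist X c c'" if c': "c' \<in> C" "c' \<noteq> c" for c'
    proof (rule ccontr)
      have c'v: "c' \<in> verts X" using c' assms(3) by blast
      note v = edge_endpoints[OF y(1)]
      assume "\<not> ?thesis"
      then have "tree_dist X c c' < tree_dist X y c'"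
        by (cases rule: edge_dist_cases[OF y(1) c'v]) auto
      then have "tree_dist X c' z0 = tree_dist X c' c + 1 + tree_dist X y z0"
        using dist_across_edge[OF y(1) c'v z0v] y(2) by simp
      moreover have "tree_dist X c' c \<noteq> 0" using tree_dist_eq_0[OF c'v cv] c' by simp
      ultimately have "tree_dist X c z0 < tree_dist X c' z0" using y(2) by simp
      then show False using max[OF c'(1)] tree_dist_commute[OF z0v cv] tree_dist_commute[OF z0v c'v] by linarith
    qed
    show ?thesis by (rule that[OF c(1) y(1) beyond])
  qed
qed

text \<open>The analogue for edges: \<open>y\<close> is an endpoint at maximal distance from some endpoint \<open>z0\<close>, and \<open>{x, y}\<close> is an
  edge of \<open>D\<close> at \<open>y\<close>. The other edges of \<open>D\<close> lie on the side of \<open>x\<close>.\<close>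

lemma extreme_edge:
  assumes "finite D" "D \<noteq> {}" "D \<subseteq> edges X"
  obtains x y where "{x, y} \<in> D"
    "\<And>e a. \<lbrakk>e \<in> D; e \<noteq> {x, y}; a \<in> e\<rbrakk> \<Longrightarrow> tree_dist X x a < tree_dist X y a"
proof -
  have fin: "finite (\<Union>D)"
    using assms edge_nonempty_finite(2) by (intro finite_Union) auto
  have Dv: "a \<in> verts X" if "a \<in> \<Union>D" for a
    using that assms(3) is_tree unfolding tree_def by blast
  have ne: "\<Union>D \<noteq> {}" using assms(2,3) edge_nonempty_finite(1) by blast
  then obtain z0 where "z0 \<in> \<Union>D" by blast
  then have z0v: "z0 \<in> verts X" by (rule Dv)
  let ?m = "Max (tree_dist X z0 ` \<Union>D)"
  have "?m \<in> tree_dist X z0 ` \<Union>D" using fin ne by (intro Max_in) auto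
  then obtain y where y: "y \<in> \<Union>D" "tree_dist X z0 y = ?m" by (metis imageE)
  have max: "tree_dist X z0 a \<le> tree_dist X z0 y" if "a \<in> \<Union>D" for a
    unfolding y(2) using that fin by (intro Max_ge) auto
  obtain e where e': "e \<in> D" "y \<in> e" using y(1) by blast
  then have eX: "e \<in> edges X" using assms(3) by blast
  obtain x where "e = {y, x}" by (rule edge_obtain_other[OF eX e'(2)])
  then have e: "e \<in> D" "e = {x, y}" using e' by auto
  have xy: "{x, y} \<in> edges X" using e assms(3) by blast
  note v = edge_endpoints[OF xy]
  have oxy: "tree_dist X x z0 < tree_dist X y z0"
    using max[of x] e tree_dist_commute[OF z0v v(1)] tree_dist_commute[OF z0v v(2)]
    by (cases rule: edge_dist_cases[OF xy z0v]) auto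
  \<comment> \<open>An endpoint beyond \<open>y\<close> would be farther from \<open>z0\<close> than \<open>y\<close>.\<close>
  have far: "a = y" if a: "a \<in> \<Union>D" "\<not> tree_dist X x a < tree_dist X y a" for a
  proof -
    have av: "a \<in> verts X" using Dv a by blast
    have "tree_dist X y a < tree_dist X x a" using a(2) by (cases rule: edge_dist_cases[OF xy av]) auto
    then have "tree_dist X z0 a = tree_dist X z0 x + 1 + tree_dist X y a"
      using dist_across_edge[OF xy z0v av oxy] by simp
    moreover have "tree_dist X z0 y = tree_dist X z0 x + 1"
      using oxy tree_dist_commute[OF z0v v(1)] tree_dist_commute[OF z0v v(2)]
      by (cases rule: edge_dist_cases[OF xy z0v]) auto
    ultimately show ?thesis using max[OF a(1)] tree_dist_eq_0[OF v(2) av] by simp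
  qed
  have near: "tree_dist X x a < tree_dist X y a" if e': "e' \<in> D" "e' \<noteq> {x, y}" "a \<in> e'" for e' a
  proof (rule ccontr)
    assume "\<not> ?thesis"
    then have ay: "a = y" using far e' by blast
    \<comment> \<open>The only edge from \<open>y\<close> to the side of \<open>x\<close> is \<open>{x, y}\<close> itself.\<close>
    have "e' \<in> edges X" "y \<in> e'" using e' ay assms(3) by auto
    then obtain b where "e' = {y, b}" by (rule edge_obtain_other)
    then have b: "e' = {b, y}" by auto
    have be: "{b, y} \<in> edges X" using b e' assms(3) by blast
    note vb = edge_endpoints[OF be]
    have "tree_dist X x b < tree_dist X y b" using far[of b] b e' vb by blast
    then have "tree_dist X b y = tree_dist X b x + 1 + tree_dist X y y"
      using dist_across_edge[OF xy vb(1) v(2)] tree_dist_edge[OF xy] v by simp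
    then have "b = x" using tree_dist_edge[OF be] tree_dist_eq_0[OF vb(1) v(1)] by simp
    then show False using b e' by simp
  qed
  show ?thesis by (rule that[of x y]) (use e near in auto)
qed

end

section \<open>Invariants and coinvariants\<close>

context rep_setup
begin

lemma pi_one: "v \<in> carrier V \<Longrightarrow> \<pi> \<one> v = v"
  using fun_cong[OF A.id_eq_one, of v] by simp

lemma inv_submodule: "H \<subseteq> carrier G \<Longrightarrow> submodule (inv_space V \<pi> H) k V"
  by (rule submoduleI) (auto simp: inv_space_def subset_iff pi_zero pi_neg pi_add pi_smult)

lemma submodule_zero: "submodule U k V \<Longrightarrow> \<zero>\<^bsub>V\<^esub> \<in> U"
  using submodule.axioms(1) subgroup.one_closed by fastforce

lemma aug_space_least:
  assumes "submodule U k V" "\<And>h v. h \<in> H \<Longrightarrow> v \<in> carrier V \<Longrightarrow> \<pi> h v \<ominus>\<^bsub>V\<^esub> v \<in> U"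
  shows "aug_space k V \<pi> H \<subseteq> U"
  unfolding aug_space_def using assms(2) by (intro linear_span_least[OF assms(1)]) blast

lemma aug_space_generator:
  "h \<in> H \<Longrightarrow> v \<in> carrier V \<Longrightarrow> \<pi> h v \<ominus>\<^bsub>V\<^esub> v \<in> aug_space k V \<pi> H"
  unfolding aug_space_def by (intro subsetD[OF linear_span_superset]) blast

lemma class_zero_iff:
  assumes H: "H \<subseteq> carrier G" and v: "v \<in> carrier V"
  shows "coinv_class k V \<pi> H v = \<zero>\<^bsub>coinvariants k V \<pi> H\<^esub> \<longleftrightarrow> v \<in> aug_space k V \<pi> H"
proof -
  note s = aug_submodule[OF H]
  have z: "\<zero>\<^bsub>coinvariants k V \<pi> H\<^esub> = aug_space k V \<pi> H"
    by (simp add: coinvariants_def quotient_module_def)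
  have "aug_space k V \<pi> H +>\<^bsub>V\<^esub> \<zero>\<^bsub>V\<^esub> = aug_space k V \<pi> H"
    using M.a_coset_add_zero[OF submoduleE(1)[OF s]] .
  then show ?thesis
    unfolding z coinv_class_def using mem_coset_self[OF md s v] coset_eq_if_mem[OF md s, of v "\<zero>\<^bsub>V\<^esub>"] by auto
qed

lemma class_zero: "H \<subseteq> carrier G \<Longrightarrow> coinv_class k V \<pi> H \<zero>\<^bsub>V\<^esub> = \<zero>\<^bsub>coinvariants k V \<pi> H\<^esub>"
  using class_zero_iff[of H "\<zero>\<^bsub>V\<^esub>"] submodule_zero[OF aug_submodule] by simp

lemma class_eq_imp:
  assumes H: "H \<subseteq> carrier G" and v: "v \<in> carrier V"
    and "coinv_class k V \<pi> H v = coinv_class k V \<pi> H w"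
  obtains a where "a \<in> aug_space k V \<pi> H" "v = a \<oplus>\<^bsub>V\<^esub> w"
  using mem_coset_self[OF md aug_submodule[OF H] v] assms(3) that
  unfolding coinv_class_def a_r_coset_def' by auto

lemma submodule_finsum:
  assumes U: "submodule U k V" and "\<And>a. a \<in> A \<Longrightarrow> f a \<in> U"
  shows "finsum V f A \<in> U"
  using assms(2)
proof (induction A rule: infinite_finite_induct)
  case (insert a A)
  then have "f \<in> A \<rightarrow> carrier V" "f a \<in> carrier V" using submoduleE(1)[OF U] by auto
  then show ?case using insert submoduleE(5)[OF U] by (simp add: M.finsum_insert)
qed (use submodule_zero[OF U] in auto)

end

section \<open>The projections onto the invariants of a plumbing system\<close>

locale plumbed_representation =
  tree_graph X + rep_setup k G V \<pi> + plumbing_system G X \<phi> N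
  for k :: "'k ring" and G :: "'g monoid" (structure) and X :: "'x graph"
    and \<phi> :: "'g \<Rightarrow> 'x \<Rightarrow> 'x" and N :: "'x \<Rightarrow> 'g set"
    and V :: "('k, 'v) module" and \<pi> :: "'g \<Rightarrow> 'v \<Rightarrow> 'v" +
  assumes vertex_action: "group_action G (verts X) \<phi>"
    and edges_action: "group_action G (edges X) (edge_action X \<phi>)"
    and characteristic: "N_characteristic k X N V \<pi>"
begin

sublocale vertices: group_action G "verts X" \<phi> by (rule vertex_action)

abbreviation Inv :: "'x \<Rightarrow> 'v set" where "Inv x \<equiv> inv_space V \<pi> (N x)"
abbreviation Aug :: "'x \<Rightarrow> 'v set" where "Aug x \<equiv> aug_space k V \<pi> (N x)"

lemma vertex_image: "g \<in> carrier G \<Longrightarrow> x \<in> verts X \<Longrightarrow> \<phi> g x \<in> verts X"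
  using vertices.element_image by blast

lemma edge_image: "g \<in> carrier G \<Longrightarrow> e \<in> edges X \<Longrightarrow> \<phi> g ` e \<in> edges X"
  using group_action.element_image[OF edges_action, of g e] by (simp add: edge_action_def)

lemma vertex_image_inv:
  "g \<in> carrier G \<Longrightarrow> x \<in> verts X \<Longrightarrow> \<phi> (inv g) (\<phi> g x) = x"
  "g \<in> carrier G \<Longrightarrow> x \<in> verts X \<Longrightarrow> \<phi> g (\<phi> (inv g) x) = x"
  using vertices.orbit_sym_aux[of g x] vertices.orbit_sym_aux[of "inv g" x] by simp_all

lemma N_carrier: "x \<in> verts X \<Longrightarrow> N x \<subseteq> carrier G"
  using is_subgroup subgroup.subset by blast

lemmas Inv_submodule = inv_submodule[OF N_carrier]
lemmas Aug_submodule = aug_submodule[OF N_carrier]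
lemmas Inv_carrier = submoduleE(1)[OF Inv_submodule, THEN subsetD]
lemmas Aug_carrier = submoduleE(1)[OF Aug_submodule, THEN subsetD]

lemma Inv_Aug_unique:
  assumes x: "x \<in> verts X" and "u \<in> Inv x" "a \<in> Aug x" "u' \<in> Inv x" "a' \<in> Aug x"
    and eq: "u \<oplus>\<^bsub>V\<^esub> a = u' \<oplus>\<^bsub>V\<^esub> a'"
  shows "u = u'"
proof -
  have c: "u \<in> carrier V" "u' \<in> carrier V" "a \<in> carrier V" "a' \<in> carrier V"
    using assms Inv_carrier Aug_carrier by blast+
  have "u = u' \<oplus>\<^bsub>V\<^esub> a' \<ominus>\<^bsub>V\<^esub> a"
    unfolding eq[symmetric] using c by (simp add: M.minus_eq M.a_assoc M.r_neg)
  also have "\<dots> = (a' \<ominus>\<^bsub>V\<^esub> a) \<oplus>\<^bsub>V\<^esub> u'" using c by (simp add: M.minus_eq M.a_ac)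
  finally have "u \<ominus>\<^bsub>V\<^esub> u' = (a' \<ominus>\<^bsub>V\<^esub> a) \<oplus>\<^bsub>V\<^esub> u' \<ominus>\<^bsub>V\<^esub> u'" by simp
  also have "\<dots> = a' \<ominus>\<^bsub>V\<^esub> a" using c by (simp add: M.minus_eq M.a_assoc M.r_neg)
  finally have d: "u \<ominus>\<^bsub>V\<^esub> u' = a' \<ominus>\<^bsub>V\<^esub> a" .
  have "u \<ominus>\<^bsub>V\<^esub> u' \<in> Inv x"
    using submoduleE(3,5)[OF Inv_submodule[OF x]] assms unfolding M.minus_eq by blast
  moreover have "a' \<ominus>\<^bsub>V\<^esub> a \<in> Aug x"
    using submoduleE(3,5)[OF Aug_submodule[OF x]] assms unfolding M.minus_eq by blast
  ultimately have "u \<ominus>\<^bsub>V\<^esub> u' = \<zero>\<^bsub>V\<^esub>"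
    using characteristic x d unfolding N_characteristic_def characteristic_for_def by auto
  moreover have "u = (u \<ominus>\<^bsub>V\<^esub> u') \<oplus>\<^bsub>V\<^esub> u'" using c by (simp add: M.minus_eq M.a_assoc M.l_neg)
  ultimately show "u = u'" using c by simp
qed

text \<open>The projection \<open>e\<^sub>x\<close> onto the invariants of \<open>N\<^sub>x\<close> along \<open>V[N\<^sub>x]\<close>. Its values represent the elements of
  the stalk at \<open>x\<close> by vectors of \<open>V\<close>.\<close>

definition proj :: "'x \<Rightarrow> 'v \<Rightarrow> 'v" where
  "proj x v = (THE u. u \<in> Inv x \<and> (\<exists>a\<in>Aug x. v = u \<oplus>\<^bsub>V\<^esub> a))"

lemma proj_eqI:
  assumes x: "x \<in> verts X" and "u \<in> Inv x" "a \<in> Aug x"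
  shows "proj x (u \<oplus>\<^bsub>V\<^esub> a) = u"
  unfolding proj_def using assms Inv_Aug_unique[OF x] by (intro the_equality) blast+

lemma proj_obtain:
  assumes x: "x \<in> verts X" and v: "v \<in> carrier V"
  obtains a where "a \<in> Aug x" "v = proj x v \<oplus>\<^bsub>V\<^esub> a" "proj x v \<in> Inv x"
proof -
  have "v \<in> Inv x <+>\<^bsub>V\<^esub> Aug x"
    using characteristic x v unfolding N_characteristic_def characteristic_for_def by blast
  then obtain u a where "u \<in> Inv x" "a \<in> Aug x" "v = u \<oplus>\<^bsub>V\<^esub> a"
    unfolding set_add_def set_mult_def by auto
  then show ?thesis using that proj_eqI[OF x] by metis
qed

lemma proj_Inv: "x \<in> verts X \<Longrightarrow> v \<in> carrier V \<Longrightarrow> proj x v \<in> Inv x"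
  using proj_obtain by blast

lemma proj_closed [simp]: "x \<in> verts X \<Longrightarrow> v \<in> carrier V \<Longrightarrow> proj x v \<in> carrier V"
  using proj_Inv Inv_carrier by blast

lemma proj_of_Inv:
  assumes x: "x \<in> verts X" and u: "u \<in> Inv x" shows "proj x u = u"
  using proj_eqI[OF x u submodule_zero[OF Aug_submodule[OF x]]] Inv_carrier[OF x u] by simp

lemma proj_zero_iff:
  assumes x: "x \<in> verts X" and v: "v \<in> carrier V"
  shows "proj x v = \<zero>\<^bsub>V\<^esub> \<longleftrightarrow> v \<in> Aug x"
proof
  obtain a where a: "a \<in> Aug x" "v = proj x v \<oplus>\<^bsub>V\<^esub> a" by (rule proj_obtain[OF x v])
  assume "proj x v = \<zero>\<^bsub>V\<^esub>"
  then show "v \<in> Aug x" using a Aug_carrier[OF x a(1)] by simp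
next
  assume "v \<in> Aug x"
  then show "proj x v = \<zero>\<^bsub>V\<^esub>"
    using proj_eqI[OF x submodule_zero[OF Inv_submodule[OF x]], of v] v by simp
qed

lemma proj_add:
  assumes x: "x \<in> verts X" and v: "v \<in> carrier V" and w: "w \<in> carrier V"
  shows "proj x (v \<oplus>\<^bsub>V\<^esub> w) = proj x v \<oplus>\<^bsub>V\<^esub> proj x w"
proof -
  obtain a where a: "a \<in> Aug x" "v = proj x v \<oplus>\<^bsub>V\<^esub> a" "proj x v \<in> Inv x" by (rule proj_obtain[OF x v])
  obtain b where b: "b \<in> Aug x" "w = proj x w \<oplus>\<^bsub>V\<^esub> b" "proj x w \<in> Inv x" by (rule proj_obtain[OF x w])
  have c: "a \<in> carrier V" "b \<in> carrier V" using a b Aug_carrier[OF x] by blast+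
  have "v \<oplus>\<^bsub>V\<^esub> w = (proj x v \<oplus>\<^bsub>V\<^esub> a) \<oplus>\<^bsub>V\<^esub> (proj x w \<oplus>\<^bsub>V\<^esub> b)" using a(2) b(2) by simp
  also have "\<dots> = (proj x v \<oplus>\<^bsub>V\<^esub> proj x w) \<oplus>\<^bsub>V\<^esub> (a \<oplus>\<^bsub>V\<^esub> b)" using c x v w by (simp add: M.a_ac)
  finally show ?thesis
    using proj_eqI[OF x] submoduleE(5)[OF Inv_submodule[OF x]] submoduleE(5)[OF Aug_submodule[OF x]]
      a b by metis
qed

lemma proj_smult:
  assumes x: "x \<in> verts X" and v: "v \<in> carrier V" and c: "c \<in> carrier k"
  shows "proj x (c \<odot>\<^bsub>V\<^esub> v) = c \<odot>\<^bsub>V\<^esub> proj x v"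
proof -
  obtain a where a: "a \<in> Aug x" "v = proj x v \<oplus>\<^bsub>V\<^esub> a" "proj x v \<in> Inv x" by (rule proj_obtain[OF x v])
  have "a \<in> carrier V" using a Aug_carrier[OF x] by blast
  then have "c \<odot>\<^bsub>V\<^esub> v = c \<odot>\<^bsub>V\<^esub> proj x v \<oplus>\<^bsub>V\<^esub> c \<odot>\<^bsub>V\<^esub> a" using a x v c by (metis proj_closed smult_r_distr)
  then show ?thesis
    using proj_eqI[OF x] submoduleE(4)[OF Inv_submodule[OF x] c] submoduleE(4)[OF Aug_submodule[OF x] c] a
    by metis
qed

lemma proj_zero: "x \<in> verts X \<Longrightarrow> proj x \<zero>\<^bsub>V\<^esub> = \<zero>\<^bsub>V\<^esub>"
  using proj_zero_iff submodule_zero[OF Aug_submodule] by simp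

lemma proj_neg: "x \<in> verts X \<Longrightarrow> v \<in> carrier V \<Longrightarrow> proj x (\<ominus>\<^bsub>V\<^esub> v) = \<ominus>\<^bsub>V\<^esub> proj x v"
  using proj_add[of x "\<ominus>\<^bsub>V\<^esub> v" v] by (simp add: M.l_neg proj_zero M.minus_equality)

lemma kernel_submodule:
  assumes "x \<in> verts X" "y \<in> verts X"
  shows "submodule {v \<in> carrier V. proj x (proj y v) = \<zero>\<^bsub>V\<^esub>} k V"
  using assms by (intro submoduleI) (auto simp: proj_zero proj_neg proj_add proj_smult)

lemma equalizer_submodule:
  assumes "x \<in> verts X" "y \<in> verts X"
  shows "submodule {v \<in> carrier V. proj x (proj y v) = proj x v} k V"
  using assms by (intro submoduleI) (auto simp: proj_zero proj_neg proj_add proj_smult)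

lemma class_proj:
  assumes x: "x \<in> verts X" and v: "v \<in> carrier V"
  shows "coinv_class k V \<pi> (N x) (proj x v) = coinv_class k V \<pi> (N x) v"
proof -
  obtain a where a: "a \<in> Aug x" "v = proj x v \<oplus>\<^bsub>V\<^esub> a" by (rule proj_obtain[OF x v])
  have "v = a \<oplus>\<^bsub>V\<^esub> proj x v" using a Aug_carrier[OF x a(1)] x v by (metis M.a_comm proj_closed)
  then have "v \<in> Aug x +>\<^bsub>V\<^esub> proj x v" using a(1) unfolding a_r_coset_def' by auto
  then show ?thesis
    unfolding coinv_class_def using coset_eq_if_mem[OF md Aug_submodule[OF x]] x v by simp
qed

lemma Inv_image:
  assumes g: "g \<in> carrier G" and x: "x \<in> verts X" and u: "u \<in> Inv x"
  shows "\<pi> g u \<in> Inv (\<phi> g x)"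
proof -
  have "\<pi> n (\<pi> g u) = \<pi> g u" if n: "n \<in> N (\<phi> g x)" for n
  proof -
    obtain m where m: "m \<in> N x" "n = g \<otimes> m \<otimes> inv g"
      using n equivariance[OF g x] unfolding l_coset_def r_coset_def by auto
    have "m \<in> carrier G" using m N_carrier[OF x] by blast
    then have "\<pi> n (\<pi> g u) = \<pi> g (\<pi> m u)"
      using m g Inv_carrier[OF x u] by (simp add: pi_mult G.m_assoc)
    then show ?thesis using m u unfolding inv_space_def by simp
  qed
  then show ?thesis using g Inv_carrier[OF x u] unfolding inv_space_def by simp
qed

lemma Aug_image:
  assumes g: "g \<in> carrier G" and x: "x \<in> verts X" and a: "a \<in> Aug x"
  shows "\<pi> g a \<in> Aug (\<phi> g x)"
  using aug_image_subset[OF N_carrier[OF x] g] equivariance[OF g x] a by auto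

lemma proj_equivariant:
  assumes g: "g \<in> carrier G" and x: "x \<in> verts X" and v: "v \<in> carrier V"
  shows "proj (\<phi> g x) (\<pi> g v) = \<pi> g (proj x v)"
proof -
  obtain a where a: "a \<in> Aug x" "v = proj x v \<oplus>\<^bsub>V\<^esub> a" "proj x v \<in> Inv x" by (rule proj_obtain[OF x v])
  have "\<pi> g v = \<pi> g (proj x v) \<oplus>\<^bsub>V\<^esub> \<pi> g a"
    using a pi_add[OF g _ Aug_carrier[OF x a(1)], of "proj x v"] x v by simp
  then show ?thesis
    using proj_eqI[OF vertex_image[OF g x] Inv_image[OF g x a(3)] Aug_image[OF g x a(1)]] by simp
qed

lemma proj_absorb:
  assumes x: "x \<in> verts X" and n: "n \<in> N x" and v: "v \<in> carrier V"
  shows "proj x (\<pi> n v) = proj x v"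
proof -
  have g: "n \<in> carrier G" using n N_carrier[OF x] by blast
  have "\<phi> n x = x" using stabilizing_vertex[OF x] n unfolding stabilizer_def by blast
  then show ?thesis
    using proj_equivariant[OF g x v] proj_Inv[OF x v] n unfolding inv_space_def by simp
qed

text \<open>An element of \<open>N\<^sub>y\<close> fixes \<open>y\<close> and stabilizes the edge \<open>{x, y}\<close>, so it cannot move the other endpoint.\<close>

lemma N_fixes_neighbour:
  assumes e: "{x, y} \<in> edges X" and n: "n \<in> N y"
  shows "n \<in> carrier G" "\<phi> n x = x"
proof -
  note v = edge_endpoints[OF e]
  show g: "n \<in> carrier G" using n N_carrier[OF v(2)] by blast
  have y: "\<phi> n y = y" using stabilizing_vertex[OF v(2)] n unfolding stabilizer_def by blast
  have "\<phi> n ` {x, y} = {x, y}"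
    using stabilizing_edge[OF e, of y] n e unfolding stabilizer_def edge_action_def by auto
  then have "\<phi> n x \<in> {x, y}" by auto
  moreover have "\<phi> n x \<noteq> y"
    using vertices.inj_prop[OF g] v y by (metis inj_on_def)
  ultimately show "\<phi> n x = x" by blast
qed

text \<open>As \<open>N\<^sub>y\<close> fixes \<open>x\<close>, equivariance makes \<open>e\<^sub>x\<close> commute with the action of \<open>N\<^sub>y\<close>. So \<open>e\<^sub>x\<close> preserves both the
  invariants of \<open>N\<^sub>y\<close> and \<open>V[N\<^sub>y]\<close>, which gives \<open>proj_commute\<close>.\<close>

lemma proj_commute_N:
  assumes e: "{x, y} \<in> edges X" and n: "n \<in> N y" and v: "v \<in> carrier V"
  shows "\<pi> n (proj x v) = proj x (\<pi> n v)"
  using proj_equivariant[OF N_fixes_neighbour(1)[OF e n] edge_endpoints(1)[OF e] v]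
    N_fixes_neighbour(2)[OF e n] by simp

lemma proj_commute:
  assumes e: "{x, y} \<in> edges X" and v: "v \<in> carrier V"
  shows "proj x (proj y v) = proj y (proj x v)"
proof -
  note xy = edge_endpoints[OF e]
  have i: "proj x u \<in> Inv y" if "u \<in> Inv y" for u
    using that proj_commute_N[OF e, of _ u] xy Inv_carrier[OF xy(2) that] unfolding inv_space_def by auto
  let ?U = "{v \<in> carrier V. proj x v \<in> Aug y}"
  have s: "submodule ?U k V"
    by (rule submoduleI)
      (use xy submoduleE(3-5)[OF Aug_submodule[OF xy(2)]] submodule_zero[OF Aug_submodule[OF xy(2)]] in
        \<open>auto simp: proj_zero proj_neg proj_add proj_smult\<close>)
  have "Aug y \<subseteq> ?U"
  proof (rule aug_space_least[OF s])
    fix h w assume h: "h \<in> N y" and w: "w \<in> carrier V"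
    have hG: "h \<in> carrier G" by (rule N_fixes_neighbour(1)[OF e h])
    have "proj x (\<pi> h w \<ominus>\<^bsub>V\<^esub> w) = \<pi> h (proj x w) \<ominus>\<^bsub>V\<^esub> proj x w"
      using h w hG xy by (simp add: M.minus_eq proj_add proj_neg proj_commute_N[OF e])
    also have "\<dots> \<in> Aug y"
      using h proj_closed[OF xy(1) w] by (rule aug_space_generator)
    finally show "\<pi> h w \<ominus>\<^bsub>V\<^esub> w \<in> ?U"
      using hG w by (simp add: M.minus_closed)
  qed
  then have a: "proj x a \<in> Aug y" if "a \<in> Aug y" for a using that by blast
  obtain b where b: "b \<in> Aug y" "v = proj y v \<oplus>\<^bsub>V\<^esub> b" "proj y v \<in> Inv y"
    by (rule proj_obtain[OF xy(2) v])
  have "proj x v = proj x (proj y v) \<oplus>\<^bsub>V\<^esub> proj x b"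
    using b proj_add[OF xy(1) _ Aug_carrier[OF xy(2) b(1)], of "proj y v"] xy v by simp
  then show ?thesis using proj_eqI[OF xy(2) i[OF b(3)] a[OF b(1)]] by simp
qed

text \<open>This is \<open>e\<^sub>x e\<^sub>y u = e\<^sub>x u\<close> for an \<open>N\<^sub>z\<close>-invariant \<open>u\<close> and the vertex \<open>y\<close> after \<open>x\<close> on the path to \<open>z\<close>. By
  convexity an element of \<open>N\<^sub>y\<close> is a product \<open>a b\<close> with \<open>a\<close> in \<open>N\<^sub>x\<close> and \<open>b\<close> in \<open>N\<^sub>z\<close>. It maps \<open>e\<^sub>x u\<close> to
  \<open>e\<^sub>x (a b u) = e\<^sub>x u\<close>, so \<open>e\<^sub>x u\<close> is \<open>N\<^sub>y\<close>-invariant.\<close>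

lemma proj_through:
  assumes e: "{x, y} \<in> edges X" and z: "z \<in> verts X"
    and path: "y \<in> set (tree_path X x z)" and u: "u \<in> Inv z"
  shows "proj x (proj y u) = proj x u"
proof -
  note xy = edge_endpoints[OF e]
  note uV = Inv_carrier[OF z u]
  have "\<pi> n (proj x u) = proj x u" if n: "n \<in> N y" for n
  proof -
    obtain a b where ab: "a \<in> N x" "b \<in> N z" "n = a \<otimes> b"
      using convexity[OF xy(1) z path] n unfolding set_mult_def by blast
    have c: "a \<in> carrier G" "b \<in> carrier G" using ab N_carrier xy z by blast+
    have "\<pi> n u = \<pi> a (\<pi> b u)" using ab c uV by (simp add: pi_mult)
    also have "\<pi> b u = u" using u ab unfolding inv_space_def by blast
    finally show ?thesis using proj_commute_N[OF e n uV] proj_absorb[OF xy(1) ab(1) uV] by simp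
  qed
  then have "proj x u \<in> Inv y" using xy uV unfolding inv_space_def by simp
  then show ?thesis using proj_of_Inv[OF xy(2)] proj_commute[OF e uV] by simp
qed

lemma edge_subgroup_eq:
  assumes "{x, y} \<in> edges X"
  shows "edge_subgroup G N {x, y} = N x <#> N y"
  unfolding edge_subgroup_def
proof (rule the_equality)
  show "\<exists>x' y'. {x, y} = {x', y'} \<and> N x <#> N y = N x' <#> N y'" by blast
next
  fix H assume "\<exists>x' y'. {x, y} = {x', y'} \<and> H = N x' <#> N y'"
  then obtain x' y' where "{x, y} = {x', y'}" and H: "H = N x' <#> N y'" by (elim exE conjE)
  then consider "x = x'" "y = y'" | "x = y'" "y = x'" by (auto simp: doubleton_eq_iff)
  then show "H = N x <#> N y" unfolding H using locality[OF assms] by cases auto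
qed

lemma edge_subgroup_carrier:
  assumes e: "{x, y} \<in> edges X" shows "edge_subgroup G N {x, y} \<subseteq> carrier G"
  using edge_subgroup_eq[OF e] N_carrier edge_endpoints[OF e] G.set_mult_closed by metis

lemma N_subset_edge_subgroup:
  assumes e: "{x, y} \<in> edges X" shows "N x \<subseteq> edge_subgroup G N {x, y}"
proof
  fix n assume n: "n \<in> N x"
  note xy = edge_endpoints[OF e]
  have "n = n \<otimes> \<one>" "\<one> \<in> N y"
    using n N_carrier[OF xy(1)] subgroup.one_closed[OF is_subgroup[OF xy(2)]] by auto
  then show "n \<in> edge_subgroup G N {x, y}" unfolding edge_subgroup_eq[OF e] set_mult_def using n by blast
qed

text \<open>Equality in the stalk at the edge implies equality after applying \<open>e\<^sub>x e\<^sub>y\<close>, because this product absorbs both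
  \<open>N\<^sub>x\<close> and \<open>N\<^sub>y\<close>.\<close>

lemma proj_edge_aug:
  assumes e: "{x, y} \<in> edges X" and a: "a \<in> aug_space k V \<pi> (edge_subgroup G N {x, y})"
  shows "proj x (proj y a) = \<zero>\<^bsub>V\<^esub>"
proof -
  note xy = edge_endpoints[OF e]
  have "aug_space k V \<pi> (edge_subgroup G N {x, y}) \<subseteq> {v \<in> carrier V. proj x (proj y v) = \<zero>\<^bsub>V\<^esub>}"
  proof (rule aug_space_least[OF kernel_submodule[OF xy(1,2)]])
    fix h w assume h: "h \<in> edge_subgroup G N {x, y}" and w: "w \<in> carrier V"
    obtain m n where mn: "m \<in> N x" "n \<in> N y" "h = m \<otimes> n"
      using h unfolding edge_subgroup_eq[OF e] set_mult_def by blast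
    have c: "m \<in> carrier G" "n \<in> carrier G" "h \<in> carrier G" using mn N_carrier xy by auto
    have "proj x (proj y (\<pi> h w)) = proj y (proj x (\<pi> m (\<pi> n w)))"
      using proj_commute[OF e] mn c w by (simp add: pi_mult)
    also have "\<dots> = proj x (proj y (\<pi> n w))"
      using proj_absorb[OF xy(1) mn(1)] proj_commute[OF e] c w by simp
    also have "\<dots> = proj x (proj y w)" using proj_absorb[OF xy(2) mn(2) w] by simp
    finally show "\<pi> h w \<ominus>\<^bsub>V\<^esub> w \<in> {v \<in> carrier V. proj x (proj y v) = \<zero>\<^bsub>V\<^esub>}"
      using c w xy by (simp add: M.minus_eq proj_add proj_neg M.r_neg)
  qed
  then show ?thesis using a by blast
qed

end

section \<open>Gluing sections of the localization\<close>

context plumbed_representation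
begin

text \<open>The identity of \<open>proj_through\<close> with \<open>y\<close> next to \<open>z\<close> instead of \<open>x\<close>. Walking from \<open>x\<close> towards \<open>z\<close>, \<open>proj_through\<close>
  inserts the projections at all intermediate vertices one by one, the last of them being \<open>e\<^sub>y\<close>; the other ones
  can be removed again, since \<open>e\<^sub>y u\<close> is \<open>N\<^sub>y\<close>-invariant.\<close>

lemma proj_through_last:
  assumes e: "{y, z} \<in> edges X" and u: "u \<in> Inv z"
    and "x \<in> verts X" "tree_dist X x y < tree_dist X x z"
  shows "proj x (proj y u) = proj x u"
  using assms(3,4)
proof (induction "tree_dist X x y" arbitrary: x rule: less_induct)
  case less
  note yz = edge_endpoints[OF e]
  note x = \<open>x \<in> verts X\<close>
  have uV: "u \<in> carrier V" using Inv_carrier[OF yz(2) u] .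
  show ?case
  proof (cases "x = y")
    case True
    then show ?thesis using proj_of_Inv[OF yz(1)] proj_Inv[OF yz(1) uV] by simp
  next
    case False
    obtain x1 where x1: "{x, x1} \<in> edges X" "tree_dist X x y = Suc (tree_dist X x1 y)"
      by (rule first_step[OF x yz(1) False])
    note xx = edge_endpoints[OF x1(1)]
    have z: "tree_dist X x z = Suc (tree_dist X x y)"
      using less.prems(2) tree_dist_commute[OF x yz(1)] tree_dist_commute[OF x yz(2)]
      by (cases rule: edge_dist_cases[OF e x]) auto
    then have z1: "tree_dist X x1 z = Suc (tree_dist X x1 y)"
      using x1(2) tree_dist_commute[OF xx(2) yz(1)] tree_dist_commute[OF xx(2) yz(2)]
      by (cases rule: edge_dist_cases[OF x1(1) yz(2)]; cases rule: edge_dist_cases[OF e xx(2)]) auto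
    have "x1 \<in> set (tree_path X x y)" "x1 \<in> set (tree_path X x z)"
      using edge_path_iff[OF x1(1) yz(1)] edge_path_iff[OF x1(1) yz(2)] x1(2) z z1 by auto
    then have *: "proj x (proj x1 (proj y u)) = proj x (proj y u)" "proj x (proj x1 u) = proj x u"
      using proj_through[OF x1(1)] proj_Inv[OF yz(1) uV] u yz by blast+
    have "proj x1 (proj y u) = proj x1 u"
      using less.hyps[of x1] x1(2) xx z1 by simp
    then show ?thesis using * by simp
  qed
qed

text \<open>Vectors are glued inside this subspace because \<open>e\<^sub>z e\<^sub>x = e\<^sub>z\<close> holds on it whenever all paths from \<open>z\<close> to \<open>T\<close>
  start with the edge to \<open>x\<close>.\<close>

definition hull :: "'x set \<Rightarrow> 'v set" where
  "hull T = linear_span k V (\<Union>t\<in>T. Inv t)"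

lemma hull_submodule: "T \<subseteq> verts X \<Longrightarrow> submodule (hull T) k V"
  unfolding hull_def using Inv_carrier by (intro submodule_linear_span[OF md]) blast

lemma Inv_subset_hull: "t \<in> T \<Longrightarrow> Inv t \<subseteq> hull T"
  unfolding hull_def using linear_span_superset[of "\<Union>t\<in>T. Inv t" k V] by blast

lemma hull_mono: "T' \<subseteq> T \<Longrightarrow> T \<subseteq> verts X \<Longrightarrow> hull T' \<subseteq> hull T"
  unfolding hull_def[of T'] using Inv_subset_hull by (intro linear_span_least hull_submodule) blast+

lemma hull_carrier: "T \<subseteq> verts X \<Longrightarrow> v \<in> hull T \<Longrightarrow> v \<in> carrier V"
  using submoduleE(1)[OF hull_submodule] by blast

lemma proj_through_hull:
  assumes e: "{z, x} \<in> edges X" and T: "T \<subseteq> verts X"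
    and path: "\<And>t. t \<in> T \<Longrightarrow> tree_dist X x t < tree_dist X z t" and v: "v \<in> hull T"
  shows "proj z (proj x v) = proj z v"
proof -
  note zx = edge_endpoints[OF e]
  have "u \<in> {v \<in> carrier V. proj z (proj x v) = proj z v}" if u: "t \<in> T" "u \<in> Inv t" for t u
  proof -
    have t: "t \<in> verts X" using u T by blast
    have "x \<in> set (tree_path X z t)" using edge_path_iff[OF e t] path[OF u(1)] by simp
    then show ?thesis using proj_through[OF e t _ u(2)] Inv_carrier[OF t u(2)] by blast
  qed
  then have "(\<Union>t\<in>T. Inv t) \<subseteq> {v \<in> carrier V. proj z (proj x v) = proj z v}" by blast
  then show ?thesis
    using linear_span_least[OF equalizer_submodule[OF zx(1,2)]] v unfolding hull_def by blast
qed

text \<open>Let \<open>y\<close> be a deepest vertex of \<open>T\<close> and \<open>x\<close> its parent. If \<open>v\<close> has the prescribed projections on the rest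
  of \<open>T\<close>, then \<open>v + s\<^sub>y - e\<^sub>x s\<^sub>y\<close> has them on \<open>T\<close>. For the other vertices \<open>t\<close>, the path from \<open>t\<close> to \<open>y\<close> ends with the
  edge from \<open>x\<close>, so \<open>e\<^sub>t s\<^sub>y = e\<^sub>t e\<^sub>x s\<^sub>y\<close>. At \<open>y\<close>, \<open>e\<^sub>y v = e\<^sub>y e\<^sub>x v = e\<^sub>y s\<^sub>x = e\<^sub>x s\<^sub>y\<close>.\<close>

lemma glue_rooted:
  assumes z0: "z0 \<in> verts X"
    and "finite T" "T \<subseteq> verts X" "\<And>t. t \<in> T \<Longrightarrow> set (tree_path X z0 t) \<subseteq> T"
    and "\<And>t. t \<in> T \<Longrightarrow> s t \<in> Inv t"
    and "\<And>x y. \<lbrakk>x \<in> T; y \<in> T; {x, y} \<in> edges X\<rbrakk> \<Longrightarrow> proj y (s x) = proj x (s y)"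
  shows "\<exists>v\<in>hull T. \<forall>t\<in>T. proj t v = s t"
  using assms(2-)
proof (induction "card T" arbitrary: T rule: less_induct)
  case less
  note fin = \<open>finite T\<close> and TX = \<open>T \<subseteq> verts X\<close>
  note rooted = less.prems(3) and sInv = less.prems(4) and compat = less.prems(5)
  have sV: "s t \<in> carrier V" if "t \<in> T" for t using sInv[OF that] Inv_carrier that TX by blast
  show ?case
  proof (cases "T = {}")
    case True
    then show ?thesis using submodule_zero[OF hull_submodule[OF TX]] by blast
  next
    case False
    let ?m = "Max (tree_dist X z0 ` T)"
    have "?m \<in> tree_dist X z0 ` T" using fin False by (intro Max_in) auto
    then obtain y where y: "y \<in> T" "tree_dist X z0 y = ?m" by (metis imageE)
    have max: "tree_dist X z0 t \<le> tree_dist X z0 y" if "t \<in> T" for t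
      unfolding y(2) using that fin by (intro Max_ge) auto
    have yX: "y \<in> verts X" using y TX by blast
    let ?T = "T - {y}"
    have T'X: "?T \<subseteq> verts X" using TX by blast
    have rooted': "set (tree_path X z0 t) \<subseteq> ?T" if t: "t \<in> ?T" for t
    proof -
      have "y \<notin> set (tree_path X z0 t)"
      proof
        assume "y \<in> set (tree_path X z0 t)"
        then have "tree_dist X z0 y < tree_dist X z0 t"
          using tree_path_initial(2)[OF z0, of t y] t TX by blast
        then show False using max[of t] t by simp
      qed
      then show ?thesis using rooted[of t] t by blast
    qed
    have "card ?T < card T" using fin y(1) by (intro psubset_card_mono) auto
    then obtain v where v: "v \<in> hull ?T" "\<And>t. t \<in> ?T \<Longrightarrow> proj t v = s t"
      using less.hyps[of ?T] fin T'X rooted' sInv compat by (metis DiffD1 finite_Diff)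
    have vV: "v \<in> carrier V" by (rule hull_carrier[OF T'X v(1)])
    show ?thesis
    proof (cases "y = z0")
      case True
      have "?T = {}" using rooted' endpoints_in_tree_path(1)[OF z0] T'X True by blast
      then have "T = {y}" using y(1) by blast
      then show ?thesis
        using Inv_subset_hull[of y T] sInv[OF y(1)] proj_of_Inv[OF yX] by auto
    next
      case False
      obtain x where x: "{y, x} \<in> edges X" "tree_dist X y z0 = Suc (tree_dist X x z0)"
        by (rule first_step[OF yX z0 False])
      note yx = edge_endpoints[OF x(1)]
      have x': "{x, y} \<in> edges X" using x(1) by (simp add: insert_commute)
      have "x \<in> set (tree_path X y z0)" using edge_path_iff[OF x(1) z0] x(2) by simp
      then have "x \<in> set (tree_path X z0 y)" using tree_path_rev[OF z0 yX] by simp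
      then have xT: "x \<in> ?T" using rooted[OF y(1)] yx by blast
      have side: "tree_dist X x t < tree_dist X y t" if t: "t \<in> ?T" for t
      proof (rule ccontr)
        have tX: "t \<in> verts X" using t TX by blast
        assume "\<not> ?thesis"
        then have "tree_dist X y t < tree_dist X x t" by (cases rule: edge_dist_cases[OF x' tX]) auto
        then have "tree_dist X z0 t = tree_dist X z0 x + 1 + tree_dist X y t"
          using dist_across_edge[OF x' z0 tX] x(2) by simp
        moreover have "tree_dist X y t \<noteq> 0" using tree_dist_eq_0[OF yX tX] t by auto
        ultimately show False
          using max[of t] t x(2) tree_dist_commute[OF z0 yX] tree_dist_commute[OF z0 yx(2)] by simp
      qed
      let ?c = "proj x (s y)"
      let ?v = "v \<oplus>\<^bsub>V\<^esub> (s y \<ominus>\<^bsub>V\<^esub> ?c)"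
      have c: "?c \<in> carrier V" "?c \<in> Inv x" using sV[OF y(1)] yx proj_Inv by auto
      have h: "v \<in> hull T" "s y \<in> hull T" "?c \<in> hull T"
        using hull_mono[OF _ TX, of ?T] v(1) Inv_subset_hull[OF y(1)] Inv_subset_hull[of x T]
          sInv[OF y(1)] c(2) xT by blast+
      have "?v \<in> hull T"
        using h submoduleE(3,5)[OF hull_submodule[OF TX]] unfolding M.minus_eq by blast
      moreover have "proj t ?v = s t" if t: "t \<in> T" for t
      proof -
        have tX: "t \<in> verts X" using t TX by blast
        have *: "proj t ?v = proj t v \<oplus>\<^bsub>V\<^esub> (proj t (s y) \<ominus>\<^bsub>V\<^esub> proj t ?c)"
          using tX vV sV[OF y(1)] c(1) by (simp add: M.minus_eq proj_add proj_neg)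
        show ?thesis
        proof (cases "t = y")
          case True
          have "proj y v = proj y (proj x v)" using proj_through_hull[OF x(1) T'X side v(1)] by simp
          also have "\<dots> = ?c" using v(2)[OF xT] compat[of x y] xT y(1) x' by simp
          finally have "proj y v = ?c" .
          moreover have "proj y ?c = ?c"
            using proj_commute[OF x' sV[OF y(1)]] proj_of_Inv[OF yX sInv[OF y(1)]] by simp
          ultimately show ?thesis
            using * True proj_of_Inv[OF yX sInv[OF y(1)]] sV[OF y(1)] c(1)
            by (simp add: M.minus_eq M.a_lcomm[of ?c] M.r_neg)
        next
          case False
          then have t': "t \<in> ?T" using t by blast
          have "tree_dist X t x < tree_dist X t y"
            using side[OF t'] tree_dist_commute[OF tX] yx by simp
          then have "proj t ?c = proj t (s y)"
            using proj_through_last[OF x' sInv[OF y(1)] tX] by simp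
          then show ?thesis
            using * v(2)[OF t'] sV[OF t] sV[OF y(1)] tX by (simp add: M.minus_eq M.r_neg)
        qed
      qed
      ultimately show ?thesis by blast
    qed
  qed
qed

text \<open>Glue along the union \<open>T\<close> of the paths from a root \<open>z0\<close> to the support. Outside \<open>T\<close> the projections of the
  glued vector vanish, by induction on the distance to \<open>z0\<close>: if \<open>y\<close> is the next vertex from \<open>x\<close> towards \<open>z0\<close>, then
  \<open>e\<^sub>x v = e\<^sub>x e\<^sub>y v = e\<^sub>x s\<^sub>y = e\<^sub>y s\<^sub>x\<close> and \<open>s\<^sub>x = 0\<close>.\<close>

lemma glue:
  assumes sInv: "\<And>x. x \<in> verts X \<Longrightarrow> s x \<in> Inv x"
    and compat: "\<And>x y. {x, y} \<in> edges X \<Longrightarrow> proj y (s x) = proj x (s y)"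
    and fin: "finite {x \<in> verts X. s x \<noteq> \<zero>\<^bsub>V\<^esub>}"
  shows "\<exists>v\<in>carrier V. \<forall>x\<in>verts X. proj x v = s x"
proof (cases "{x \<in> verts X. s x \<noteq> \<zero>\<^bsub>V\<^esub>} = {}")
  case True
  then show ?thesis using proj_zero by (intro bexI[of _ "\<zero>\<^bsub>V\<^esub>"]) auto
next
  case False
  then obtain z0 where z0: "z0 \<in> verts X" "s z0 \<noteq> \<zero>\<^bsub>V\<^esub>" by blast
  let ?T = "\<Union>x\<in>{x \<in> verts X. s x \<noteq> \<zero>\<^bsub>V\<^esub>}. set (tree_path X z0 x)"
  have TX: "?T \<subseteq> verts X" using tree_path_subset[OF z0(1)] by blast
  have rooted: "set (tree_path X z0 t) \<subseteq> ?T" if "t \<in> ?T" for t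
    using that tree_path_initial(1)[OF z0(1)] by blast
  have "\<exists>v\<in>hull ?T. \<forall>t\<in>?T. proj t v = s t"
    using rooted by (intro glue_rooted[OF z0(1) _ TX]) (use fin TX sInv compat in auto)
  then obtain v where v: "v \<in> hull ?T" "\<And>t. t \<in> ?T \<Longrightarrow> proj t v = s t" by blast
  have vV: "v \<in> carrier V" by (rule hull_carrier[OF TX v(1)])
  have supp: "s x = \<zero>\<^bsub>V\<^esub>" if "x \<in> verts X" "x \<notin> ?T" for x
    using that endpoints_in_tree_path(2)[OF z0(1) that(1)] by blast
  have z0T: "z0 \<in> ?T" using z0 endpoints_in_tree_path(1)[OF z0(1) z0(1)] by blast
  have "proj x v = s x" if "x \<in> verts X" for x
    using that
  proof (induction "tree_dist X x z0" arbitrary: x rule: less_induct)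
    case less
    note z = \<open>x \<in> verts X\<close>
    show ?case
    proof (cases "x \<in> ?T")
      case True
      then show ?thesis by (rule v(2))
    next
      case False
      then have "x \<noteq> z0" using z0T by blast
      then obtain y where y: "{x, y} \<in> edges X" "tree_dist X x z0 = Suc (tree_dist X y z0)"
        using first_step[OF z z0(1)] by blast
      have y': "{y, x} \<in> edges X" using y(1) by (simp add: insert_commute)
      note xy = edge_endpoints[OF y(1)]
      have "tree_dist X y t < tree_dist X x t" if t: "t \<in> ?T" for t
      proof (rule ccontr)
        have tX: "t \<in> verts X" using t TX by blast
        assume "\<not> ?thesis"
        then have "tree_dist X x t < tree_dist X y t" by (cases rule: edge_dist_cases[OF y(1) tX]) auto
        then have "tree_path X z0 t = tree_path X z0 y @ tree_path X x t"
          using path_across_edge(1)[OF y' z0(1) tX] y(2) by simp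
        then have "x \<in> set (tree_path X z0 t)" using endpoints_in_tree_path(1)[OF z tX] by simp
        then show False using rooted[OF t] False by blast
      qed
      then have "proj x v = proj x (proj y v)" using proj_through_hull[OF y(1) TX _ v(1)] by simp
      also have "proj y v = s y" using less.hyps[of y] y(2) xy by simp
      also have "proj x (s y) = proj y (s x)" using compat[OF y'] by simp
      finally show ?thesis using supp[OF z False] proj_zero[OF xy(2)] by simp
    qed
  qed
  then show ?thesis using vV by blast
qed

end

locale localized_representation = plumbed_representation k G X \<phi> N V \<pi>
  for k :: "'k ring" and G :: "'g monoid" (structure) and X :: "'x graph"
    and \<phi> :: "'g \<Rightarrow> 'x \<Rightarrow> 'x" and N :: "'x \<Rightarrow> 'g set"
    and V :: "('k, 'v) module" and \<pi> :: "'g \<Rightarrow> 'v \<Rightarrow> 'v" +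
  assumes compact: "N_compact k G X N V \<pi>"
    and cogenerated: "N_cogenerated k X N V \<pi>"
begin

abbreviation S where "S \<equiv> localization k G N V \<pi>"
abbreviation L where "L \<equiv> localization_map k X N V \<pi>"

lemma vstalk_S: "vstalk S x = coinvariants k V \<pi> (N x)"
  by (simp add: localization_def)

lemma L_apply: "x \<in> verts X \<Longrightarrow> L v x = coinv_class k V \<pi> (N x) v"
  by (simp add: localization_map_def)

lemma res_L:
  assumes e: "e \<in> edges X" and x: "x \<in> e" and v: "v \<in> carrier V"
  shows "res S x e (coinv_class k V \<pi> (N x) v) = coinv_class k V \<pi> (edge_subgroup G N e) v"
proof -
  obtain y where y: "e = {x, y}" by (rule edge_obtain_other[OF e x])
  show ?thesis
    using res_class[OF N_subset_edge_subgroup edge_subgroup_carrier v, of x y] e y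
    by (simp add: localization_def)
qed

lemma L_section:
  assumes v: "v \<in> carrier V" shows "L v \<in> carrier (compact_sections X S)"
proof -
  have ev: "x \<in> verts X" if "e \<in> edges X" "x \<in> e" for x e
    using edge_obtain_other[OF that] edge_endpoints that by metis
  have "finite (N_support k G X N V \<pi> v)" using compact v unfolding N_compact_def by blast
  then have "finite {x \<in> verts X. coinv_class k V \<pi> (N x) v \<noteq> \<zero>\<^bsub>coinvariants k V \<pi> (N x)\<^esub>}"
    unfolding N_support_def by (auto dest: finite_imageD)
  moreover have "{x \<in> verts X. coinv_class k V \<pi> (N x) v \<noteq> \<zero>\<^bsub>coinvariants k V \<pi> (N x)\<^esub>} =
      {x \<in> verts X. L v x \<noteq> \<zero>\<^bsub>vstalk S x\<^esub>}"
    by (auto simp: L_apply vstalk_S)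
  moreover have "L v \<in> (\<Pi>\<^sub>E x\<in>verts X. carrier (vstalk S x))"
    using v by (auto simp: localization_map_def vstalk_S coinv_carrier[OF N_carrier])
  ultimately show ?thesis
    using v res_L ev by (simp add: compact_sections_def L_apply)
qed

lemma L_inj: "inj_on L (carrier V)"
  using cogenerated unfolding N_cogenerated_def .

text \<open>The vector \<open>s\<^sub>x\<close> is the \<open>N\<^sub>x\<close>-invariant representative of the value of \<open>f\<close> at \<open>x\<close>. Agreement of the values at
  an edge becomes the gluing condition \<open>e\<^sub>y s\<^sub>x = e\<^sub>x s\<^sub>y\<close>.\<close>

lemma L_surj:
  assumes f: "f \<in> carrier (compact_sections X S)"
  shows "\<exists>v\<in>carrier V. L v = f"
proof -
  have "\<forall>x\<in>verts X. \<exists>u. u \<in> Inv x \<and> coinv_class k V \<pi> (N x) u = f x"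
  proof
    fix x assume x: "x \<in> verts X"
    have "f x \<in> carrier (coinvariants k V \<pi> (N x))"
      using f x by (auto simp: compact_sections_def vstalk_S)
    then obtain u where u: "u \<in> carrier V" "f x = coinv_class k V \<pi> (N x) u"
      unfolding coinv_carrier[OF N_carrier[OF x]] by blast
    then show "\<exists>u. u \<in> Inv x \<and> coinv_class k V \<pi> (N x) u = f x"
      using proj_Inv[OF x] class_proj[OF x] by metis
  qed
  then obtain s where s: "\<And>x. x \<in> verts X \<Longrightarrow> s x \<in> Inv x"
      "\<And>x. x \<in> verts X \<Longrightarrow> coinv_class k V \<pi> (N x) (s x) = f x"
    by (metis bchoice)
  have sV: "s x \<in> carrier V" if "x \<in> verts X" for x using s(1)[OF that] Inv_carrier that by blast
  have s0: "s x = \<zero>\<^bsub>V\<^esub> \<longleftrightarrow> f x = \<zero>\<^bsub>vstalk S x\<^esub>" if x: "x \<in> verts X" for x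
    using class_zero_iff[OF N_carrier[OF x] sV[OF x]] proj_zero_iff[OF x sV[OF x]]
      proj_of_Inv[OF x s(1)[OF x]] s(2)[OF x] vstalk_S by simp
  have compat: "proj y (s x) = proj x (s y)" if e: "{x, y} \<in> edges X" for x y
  proof -
    note xy = edge_endpoints[OF e]
    have "res S x {x, y} (f x) = res S y {x, y} (f y)"
      using f e by (auto simp: compact_sections_def)
    then have "coinv_class k V \<pi> (edge_subgroup G N {x, y}) (s x) =
        coinv_class k V \<pi> (edge_subgroup G N {x, y}) (s y)"
      using res_L[OF e, of x "s x"] res_L[OF e, of y "s y"] sV xy s(2)[OF xy(1)] s(2)[OF xy(2)]
      by simp
    then obtain a where a: "a \<in> aug_space k V \<pi> (edge_subgroup G N {x, y})" "s x = a \<oplus>\<^bsub>V\<^esub> s y"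
      using class_eq_imp[OF edge_subgroup_carrier[OF e] sV[OF xy(1)]] by blast
    have aV: "a \<in> carrier V" using submoduleE(1)[OF aug_submodule[OF edge_subgroup_carrier[OF e]]] a by blast
    have "proj x (proj y (s x)) = proj x (proj y (s y))"
      unfolding a(2) using aV sV xy proj_edge_aug[OF e a(1)] by (simp add: proj_add)
    then show ?thesis
      using proj_commute[OF e sV[OF xy(1)]] proj_of_Inv s(1) xy by simp
  qed
  have "finite {x \<in> verts X. s x \<noteq> \<zero>\<^bsub>V\<^esub>}"
  proof -
    have "{x \<in> verts X. s x \<noteq> \<zero>\<^bsub>V\<^esub>} = {x \<in> verts X. f x \<noteq> \<zero>\<^bsub>vstalk S x\<^esub>}" using s0 by blast
    then show ?thesis using f by (simp add: compact_sections_def)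
  qed
  then obtain v where v: "v \<in> carrier V" "\<And>x. x \<in> verts X \<Longrightarrow> proj x v = s x"
    using glue[OF s(1) compat] by blast
  have "L v = f"
  proof (rule extensionalityI[of _ "verts X"])
    show "L v \<in> extensional (verts X)" by (simp add: localization_map_def)
    show "f \<in> extensional (verts X)" using f by (simp add: compact_sections_def PiE_def)
    fix x assume x: "x \<in> verts X"
    show "L v x = f x"
      using class_proj[OF x v(1)] v(2)[OF x] s(2)[OF x] L_apply[OF x] by simp
  qed
  then show ?thesis using v(1) by blast
qed

lemma L_add:
  assumes "v \<in> carrier V" "w \<in> carrier V"
  shows "L (v \<oplus>\<^bsub>V\<^esub> w) = L v \<oplus>\<^bsub>compact_sections X S\<^esub> L w"
  using assms coinv_add[OF N_carrier]
  by (simp add: compact_sections_def vstalk_S localization_map_def cong: restrict_cong)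

lemma L_smult:
  assumes "v \<in> carrier V" "c \<in> carrier k"
  shows "L (c \<odot>\<^bsub>V\<^esub> v) = c \<odot>\<^bsub>compact_sections X S\<^esub> L v"
  using assms coinv_smult[OF N_carrier]
  by (simp add: compact_sections_def vstalk_S localization_map_def cong: restrict_cong)

lemma L_zero: "L \<zero>\<^bsub>V\<^esub> = \<zero>\<^bsub>compact_sections X S\<^esub>"
  using class_zero[OF N_carrier]
  by (simp add: compact_sections_def vstalk_S localization_map_def cong: restrict_cong)

lemma L_equivariant:
  assumes g: "g \<in> carrier G" and v: "v \<in> carrier V"
  shows "section_action G X \<phi> S g (L v) = L (\<pi> g v)"
  unfolding section_action_def localization_map_def
proof (rule restrict_ext)
  fix y assume y: "y \<in> verts X"
  have y': "\<phi> (inv g) y \<in> verts X" using vertex_image[of "inv g" y] g y by simp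
  show "vact S g (\<phi> (inv g) y) ((\<lambda>x\<in>verts X. coinv_class k V \<pi> (N x) v) (\<phi> (inv g) y)) =
      coinv_class k V \<pi> (N y) (\<pi> g v)"
    using y' class_image[OF N_carrier[OF y'] g v] equivariance[OF g y'] vertex_image_inv(2)[OF g y]
    by (simp add: localization_def)
qed

end

section \<open>A criterion for compact induction\<close>

text \<open>The situation in which \<open>V\<close> is compactly induced from \<open>W\<close>, embedded by \<open>\<iota>\<close>. The last assumption says
  that the translates of \<open>\<iota> W\<close> by elements of distinct left cosets of \<open>K\<close> are linearly independent subspaces; its case of
  a single coset makes \<open>\<iota>\<close> injective.\<close>

locale independent_translates = rep_setup k G V \<pi>
  for k :: "'k ring" and G :: "'g monoid" (structure) and V :: "('k, 'v) module"
    and \<pi> :: "'g \<Rightarrow> 'v \<Rightarrow> 'v" +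
  fixes K :: "'g set" and W :: "('k, 'w) module" and \<sigma> :: "'g \<Rightarrow> 'w \<Rightarrow> 'w" and \<iota> :: "'w \<Rightarrow> 'v"
  assumes irreducible: "irreducible_representation k G V \<pi>"
    and K_subgroup: "subgroup K G"
    and W_rep: "representation k (G\<lparr>carrier := K\<rparr>) W \<sigma>"
    and W_nonzero: "carrier W \<noteq> {\<zero>\<^bsub>W\<^esub>}"
    and \<iota>_linear: "\<iota> \<in> linear_maps k W V"
    and \<iota>_equivariant: "\<lbrakk>h \<in> K; w \<in> carrier W\<rbrakk> \<Longrightarrow> \<iota> (\<sigma> h w) = \<pi> h (\<iota> w)"
    and independent:
      "\<lbrakk>finite A; A \<subseteq> carrier G; \<And>a b. \<lbrakk>a \<in> A; b \<in> A; inv a \<otimes> b \<in> K\<rbrakk> \<Longrightarrow> a = b;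
        f \<in> A \<rightarrow> carrier W; finsum V (\<lambda>a. \<pi> a (\<iota> (f a))) A = \<zero>\<^bsub>V\<^esub>; c \<in> A\<rbrakk>
       \<Longrightarrow> f c = \<zero>\<^bsub>W\<^esub>"
begin

sublocale W: rep_setup k "G\<lparr>carrier := K\<rparr>" W \<sigma> by unfold_locales (rule W_rep)

lemma K_carrier: "h \<in> K \<Longrightarrow> h \<in> carrier G"
  using subgroup.subset[OF K_subgroup] by blast

lemma K_one: "\<one> \<in> K" and K_mult: "h \<in> K \<Longrightarrow> h' \<in> K \<Longrightarrow> h \<otimes> h' \<in> K"
  and K_inv: "h \<in> K \<Longrightarrow> inv h \<in> K"
  using K_subgroup by (auto simp: subgroup_def)

lemma \<sigma>_closed: "h \<in> K \<Longrightarrow> w \<in> carrier W \<Longrightarrow> \<sigma> h w \<in> carrier W"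
  using W.pi_closed by simp

lemma \<sigma>_mult: "h \<in> K \<Longrightarrow> h' \<in> K \<Longrightarrow> w \<in> carrier W \<Longrightarrow> \<sigma> h (\<sigma> h' w) = \<sigma> (h \<otimes> h') w"
  using W.pi_mult by simp

lemma \<sigma>_one: "w \<in> carrier W \<Longrightarrow> \<sigma> \<one> w = w"
  using W.pi_one by simp

lemma \<sigma>_zero: "h \<in> K \<Longrightarrow> \<sigma> h \<zero>\<^bsub>W\<^esub> = \<zero>\<^bsub>W\<^esub>"
  using W.pi_zero by simp

lemma \<iota>_closed [simp]: "w \<in> carrier W \<Longrightarrow> \<iota> w \<in> carrier V"
  and \<iota>_add: "w \<in> carrier W \<Longrightarrow> w' \<in> carrier W \<Longrightarrow> \<iota> (w \<oplus>\<^bsub>W\<^esub> w') = \<iota> w \<oplus>\<^bsub>V\<^esub> \<iota> w'"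
  and \<iota>_smult: "w \<in> carrier W \<Longrightarrow> c \<in> carrier k \<Longrightarrow> \<iota> (c \<odot>\<^bsub>W\<^esub> w) = c \<odot>\<^bsub>V\<^esub> \<iota> w"
  using \<iota>_linear unfolding linear_maps_def hom_def by auto

lemma \<iota>_zero: "\<iota> \<zero>\<^bsub>W\<^esub> = \<zero>\<^bsub>V\<^esub>"
  using \<iota>_smult[of "\<zero>\<^bsub>W\<^esub>" "\<zero>\<^bsub>k\<^esub>"] by simp

lemma \<iota>_eq_zero: "w \<in> carrier W \<Longrightarrow> \<iota> w = \<zero>\<^bsub>V\<^esub> \<Longrightarrow> w = \<zero>\<^bsub>W\<^esub>"
  using independent[of "{\<one>}" "\<lambda>_. w" \<one>] pi_one by (simp add: K_one)

lemma \<pi>_finsum: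
  assumes g: "g \<in> carrier G" and "f \<in> A \<rightarrow> carrier V"
  shows "\<pi> g (finsum V f A) = finsum V (\<lambda>a. \<pi> g (f a)) A"
  using assms(2)
  by (induction A rule: infinite_finite_induct)
    (auto simp: g pi_zero pi_add M.finsum_insert Pi_iff)

abbreviation C where "C \<equiv> cInd G K W \<sigma>"

lemma cInd_iff:
  "F \<in> carrier C \<longleftrightarrow> F \<in> carrier G \<rightarrow>\<^sub>E carrier W \<and>
     (\<forall>g\<in>carrier G. \<forall>h\<in>K. F (g \<otimes> h) = \<sigma> (inv h) (F g)) \<and>
     finite {g <# K | g. g \<in> carrier G \<and> F g \<noteq> \<zero>\<^bsub>W\<^esub>}"
  by (simp add: cInd_def)

lemma cInd_closed: "F \<in> carrier C \<Longrightarrow> g \<in> carrier G \<Longrightarrow> F g \<in> carrier W"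
  unfolding cInd_iff by blast

lemma cInd_eqI:
  "F \<in> carrier C \<Longrightarrow> F' \<in> carrier C \<Longrightarrow> (\<And>g. g \<in> carrier G \<Longrightarrow> F g = F' g) \<Longrightarrow> F = F'"
  unfolding cInd_iff by (blast intro: PiE_ext)

definition cosets :: "'g set set" where "cosets = {g <# K | g. g \<in> carrier G}"

definition coset_support :: "('g \<Rightarrow> 'w) \<Rightarrow> 'g set set" where
  "coset_support F = {g <# K | g. g \<in> carrier G \<and> F g \<noteq> \<zero>\<^bsub>W\<^esub>}"

definition rep_of :: "'g set \<Rightarrow> 'g" where "rep_of D = (SOME g. g \<in> D)"

lemma coset_support_finite: "F \<in> carrier C \<Longrightarrow> finite (coset_support F)"
  unfolding cInd_iff coset_support_def by blast

lemma coset_support_cosets: "coset_support F \<subseteq> cosets"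
  unfolding coset_support_def cosets_def by blast

lemma rep_of_coset:
  assumes "g \<in> carrier G"
  obtains h where "h \<in> K" "rep_of (g <# K) = g \<otimes> h"
proof -
  have "g \<otimes> \<one> \<in> g <# K" unfolding l_coset_def using K_one by blast
  then have "rep_of (g <# K) \<in> g <# K" unfolding rep_of_def by (rule someI)
  then show ?thesis using that unfolding l_coset_def by blast
qed

lemma rep_of_carrier: "D \<in> cosets \<Longrightarrow> rep_of D \<in> carrier G"
  unfolding cosets_def using rep_of_coset K_carrier by (smt (verit) G.m_closed mem_Collect_eq)

lemma coset_eqI:
  assumes a: "a \<in> carrier G" and b: "b \<in> carrier G" and "inv a \<otimes> b \<in> K"
  shows "a <# K = b <# K"
proof -
  have "b = a \<otimes> (inv a \<otimes> b)" using a b by (simp add: G.m_assoc[symmetric])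
  then have "b \<in> a <# K" using assms(3) unfolding l_coset_def by blast
  then show ?thesis using G.l_repr_independence[OF _ a K_subgroup] by blast
qed

lemma coset_of_rep: assumes "D \<in> cosets" shows "rep_of D <# K = D"
proof -
  obtain g where g: "g \<in> carrier G" "D = g <# K" using assms unfolding cosets_def by blast
  obtain h where h: "h \<in> K" "rep_of D = g \<otimes> h" using rep_of_coset[OF g(1)] unfolding g(2) by blast
  have "inv g \<otimes> rep_of D = h" using g h K_carrier by (simp add: G.m_assoc[symmetric])
  then show ?thesis using coset_eqI[OF g(1) rep_of_carrier[OF assms]] h g by simp
qed

definition contribution :: "('g \<Rightarrow> 'w) \<Rightarrow> 'g set \<Rightarrow> 'v" where
  "contribution F D = \<pi> (rep_of D) (\<iota> (F (rep_of D)))"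

text \<open>The extension of \<open>\<iota>\<close> to the compactly induced representation. It sends the tensor of \<open>g\<close> and \<open>w\<close> to
  \<open>\<pi>(g) \<iota>(w)\<close>, see \<open>tensor_in_cInd\<close>.\<close>

definition induced_map :: "('g \<Rightarrow> 'w) \<Rightarrow> 'v" where
  "induced_map F = finsum V (contribution F) (coset_support F)"

text \<open>The choice of a representative does not matter: replacing \<open>g\<close> by \<open>g h\<close> applies \<open>\<sigma>(h)\<close> inverse to the value of
  \<open>F\<close>, which \<open>\<pi>(h)\<close> undoes.\<close>

lemma contribution_coset:
  assumes F: "F \<in> carrier C" and g: "g \<in> carrier G"
  shows "contribution F (g <# K) = \<pi> g (\<iota> (F g))"
proof -
  obtain h where h: "h \<in> K" "rep_of (g <# K) = g \<otimes> h" by (rule rep_of_coset[OF g])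
  have "F (g \<otimes> h) = \<sigma> (inv h) (F g)" using F g h unfolding cInd_iff by blast
  then show ?thesis
    unfolding contribution_def h(2)
    using h g K_carrier K_inv cInd_closed[OF F g] by (simp add: \<iota>_equivariant pi_mult G.m_assoc)
qed

lemma contribution_closed:
  "F \<in> carrier C \<Longrightarrow> D \<in> cosets \<Longrightarrow> contribution F D \<in> carrier V"
  unfolding contribution_def using rep_of_carrier cInd_closed by simp

lemma induced_map_eq:
  assumes F: "F \<in> carrier C" and D: "finite D" "coset_support F \<subseteq> D" "D \<subseteq> cosets"
  shows "induced_map F = finsum V (contribution F) D"
  unfolding induced_map_def
proof (rule M.add.finprod_mono_neutral_cong_left[OF D(1,2)])
  fix E assume E: "E \<in> D - coset_support F"
  then obtain g where g: "g \<in> carrier G" "E = g <# K" using D(3) unfolding cosets_def by blast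
  then have "F g = \<zero>\<^bsub>W\<^esub>" using E unfolding coset_support_def by blast
  then show "contribution F E = \<zero>\<^bsub>V\<^esub>" using contribution_coset[OF F g(1)] g \<iota>_zero pi_zero by simp
qed (use D contribution_closed[OF F] in auto)

lemma induced_map_closed: "F \<in> carrier C \<Longrightarrow> induced_map F \<in> carrier V"
  unfolding induced_map_def using contribution_closed coset_support_cosets
  by (intro M.finsum_closed) blast

lemma add_in_cInd:
  assumes F: "F \<in> carrier C" and F': "F' \<in> carrier C"
  shows "F \<oplus>\<^bsub>C\<^esub> F' \<in> carrier C" and "coset_support (F \<oplus>\<^bsub>C\<^esub> F') \<subseteq> coset_support F \<union> coset_support F'"
proof -
  have eq: "(F \<oplus>\<^bsub>C\<^esub> F') g = F g \<oplus>\<^bsub>W\<^esub> F' g" if "g \<in> carrier G" for g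
    using that by (simp add: cInd_def)
  show s: "coset_support (F \<oplus>\<^bsub>C\<^esub> F') \<subseteq> coset_support F \<union> coset_support F'"
    unfolding coset_support_def using eq by fastforce
  have "finite (coset_support (F \<oplus>\<^bsub>C\<^esub> F'))"
    using finite_subset[OF s] coset_support_finite F F' by blast
  moreover have "(F \<oplus>\<^bsub>C\<^esub> F') (g \<otimes> h) = \<sigma> (inv h) ((F \<oplus>\<^bsub>C\<^esub> F') g)" if "g \<in> carrier G" "h \<in> K" for g h
  proof -
    have "F (g \<otimes> h) = \<sigma> (inv h) (F g)" "F' (g \<otimes> h) = \<sigma> (inv h) (F' g)"
      using F F' that unfolding cInd_iff by blast+
    then show ?thesis
      using eq that K_carrier K_inv cInd_closed[OF F] cInd_closed[OF F'] W.pi_add by simp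
  qed
  moreover have "F \<oplus>\<^bsub>C\<^esub> F' \<in> carrier G \<rightarrow>\<^sub>E carrier W"
    using cInd_closed[OF F] cInd_closed[OF F'] by (auto simp: cInd_def)
  ultimately show "F \<oplus>\<^bsub>C\<^esub> F' \<in> carrier C" unfolding cInd_iff coset_support_def by blast
qed

lemma smult_in_cInd:
  assumes F: "F \<in> carrier C" and c: "c \<in> carrier k"
  shows "c \<odot>\<^bsub>C\<^esub> F \<in> carrier C" and "coset_support (c \<odot>\<^bsub>C\<^esub> F) \<subseteq> coset_support F"
proof -
  have eq: "(c \<odot>\<^bsub>C\<^esub> F) g = c \<odot>\<^bsub>W\<^esub> F g" if "g \<in> carrier G" for g
    using that by (simp add: cInd_def)
  show s: "coset_support (c \<odot>\<^bsub>C\<^esub> F) \<subseteq> coset_support F"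
    unfolding coset_support_def using eq c by fastforce
  have "finite (coset_support (c \<odot>\<^bsub>C\<^esub> F))"
    using finite_subset[OF s] coset_support_finite F by blast
  moreover have "(c \<odot>\<^bsub>C\<^esub> F) (g \<otimes> h) = \<sigma> (inv h) ((c \<odot>\<^bsub>C\<^esub> F) g)" if "g \<in> carrier G" "h \<in> K" for g h
  proof -
    have "F (g \<otimes> h) = \<sigma> (inv h) (F g)" using F that unfolding cInd_iff by blast
    then show ?thesis
      using eq that K_carrier K_inv cInd_closed[OF F] c W.pi_smult by simp
  qed
  moreover have "c \<odot>\<^bsub>C\<^esub> F \<in> carrier G \<rightarrow>\<^sub>E carrier W"
    using cInd_closed[OF F] c by (auto simp: cInd_def)
  ultimately show "c \<odot>\<^bsub>C\<^esub> F \<in> carrier C" unfolding cInd_iff coset_support_def by blast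
qed

lemma induced_map_add:
  assumes F: "F \<in> carrier C" and F': "F' \<in> carrier C"
  shows "induced_map (F \<oplus>\<^bsub>C\<^esub> F') = induced_map F \<oplus>\<^bsub>V\<^esub> induced_map F'"
proof -
  let ?D = "coset_support F \<union> coset_support F'"
  have D: "finite ?D" "?D \<subseteq> cosets"
    using coset_support_finite F F' coset_support_cosets by auto
  have "contribution (F \<oplus>\<^bsub>C\<^esub> F') E = contribution F E \<oplus>\<^bsub>V\<^esub> contribution F' E" if "E \<in> ?D" for E
  proof -
    have r: "rep_of E \<in> carrier G" using that D rep_of_carrier by blast
    then have "(F \<oplus>\<^bsub>C\<^esub> F') (rep_of E) = F (rep_of E) \<oplus>\<^bsub>W\<^esub> F' (rep_of E)" by (simp add: cInd_def)
    then show ?thesis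
      unfolding contribution_def using r cInd_closed[OF F r] cInd_closed[OF F' r]
      by (simp add: \<iota>_add pi_add)
  qed
  then have "finsum V (contribution (F \<oplus>\<^bsub>C\<^esub> F')) ?D =
      finsum V (\<lambda>E. contribution F E \<oplus>\<^bsub>V\<^esub> contribution F' E) ?D"
    using contribution_closed F F' D by (intro M.finsum_cong') auto
  also have "\<dots> = finsum V (contribution F) ?D \<oplus>\<^bsub>V\<^esub> finsum V (contribution F') ?D"
    using contribution_closed F F' D by (intro M.finsum_addf) auto
  finally show ?thesis
    using induced_map_eq[OF add_in_cInd(1)[OF F F'] D(1) add_in_cInd(2)[OF F F'] D(2)]
      induced_map_eq[OF F D(1) _ D(2)] induced_map_eq[OF F' D(1) _ D(2)] by simp
qed

lemma induced_map_smult: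
  assumes F: "F \<in> carrier C" and c: "c \<in> carrier k"
  shows "induced_map (c \<odot>\<^bsub>C\<^esub> F) = c \<odot>\<^bsub>V\<^esub> induced_map F"
proof -
  let ?D = "coset_support F"
  have D: "finite ?D" "?D \<subseteq> cosets"
    using coset_support_finite F coset_support_cosets by auto
  have "contribution (c \<odot>\<^bsub>C\<^esub> F) E = c \<odot>\<^bsub>V\<^esub> contribution F E" if "E \<in> ?D" for E
  proof -
    have r: "rep_of E \<in> carrier G" using that D rep_of_carrier by blast
    then have "(c \<odot>\<^bsub>C\<^esub> F) (rep_of E) = c \<odot>\<^bsub>W\<^esub> F (rep_of E)" by (simp add: cInd_def)
    then show ?thesis
      unfolding contribution_def using r cInd_closed[OF F r] c by (simp add: \<iota>_smult pi_smult)
  qed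
  then have "finsum V (contribution (c \<odot>\<^bsub>C\<^esub> F)) ?D = finsum V (\<lambda>E. c \<odot>\<^bsub>V\<^esub> contribution F E) ?D"
    using contribution_closed F c D by (intro M.finsum_cong') auto
  also have "\<dots> = c \<odot>\<^bsub>V\<^esub> finsum V (contribution F) ?D"
    using contribution_closed F D by (intro finsum_smult_ldistr[symmetric] c) auto
  finally show ?thesis
    using induced_map_eq[OF smult_in_cInd(1)[OF F c] D(1) smult_in_cInd(2)[OF F c] D(2)]
      induced_map_eq[OF F D(1) _ D(2)] by simp
qed

lemma induced_map_eq_zero:
  assumes F: "F \<in> carrier C" and z: "induced_map F = \<zero>\<^bsub>V\<^esub>" and g: "g \<in> carrier G"
  shows "F g = \<zero>\<^bsub>W\<^esub>"
proof (rule ccontr)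
  assume Fg: "F g \<noteq> \<zero>\<^bsub>W\<^esub>"
  let ?D = "coset_support F" and ?A = "rep_of ` coset_support F"
  note Dc = coset_support_cosets[of F]
  have inj: "inj_on rep_of ?D" using coset_of_rep Dc by (metis inj_onI subset_iff)
  have "finsum V (\<lambda>a. \<pi> a (\<iota> (F a))) ?A = finsum V (\<lambda>E. \<pi> (rep_of E) (\<iota> (F (rep_of E)))) ?D"
    using Dc rep_of_carrier cInd_closed[OF F] by (intro M.finsum_reindex inj) auto
  also have "\<dots> = \<zero>\<^bsub>V\<^esub>" using z unfolding induced_map_def contribution_def .
  finally have s: "finsum V (\<lambda>a. \<pi> a (\<iota> (F a))) ?A = \<zero>\<^bsub>V\<^esub>" .
  have gD: "g <# K \<in> ?D" using g Fg unfolding coset_support_def by blast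
  then have "F (rep_of (g <# K)) = \<zero>\<^bsub>W\<^esub>"
  proof (intro independent[OF _ _ _ _ s] imageI)
    show "?A \<subseteq> carrier G" using Dc rep_of_carrier by blast
    show "F \<in> ?A \<rightarrow> carrier W" using Dc rep_of_carrier cInd_closed[OF F] by blast
    show "finite ?A" using coset_support_finite[OF F] by blast
    fix a b assume ab: "a \<in> ?A" "b \<in> ?A" "inv a \<otimes> b \<in> K"
    then obtain D E where DE: "D \<in> ?D" "a = rep_of D" "E \<in> ?D" "b = rep_of E" by blast
    then have "a \<in> carrier G" "b \<in> carrier G" "a <# K = D" "b <# K = E"
      using Dc rep_of_carrier coset_of_rep by blast+
    then show "a = b" using coset_eqI[of a b] ab(3) DE by simp
  qed
  then have "contribution F (g <# K) = \<zero>\<^bsub>V\<^esub>"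
    unfolding contribution_def using \<iota>_zero pi_zero rep_of_carrier Dc gD by auto
  then have "\<pi> (inv g) (\<pi> g (\<iota> (F g))) = \<zero>\<^bsub>V\<^esub>"
    using contribution_coset[OF F g] pi_zero g by simp
  then show False using pi_inv(1)[OF g] cInd_closed[OF F g] \<iota>_eq_zero Fg by simp
qed

lemma induced_map_inj: "inj_on induced_map (carrier C)"
proof (rule inj_onI)
  fix F F' assume F: "F \<in> carrier C" and F': "F' \<in> carrier C" and eq: "induced_map F = induced_map F'"
  let ?c = "\<ominus>\<^bsub>k\<^esub> \<one>\<^bsub>k\<^esub>"
  have c: "?c \<in> carrier k" by simp
  note n = smult_in_cInd(1)[OF F' c]
  have "induced_map (F \<oplus>\<^bsub>C\<^esub> ?c \<odot>\<^bsub>C\<^esub> F') = \<zero>\<^bsub>V\<^esub>"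
    using induced_map_add[OF F n] induced_map_smult[OF F' c] induced_map_closed[OF F'] eq
    by (simp add: smult_l_minus M.r_neg)
  then have z: "(F \<oplus>\<^bsub>C\<^esub> ?c \<odot>\<^bsub>C\<^esub> F') g = \<zero>\<^bsub>W\<^esub>" if "g \<in> carrier G" for g
    using induced_map_eq_zero[OF add_in_cInd(1)[OF F n] _ that] by blast
  show "F = F'"
  proof (rule cInd_eqI[OF F F'])
    fix g assume g: "g \<in> carrier G"
    have "F g \<oplus>\<^bsub>W\<^esub> \<ominus>\<^bsub>W\<^esub> F' g = \<zero>\<^bsub>W\<^esub>"
      using z[OF g] g cInd_closed[OF F' g] by (simp add: cInd_def W.smult_l_minus)
    then show "F g = F' g"
      using cInd_closed[OF F g] cInd_closed[OF F' g] by (metis W.M.add.inv_closed W.M.minus_equality W.M.minus_minus)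
  qed
qed

lemma action_in_cInd:
  assumes F: "F \<in> carrier C" and g: "g \<in> carrier G"
  shows "cInd_action G g F \<in> carrier C" and "induced_map (cInd_action G g F) = \<pi> g (induced_map F)"
proof -
  let ?F = "cInd_action G g F"
  have shift: "?F (g \<otimes> a) = F a" if "a \<in> carrier G" for a
    using that g by (simp add: cInd_action_def G.m_assoc[symmetric])
  have unshift: "a = g \<otimes> (inv g \<otimes> a)" if "a \<in> carrier G" for a
    using that g by (simp add: G.m_assoc[symmetric])
  have tr: "(g \<otimes> a) <# K = g <# (a <# K)" if "a \<in> carrier G" for a
    using G.lcos_m_assoc[OF subgroup.subset[OF K_subgroup] g that] by simp
  have supp: "coset_support ?F = (\<lambda>D. g <# D) ` coset_support F"
  proof
    show "coset_support ?F \<subseteq> (\<lambda>D. g <# D) ` coset_support F"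
    proof
      fix D assume "D \<in> coset_support ?F"
      then obtain a where a: "a \<in> carrier G" "?F a \<noteq> \<zero>\<^bsub>W\<^esub>" "D = a <# K"
        unfolding coset_support_def by blast
      let ?b = "inv g \<otimes> a"
      have b: "?b \<in> carrier G" "F ?b \<noteq> \<zero>\<^bsub>W\<^esub>" using a g by (simp_all add: cInd_action_def)
      have "D = g <# (?b <# K)" using tr[OF b(1)] unshift[OF a(1)] a(3) by simp
      then show "D \<in> (\<lambda>D. g <# D) ` coset_support F" using b unfolding coset_support_def by blast
    qed
    show "(\<lambda>D. g <# D) ` coset_support F \<subseteq> coset_support ?F"
      unfolding coset_support_def using shift tr g by (force intro: G.m_closed)
  qed
  have "?F (a \<otimes> h) = \<sigma> (inv h) (?F a)" if "a \<in> carrier G" "h \<in> K" for a h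
    using F that g K_carrier unfolding cInd_iff by (simp add: cInd_action_def G.m_assoc[symmetric])
  moreover have "finite (coset_support ?F)" unfolding supp using coset_support_finite[OF F] by blast
  moreover have "?F \<in> carrier G \<rightarrow>\<^sub>E carrier W"
    using cInd_closed[OF F] g by (auto simp: cInd_action_def)
  ultimately show F': "?F \<in> carrier C" unfolding cInd_iff coset_support_def by blast
  have inj: "inj_on (\<lambda>D. g <# D) (coset_support F)"
  proof (rule inj_onI)
    fix D E assume "D \<in> coset_support F" "E \<in> coset_support F" "g <# D = g <# E"
    then show "D = E"
      using coset_support_cosets[of F] G.lcos_m_assoc[of _ "inv g" g] g
        G.lcos_mult_one G.l_coset_subset_G[OF subgroup.subset[OF K_subgroup]] unfolding cosets_def
      by (smt (verit) G.inv_closed G.l_inv mem_Collect_eq subset_iff)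
  qed
  have contr: "contribution ?F (g <# D) = \<pi> g (contribution F D)" if D: "D \<in> coset_support F" for D
  proof -
    obtain a where a: "a \<in> carrier G" "D = a <# K" using D unfolding coset_support_def by blast
    have "contribution ?F (g <# D) = \<pi> (g \<otimes> a) (\<iota> (F a))"
      using contribution_coset[OF F', of "g \<otimes> a"] shift[OF a(1)] tr[OF a(1)] a g by simp
    then show ?thesis
      using contribution_coset[OF F a(1)] a g cInd_closed[OF F a(1)] by (simp add: pi_mult)
  qed
  have cl: "contribution F \<in> coset_support F \<rightarrow> carrier V"
    using contribution_closed[OF F] coset_support_cosets by blast
  have "induced_map ?F = finsum V (\<lambda>D. contribution ?F (g <# D)) (coset_support F)"
    unfolding induced_map_def supp using contribution_closed[OF F'] coset_support_cosets[of ?F]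
    by (intro M.finsum_reindex inj) (auto simp: supp)
  also have "\<dots> = finsum V (\<lambda>D. \<pi> g (contribution F D)) (coset_support F)"
    using contr cl g by (intro M.finsum_cong') (auto simp: Pi_iff)
  finally show "induced_map ?F = \<pi> g (induced_map F)"
    unfolding induced_map_def \<pi>_finsum[OF g cl] .
qed

lemma tensor_in_cInd:
  assumes g: "g \<in> carrier G" and w: "w \<in> carrier W"
  shows "cInd_tensor G K W \<sigma> g w \<in> carrier C"
    and "induced_map (cInd_tensor G K W \<sigma> g w) = \<pi> g (\<iota> w)"
    and "cInd_tensor G K W \<sigma> g w g = w"
proof -
  let ?F = "cInd_tensor G K W \<sigma> g w"
  show 1: "?F g = w" using g w K_one \<sigma>_one by (simp add: cInd_tensor_def)
  have supp: "coset_support ?F \<subseteq> {g <# K}"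
    unfolding coset_support_def cInd_tensor_def using coset_eqI[OF g] by (auto split: if_splits)
  have "?F (a \<otimes> h) = \<sigma> (inv h) (?F a)" if a: "a \<in> carrier G" and h: "h \<in> K" for a h
  proof -
    let ?b = "inv g \<otimes> a"
    have b: "?b \<in> carrier G" using a g by simp
    have "?b \<otimes> h \<in> K \<longleftrightarrow> ?b \<in> K"
    proof
      assume "?b \<otimes> h \<in> K"
      then have "(?b \<otimes> h) \<otimes> inv h \<in> K" using h K_inv K_mult by blast
      then show "?b \<in> K" using b h K_carrier by (simp add: G.m_assoc)
    qed (use h K_mult in blast)
    moreover have "\<sigma> (inv (?b \<otimes> h)) w = \<sigma> (inv h) (\<sigma> (inv ?b) w)" if "?b \<in> K"
      using that h w b K_carrier K_inv by (simp add: \<sigma>_mult G.inv_mult_group)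
    ultimately show ?thesis
      using a h g K_carrier K_inv \<sigma>_zero by (simp add: cInd_tensor_def G.m_assoc[symmetric])
  qed
  moreover have "finite (coset_support ?F)" using finite_subset[OF supp] by blast
  moreover have "?F \<in> carrier G \<rightarrow>\<^sub>E carrier W"
    using w g K_inv \<sigma>_closed by (auto simp: cInd_tensor_def)
  ultimately show F: "?F \<in> carrier C" unfolding cInd_iff coset_support_def by blast
  have "induced_map ?F = finsum V (contribution ?F) {g <# K}"
    using g by (intro induced_map_eq[OF F _ supp]) (auto simp: cosets_def)
  also have "\<dots> = \<pi> g (\<iota> w)"
    using contribution_coset[OF F g] 1 g w by simp
  finally show "induced_map ?F = \<pi> g (\<iota> w)" .
qed

text \<open>The functions with values in \<open>U\<close> form a subrepresentation, whose image in the irreducible \<open>V\<close> is nonzero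
  because \<open>\<iota>\<close> is injective on \<open>U\<close>.\<close>

lemma induced_map_onto:
  assumes U: "submodule U k W" and stable: "\<And>h u. \<lbrakk>h \<in> K; u \<in> U\<rbrakk> \<Longrightarrow> \<sigma> h u \<in> U"
    and ne: "U \<noteq> {\<zero>\<^bsub>W\<^esub>}"
  shows "induced_map ` {F \<in> carrier C. \<forall>g\<in>carrier G. F g \<in> U} = carrier V"
proof -
  let ?I = "{F \<in> carrier C. \<forall>g\<in>carrier G. F g \<in> U}"
  note UE = W.submoduleE[OF U]
  have U0: "\<zero>\<^bsub>W\<^esub> \<in> U" by (rule W.submodule_zero[OF U])
  have tensor: "cInd_tensor G K W \<sigma> \<one> u \<in> ?I" if u: "u \<in> U" for u
    using tensor_in_cInd(1)[OF G.one_closed, of u] UE(1) u stable K_inv U0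
    by (auto simp: cInd_tensor_def)
  have add: "F \<oplus>\<^bsub>C\<^esub> F' \<in> ?I" if "F \<in> ?I" "F' \<in> ?I" for F F'
    using that add_in_cInd(1) UE(5) by (auto simp: cInd_def)
  have smult: "c \<odot>\<^bsub>C\<^esub> F \<in> ?I" if "c \<in> carrier k" "F \<in> ?I" for c F
    using that smult_in_cInd(1) UE(4) by (auto simp: cInd_def)
  have "submodule (induced_map ` ?I) k V"
  proof (rule submoduleI)
    show "induced_map ` ?I \<subseteq> carrier V" using induced_map_closed by blast
    have "induced_map (cInd_tensor G K W \<sigma> \<one> \<zero>\<^bsub>W\<^esub>) = \<zero>\<^bsub>V\<^esub>"
      using tensor_in_cInd(2)[OF G.one_closed, of "\<zero>\<^bsub>W\<^esub>"] \<iota>_zero pi_zero by simp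
    then show "\<zero>\<^bsub>V\<^esub> \<in> induced_map ` ?I" by (rule image_eqI[OF sym tensor[OF U0]])
  next
    fix a assume "a \<in> induced_map ` ?I"
    then obtain F where F: "F \<in> ?I" "a = induced_map F" by blast
    have "\<ominus>\<^bsub>V\<^esub> a = induced_map ((\<ominus>\<^bsub>k\<^esub> \<one>\<^bsub>k\<^esub>) \<odot>\<^bsub>C\<^esub> F)"
      using F induced_map_smult[of F "\<ominus>\<^bsub>k\<^esub> \<one>\<^bsub>k\<^esub>"] induced_map_closed[of F] by (simp add: smult_l_minus)
    then show "\<ominus>\<^bsub>V\<^esub> a \<in> induced_map ` ?I" using smult[OF _ F(1), of "\<ominus>\<^bsub>k\<^esub> \<one>\<^bsub>k\<^esub>"] by auto
  next
    fix a b assume "a \<in> induced_map ` ?I" "b \<in> induced_map ` ?I"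
    then obtain F F' where F: "F \<in> ?I" "a = induced_map F" "F' \<in> ?I" "b = induced_map F'" by blast
    then have "a \<oplus>\<^bsub>V\<^esub> b = induced_map (F \<oplus>\<^bsub>C\<^esub> F')" using induced_map_add by simp
    then show "a \<oplus>\<^bsub>V\<^esub> b \<in> induced_map ` ?I" using add[OF F(1,3)] by blast
  next
    fix c a assume c: "c \<in> carrier k" and "a \<in> induced_map ` ?I"
    then obtain F where F: "F \<in> ?I" "a = induced_map F" by blast
    then have "c \<odot>\<^bsub>V\<^esub> a = induced_map (c \<odot>\<^bsub>C\<^esub> F)" using induced_map_smult c by simp
    then show "c \<odot>\<^bsub>V\<^esub> a \<in> induced_map ` ?I" using smult[OF c F(1)] by blast
  qed
  moreover have "\<pi> g a \<in> induced_map ` ?I" if g: "g \<in> carrier G" and a: "a \<in> induced_map ` ?I" for g a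
  proof -
    obtain F where F: "F \<in> ?I" "a = induced_map F" using a by blast
    have "cInd_action G g F \<in> ?I"
      using F(1) action_in_cInd(1)[OF _ g, of F] g by (auto simp: cInd_action_def)
    moreover have "\<pi> g a = induced_map (cInd_action G g F)"
      using action_in_cInd(2)[OF _ g, of F] F by simp
    ultimately show ?thesis by (simp only: image_eqI)
  qed
  moreover have "induced_map ` ?I \<noteq> {\<zero>\<^bsub>V\<^esub>}"
  proof
    assume z: "induced_map ` ?I = {\<zero>\<^bsub>V\<^esub>}"
    have "u = \<zero>\<^bsub>W\<^esub>" if u: "u \<in> U" for u
    proof -
      have uW: "u \<in> carrier W" using UE(1) u by blast
      have "induced_map (cInd_tensor G K W \<sigma> \<one> u) = \<zero>\<^bsub>V\<^esub>" using z tensor[OF u] by blast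
      then show ?thesis using tensor_in_cInd(2)[OF G.one_closed uW] pi_one \<iota>_eq_zero[OF uW] uW by simp
    qed
    then show False using ne U0 by blast
  qed
  ultimately show ?thesis using irreducible unfolding irreducible_representation_def by blast
qed

text \<open>For a nonzero subrepresentation \<open>U\<close> and \<open>w\<close> in \<open>W\<close>, the image of the tensor of \<open>\<one>\<close> and \<open>w\<close> is also the image of
  a function with values in \<open>U\<close>. By injectivity the two functions agree, and the value at \<open>\<one>\<close> of the first is \<open>w\<close>.\<close>

theorem W_irreducible: "irreducible_representation k (G\<lparr>carrier := K\<rparr>) W \<sigma>"
  unfolding irreducible_representation_def
proof (intro conjI allI impI W_rep W_nonzero)
  fix U assume "submodule U k W \<and> (\<forall>g\<in>carrier (G\<lparr>carrier := K\<rparr>). \<forall>u\<in>U. \<sigma> g u \<in> U)"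
  then have U: "submodule U k W" and st: "\<And>h u. \<lbrakk>h \<in> K; u \<in> U\<rbrakk> \<Longrightarrow> \<sigma> h u \<in> U" by auto
  show "U = {\<zero>\<^bsub>W\<^esub>} \<or> U = carrier W"
  proof (rule disjCI)
    assume "U \<noteq> carrier W"
    show "U = {\<zero>\<^bsub>W\<^esub>}"
    proof (rule ccontr)
      assume "U \<noteq> {\<zero>\<^bsub>W\<^esub>}"
      then have onto: "induced_map ` {F \<in> carrier C. \<forall>g\<in>carrier G. F g \<in> U} = carrier V"
        using st by (intro induced_map_onto[OF U])
      have "w \<in> U" if w: "w \<in> carrier W" for w
      proof -
        let ?t = "cInd_tensor G K W \<sigma> \<one> w"
        note t = tensor_in_cInd[OF G.one_closed w]
        have "induced_map ?t \<in> induced_map ` {F \<in> carrier C. \<forall>g\<in>carrier G. F g \<in> U}"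
          unfolding onto using induced_map_closed[OF t(1)] .
        then obtain F where F: "F \<in> carrier C" "\<forall>g\<in>carrier G. F g \<in> U" "induced_map ?t = induced_map F"
          by blast
        then have "?t = F" using inj_onD[OF induced_map_inj _ t(1)] by blast
        then show ?thesis using t(3) F(2) G.one_closed by metis
      qed
      then show False using \<open>U \<noteq> carrier W\<close> W.submoduleE(1)[OF U] by blast
    qed
  qed
qed

theorem induced_map_isomorphism: "rep_isomorphism k G C (cInd_action G) V \<pi> induced_map"
  unfolding rep_isomorphism_def
proof (intro conjI ballI)
  show "induced_map \<in> linear_maps k C V"
    unfolding linear_maps_def hom_def
    using induced_map_closed induced_map_add induced_map_smult by auto
  have "induced_map ` {F \<in> carrier C. \<forall>g\<in>carrier G. F g \<in> carrier W} = carrier V"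
    by (rule induced_map_onto[OF W.carrier_is_submodule \<sigma>_closed W_nonzero])
  moreover have "{F \<in> carrier C. \<forall>g\<in>carrier G. F g \<in> carrier W} = carrier C"
    using cInd_closed by blast
  ultimately show "bij_betw induced_map (carrier C) (carrier V)"
    using induced_map_inj unfolding bij_betw_def by simp
qed (use action_in_cInd(2) in blast)

end

section \<open>Balls and supports\<close>

lemma Inl_in_vertex_ball: "Inl p \<in> vertex_ball X x r \<longleftrightarrow> p \<in> verts X \<and> tree_dist X x p \<le> r"
  unfolding vertex_ball_def by auto

lemma Inr_in_vertex_ball:
  "Inr e \<in> vertex_ball X x r \<longleftrightarrow> e \<in> edges X \<and> (\<forall>p\<in>e. tree_dist X x p \<le> r)"
  unfolding vertex_ball_def by auto

lemma Inl_in_edge_ball: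
  "Inl p \<in> edge_ball X e r \<longleftrightarrow> p \<in> verts X \<and> (\<exists>x\<in>e. tree_dist X x p \<le> r)"
  unfolding edge_ball_def by (auto simp: Inl_in_vertex_ball)

lemma Inr_in_edge_ball:
  "Inr d \<in> edge_ball X e r \<longleftrightarrow> d = e \<or> d \<in> edges X \<and> (\<exists>x\<in>e. \<forall>p\<in>d. tree_dist X x p \<le> r)"
  unfolding edge_ball_def by (auto simp: Inr_in_vertex_ball)

lemma (in tree_graph) ball_subset:
  assumes "is_ball X r B" shows "B \<subseteq> Inl ` verts X \<union> Inr ` edges X"
  using assms unfolding is_ball_def vertex_ball_def edge_ball_def by auto

text \<open>By this, the vertices in the support of a section decide whether a ball contains the support. For the ball around
  an edge \<open>{x, y}\<close>, an edge with both endpoints on the side of \<open>x\<close> lies in the ball around \<open>x\<close>, and likewise for \<open>y\<close>.\<close>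

lemma (in tree_graph) ball_contains_edge:
  assumes B: "is_ball X r B" and d: "d \<in> edges X" and sub: "Inl ` d \<subseteq> B"
  shows "Inr d \<in> B"
  using B unfolding is_ball_def
proof (elim disjE bexE)
  fix x assume "B = vertex_ball X x r"
  then show ?thesis using sub d by (auto simp: Inl_in_vertex_ball Inr_in_vertex_ball)
next
  fix e assume e: "e \<in> edges X" and Be: "B = edge_ball X e r"
  obtain x y where xy: "e = {x, y}" by (rule edge_obtain[OF e])
  obtain a b where ab: "d = {a, b}" by (rule edge_obtain[OF d])
  have eX: "{x, y} \<in> edges X" and dX: "{a, b} \<in> edges X" using e d xy ab by auto
  note v = edge_endpoints[OF eX] edge_endpoints[OF dX]
  have near: "tree_dist X x p \<le> r \<or> tree_dist X y p \<le> r" if "p = a \<or> p = b" for p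
    using sub that unfolding ab Be xy by (auto simp: Inl_in_edge_ball)
  \<comment> \<open>The path from \<open>p\<close> to \<open>q\<close> crosses \<open>{x, y}\<close> and has length one.\<close>
  have cross: "{p, q} = {x, y}"
    if "{p, q} \<in> edges X" "tree_dist X x p < tree_dist X y p" "tree_dist X y q < tree_dist X x q" for p q
  proof -
    note w = edge_endpoints[OF that(1)]
    have "tree_dist X p q = tree_dist X p x + 1 + tree_dist X y q"
      by (rule dist_across_edge[OF eX w(1,2) that(2,3)])
    then show ?thesis using tree_dist_edge[OF that(1)] tree_dist_eq_0 v w by auto
  qed
  consider "d = e" | "tree_dist X x a < tree_dist X y a" "tree_dist X x b < tree_dist X y b"
    | "tree_dist X y a < tree_dist X x a" "tree_dist X y b < tree_dist X x b"
    using cross[of a b] cross[of b a] dX unfolding ab xy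
    by (cases rule: edge_dist_cases[OF eX v(4)]; cases rule: edge_dist_cases[OF eX v(5)])
      (auto simp: insert_commute)
  then show ?thesis
  proof cases
    case 1
    then show ?thesis unfolding Be by (simp add: Inr_in_edge_ball)
  next
    case 2
    then have "\<forall>p\<in>d. tree_dist X x p \<le> r" using near[of a] near[of b] ab by auto
    then show ?thesis using d unfolding Be xy by (auto simp: Inr_in_edge_ball)
  next
    case 3
    then have "\<forall>p\<in>d. tree_dist X y p \<le> r" using near[of a] near[of b] ab by auto
    then show ?thesis using d unfolding Be xy by (auto simp: Inr_in_edge_ball)
  qed
qed

context plumbed_representation
begin

lemma simple_path_image:
  assumes g: "g \<in> carrier G" and p: "simple_path X x y p"
  shows "simple_path X (\<phi> g x) (\<phi> g y) (map (\<phi> g) p)"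
proof -
  have s: "set p \<subseteq> verts X" "distinct p" "successively (\<lambda>a b. {a, b} \<in> edges X) p" "p \<noteq> []"
      "hd p = x" "last p = y"
    using p unfolding simple_path_def by auto
  have "inj_on (\<phi> g) (set p)" using vertices.inj_prop[OF g] s(1) by (rule inj_on_subset)
  moreover have "successively (\<lambda>a b. {\<phi> g a, \<phi> g b} \<in> edges X) p"
    using s(3) edge_image[OF g] by (elim successively_mono) force
  ultimately show ?thesis
    using s vertex_image[OF g]
    unfolding simple_path_def by (auto simp: hd_map last_map distinct_map successively_map)
qed

lemma tree_dist_image:
  assumes "g \<in> carrier G" "x \<in> verts X" "y \<in> verts X"
  shows "tree_dist X (\<phi> g x) (\<phi> g y) = tree_dist X x y"
  unfolding tree_dist_def
  using tree_path_eqI[OF simple_path_image[OF assms(1) tree_path_simple[OF assms(2,3)]]] by simp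

definition cell_image :: "'g \<Rightarrow> 'x + 'x set \<Rightarrow> 'x + 'x set" where
  "cell_image g = map_sum (\<phi> g) ((`) (\<phi> g))"

lemma cell_image_simps [simp]:
  "cell_image g (Inl x) = Inl (\<phi> g x)" "cell_image g (Inr e) = Inr (\<phi> g ` e)"
  by (simp_all add: cell_image_def)

lemma edge_subset_verts: "e \<in> edges X \<Longrightarrow> x \<in> e \<Longrightarrow> x \<in> verts X"
  using is_tree unfolding tree_def by blast

lemma cell_image_mult:
  assumes "g \<in> carrier G" "h \<in> carrier G" "b \<in> Inl ` verts X \<union> Inr ` edges X"
  shows "cell_image g (cell_image h b) = cell_image (g \<otimes> h) b"
  using assms vertices.composition_rule edge_subset_verts
  by (auto simp: image_image intro!: image_cong)

lemma cell_image_inv: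
  assumes "g \<in> carrier G" "b \<in> Inl ` verts X \<union> Inr ` edges X"
  shows "cell_image (inv g) (cell_image g b) = b" "cell_image g (cell_image (inv g) b) = b"
  using assms vertex_image_inv edge_subset_verts by (force simp: image_image)+

lemma setwise_stabilizer_iff:
  "g \<in> setwise_stabilizer G \<phi> B \<longleftrightarrow> g \<in> carrier G \<and> cell_image g ` B = B"
  unfolding setwise_stabilizer_def stabilizer_def cell_image_def by simp

lemma setwise_stabilizer_subgroup:
  assumes B: "B \<subseteq> Inl ` verts X \<union> Inr ` edges X"
  shows "subgroup (setwise_stabilizer G \<phi> B) G"
proof (rule G.subgroupI)
  have "cell_image \<one> b = b" if "b \<in> B" for b
    using cell_image_mult[of "inv \<one>" \<one> b] cell_image_inv[of \<one> b] that B by auto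
  then have "cell_image \<one> ` B = B" by simp
  then show "setwise_stabilizer G \<phi> B \<noteq> {}" using setwise_stabilizer_iff by blast
next
  fix g assume "g \<in> setwise_stabilizer G \<phi> B"
  then have g: "g \<in> carrier G" "cell_image g ` B = B" using setwise_stabilizer_iff by blast+
  have "cell_image (inv g) (cell_image g b) = b" if "b \<in> B" for b
    using cell_image_inv(1)[OF g(1)] B that by blast
  then have "cell_image (inv g) ` (cell_image g ` B) = B" by (simp add: image_image)
  then show "inv g \<in> setwise_stabilizer G \<phi> B" using g setwise_stabilizer_iff by simp
next
  fix g h assume "g \<in> setwise_stabilizer G \<phi> B" "h \<in> setwise_stabilizer G \<phi> B"
  then have g: "g \<in> carrier G" "cell_image g ` B = B" and h: "h \<in> carrier G" "cell_image h ` B = B"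
    using setwise_stabilizer_iff by blast+
  have "cell_image g (cell_image h b) = cell_image (g \<otimes> h) b" if "b \<in> B" for b
    using cell_image_mult[OF g(1) h(1)] B that by blast
  then have "cell_image (g \<otimes> h) ` B = cell_image g ` (cell_image h ` B)" by (simp add: image_image)
  then show "g \<otimes> h \<in> setwise_stabilizer G \<phi> B" using g h setwise_stabilizer_iff by simp
qed (use setwise_stabilizer_iff in auto)

lemma vertex_ball_image:
  assumes "g \<in> carrier G" "x \<in> verts X" "b \<in> vertex_ball X x r"
  shows "cell_image g b \<in> vertex_ball X (\<phi> g x) r"
  using assms edge_subset_verts edge_image[OF assms(1)] vertex_image[OF assms(1)] tree_dist_image
  by (cases b) (auto simp: Inl_in_vertex_ball Inr_in_vertex_ball)

lemma edge_ball_image: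
  assumes g: "g \<in> carrier G" and e: "e \<in> edges X" and "b \<in> edge_ball X e r"
  shows "cell_image g b \<in> edge_ball X (\<phi> g ` e) r"
  using assms vertex_ball_image[OF g edge_subset_verts[OF e]] unfolding edge_ball_def by auto

lemma stabilizerI:
  assumes B: "B \<subseteq> Inl ` verts X \<union> Inr ` edges X" and g: "g \<in> carrier G"
    and sub: "\<And>b. b \<in> B \<Longrightarrow> cell_image g b \<in> B" "\<And>b. b \<in> B \<Longrightarrow> cell_image (inv g) b \<in> B"
  shows "g \<in> setwise_stabilizer G \<phi> B"
proof -
  have "B \<subseteq> cell_image g ` B"
  proof
    fix b assume b: "b \<in> B"
    have "cell_image g (cell_image (inv g) b) = b" using cell_image_inv(2)[OF g] B b by blast
    then show "b \<in> cell_image g ` B" by (rule image_eqI[OF sym sub(2)[OF b]])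
  qed
  then show ?thesis using sub(1) g setwise_stabilizer_iff by blast
qed

lemma fixes_center_vertex:
  assumes g: "g \<in> carrier G" and x: "x \<in> verts X" and "\<phi> g x = x"
  shows "g \<in> setwise_stabilizer G \<phi> (vertex_ball X x r)"
proof (rule stabilizerI[OF _ g])
  show "vertex_ball X x r \<subseteq> Inl ` verts X \<union> Inr ` edges X" unfolding vertex_ball_def by auto
  have "\<phi> (inv g) x = x" using vertex_image_inv(1)[OF g x] assms(3) by simp
  then show "cell_image (inv g) b \<in> vertex_ball X x r" if "b \<in> vertex_ball X x r" for b
    using vertex_ball_image[of "inv g" x b r] g x that by simp
  show "cell_image g b \<in> vertex_ball X x r" if "b \<in> vertex_ball X x r" for b
    using vertex_ball_image[of g x b r] g x that assms(3) by simp
qed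

lemma edge_image_inv:
  assumes "g \<in> carrier G" "e \<in> edges X" shows "\<phi> (inv g) ` (\<phi> g ` e) = e"
  using cell_image_inv(1)[of g "Inr e"] assms by simp

lemma fixes_center_edge:
  assumes g: "g \<in> carrier G" and e: "e \<in> edges X" and "\<phi> g ` e = e"
  shows "g \<in> setwise_stabilizer G \<phi> (edge_ball X e r)"
proof (rule stabilizerI[OF _ g])
  show "edge_ball X e r \<subseteq> Inl ` verts X \<union> Inr ` edges X"
    using e unfolding edge_ball_def vertex_ball_def by auto
  have "\<phi> (inv g) ` e = e" using edge_image_inv[OF g e] assms(3) by simp
  then show "cell_image (inv g) b \<in> edge_ball X e r" if "b \<in> edge_ball X e r" for b
    using edge_ball_image[of "inv g" e b r] g e that by simp
  show "cell_image g b \<in> edge_ball X e r" if "b \<in> edge_ball X e r" for b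
    using edge_ball_image[of g e b r] g e that assms(3) by simp
qed

definition vertex_support :: "'v \<Rightarrow> 'x set" where "vertex_support v = {x \<in> verts X. v \<notin> Aug x}"

lemma vertex_support_image:
  assumes g: "g \<in> carrier G" and v: "v \<in> carrier V"
  shows "vertex_support (\<pi> g v) = \<phi> g ` vertex_support v"
proof
  have sub: "vertex_support (\<pi> h u) \<subseteq> \<phi> h ` vertex_support u" if h: "h \<in> carrier G" and u: "u \<in> carrier V" for h u
  proof
    fix y assume y: "y \<in> vertex_support (\<pi> h u)"
    let ?x = "\<phi> (inv h) y"
    have yX: "y \<in> verts X" using y unfolding vertex_support_def by blast
    have x: "?x \<in> verts X" "y = \<phi> h ?x"
      using vertex_image[of "inv h" y] vertex_image_inv(2)[OF h yX] h yX by auto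
    have "u \<notin> Aug ?x" using Aug_image[OF h x(1)] x(2) y unfolding vertex_support_def by auto
    then show "y \<in> \<phi> h ` vertex_support u" using x unfolding vertex_support_def by blast
  qed
  show "vertex_support (\<pi> g v) \<subseteq> \<phi> g ` vertex_support v" by (rule sub[OF g v])
  have "vertex_support v \<subseteq> \<phi> (inv g) ` vertex_support (\<pi> g v)" using sub[of "inv g" "\<pi> g v"] g v pi_inv(1) by simp
  then have "\<phi> g ` vertex_support v \<subseteq> \<phi> g ` \<phi> (inv g) ` vertex_support (\<pi> g v)" by blast
  also have "\<dots> = (\<lambda>y. y) ` vertex_support (\<pi> g v)"
    unfolding image_image using vertex_image_inv(2)[OF g] by (intro image_cong) (auto simp: vertex_support_def)
  also have "\<dots> = vertex_support (\<pi> g v)" by simp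
  finally show "\<phi> g ` vertex_support v \<subseteq> vertex_support (\<pi> g v)" .
qed

lemma vertex_support_zero: "vertex_support \<zero>\<^bsub>V\<^esub> = {}"
  unfolding vertex_support_def using submodule_zero[OF Aug_submodule] by blast

text \<open>Passing to the coinvariants at \<open>p\<close> kills every summand whose support does not contain \<open>p\<close>, so
  \<open>f a\<close> cannot be the only one that survives.\<close>

lemma sum_zero_support:
  assumes A: "finite A" and f: "f \<in> A \<rightarrow> carrier V" and z: "finsum V f A = \<zero>\<^bsub>V\<^esub>"
    and a: "a \<in> A" and p: "p \<in> vertex_support (f a)"
  obtains b where "b \<in> A" "b \<noteq> a" "p \<in> vertex_support (f b)"
proof (rule ccontr)
  assume "\<not> thesis"
  have pX: "p \<in> verts X" using p unfolding vertex_support_def by blast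
  note s = Aug_submodule[OF pX]
  let ?s = "finsum V f (A - {a})"
  have U: "?s \<in> Aug p"
    using that \<open>\<not> thesis\<close> pX by (intro submodule_finsum[OF s]) (auto simp: vertex_support_def)
  have "finsum V f (insert a (A - {a})) = f a \<oplus>\<^bsub>V\<^esub> ?s"
    using A f a by (intro M.finsum_insert) auto
  then have "f a \<oplus>\<^bsub>V\<^esub> ?s = \<zero>\<^bsub>V\<^esub>" using z a by (simp add: insert_absorb)
  then have "f a = \<ominus>\<^bsub>V\<^esub> ?s" using f a Aug_carrier[OF pX U] by (auto intro: M.minus_equality[symmetric])
  then have "f a \<in> Aug p" using submoduleE(3)[OF s U] by simp
  then show False using p unfolding vertex_support_def by blast
qed

end

context localized_representation
begin

lemma vertex_support_empty: 
  assumes v: "v \<in> carrier V" and "vertex_support v = {}" shows "v = \<zero>\<^bsub>V\<^esub>"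
proof (rule inj_onD[OF L_inj _ v])
  have "coinv_class k V \<pi> (N x) v = coinv_class k V \<pi> (N x) \<zero>\<^bsub>V\<^esub>" if x: "x \<in> verts X" for x
  proof -
    have "v \<in> Aug x" using assms(2) x unfolding vertex_support_def by blast
    then show ?thesis
      using class_zero_iff[OF N_carrier[OF x] v] class_zero[OF N_carrier[OF x]] by simp
  qed
  then show "L v = L \<zero>\<^bsub>V\<^esub>" unfolding localization_map_def by (auto intro: restrict_ext)
qed simp

lemma Inl_in_support:
  assumes v: "v \<in> carrier V" shows "Inl x \<in> section_support X S (L v) \<longleftrightarrow> x \<in> vertex_support v"
proof -
  have "Inl x \<in> section_support X S (L v) \<longleftrightarrow> x \<in> verts X \<and> L v x \<noteq> \<zero>\<^bsub>vstalk S x\<^esub>"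
    unfolding section_support_def by blast
  then show ?thesis
    using class_zero_iff[OF N_carrier v, of x] L_apply[of x v] vstalk_S[of x] unfolding vertex_support_def by force
qed

lemma Inr_in_support:
  assumes v: "v \<in> carrier V" and e: "Inr e \<in> section_support X S (L v)"
  shows "e \<in> edges X" and "e \<subseteq> vertex_support v"
proof -
  show eX: "e \<in> edges X" using e unfolding section_support_def by auto
  have ne: "edge_value S (L v) e \<noteq> \<zero>\<^bsub>estalk S e\<^esub>" using e unfolding section_support_def by auto
  let ?c = "coinv_class k V \<pi> (edge_subgroup G N e) v"
  have r: "res S x e (L v x) = ?c" if "x \<in> e" for x
    using res_L[OF eX that v] L_apply[OF edge_subset_verts[OF eX that]] by simp
  have "edge_value S (L v) e = ?c"
    unfolding edge_value_def using r edge_nonempty_finite(1)[OF eX] by (intro the_equality) auto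
  then have nz: "?c \<noteq> \<zero>\<^bsub>coinvariants k V \<pi> (edge_subgroup G N e)\<^esub>"
    using ne by (simp add: localization_def)
  show "e \<subseteq> vertex_support v"
  proof
    fix x assume x: "x \<in> e"
    obtain y where y: "e = {x, y}" by (rule edge_obtain_other[OF eX x])
    have eX': "{x, y} \<in> edges X" using eX y by simp
    note c = edge_subgroup_carrier[OF eX']
    have "Aug x \<subseteq> aug_space k V \<pi> (edge_subgroup G N e)"
      unfolding y using N_subset_edge_subgroup[OF eX']
      by (intro aug_space_least[OF aug_submodule[OF c]] aug_space_generator) auto
    moreover have "v \<notin> aug_space k V \<pi> (edge_subgroup G N e)"
      using nz class_zero_iff[OF c v] y by simp
    ultimately show "x \<in> vertex_support v" using edge_subset_verts[OF eX x] unfolding vertex_support_def by blast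
  qed
qed

lemma support_in_ball_iff:
  assumes v: "v \<in> carrier V" and B: "is_ball X r B"
  shows "section_support X S (L v) \<subseteq> B \<longleftrightarrow> Inl ` vertex_support v \<subseteq> B"
proof
  assume "section_support X S (L v) \<subseteq> B"
  then show "Inl ` vertex_support v \<subseteq> B" using Inl_in_support[OF v] by blast
next
  assume sub: "Inl ` vertex_support v \<subseteq> B"
  show "section_support X S (L v) \<subseteq> B"
  proof
    fix c assume c: "c \<in> section_support X S (L v)"
    show "c \<in> B"
    proof (cases c)
      case (Inl x)
      then show ?thesis using c sub Inl_in_support[OF v] by blast
    next
      case (Inr e)
      then show ?thesis using c sub Inr_in_support[OF v, of e] ball_contains_edge[OF B, of e] by blast
    qed
  qed
qed

lemma L_nonzero: "v \<in> carrier V \<Longrightarrow> v \<noteq> \<zero>\<^bsub>V\<^esub> \<Longrightarrow> L v \<noteq> \<zero>\<^bsub>compact_sections X S\<^esub>"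
  using inj_onD[OF L_inj, of v "\<zero>\<^bsub>V\<^esub>"] L_zero by auto

lemma support_radius_le:
  assumes v: "v \<in> carrier V" "v \<noteq> \<zero>\<^bsub>V\<^esub>" and B: "is_ball X r B" and "Inl ` vertex_support v \<subseteq> B"
  shows "support_radius X S \<le> r"
proof -
  have "section_radius X S (L v) \<le> r"
    unfolding section_radius_def using support_in_ball_iff[OF v(1) B] assms(4) B by (intro Least_le) blast
  moreover have "support_radius X S \<le> section_radius X S (L v)"
    unfolding support_radius_def using L_section[OF v(1)] L_nonzero[OF v] by (intro Least_le) blast
  ultimately show ?thesis by simp
qed

end

section \<open>Independence of the translates of a minimal support-ball\<close>

locale minimal_ball = localized_representation k G X \<phi> N V \<pi>
  for k :: "'k ring" and G :: "'g monoid" (structure) and X :: "'x graph"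
    and \<phi> :: "'g \<Rightarrow> 'x \<Rightarrow> 'x" and N :: "'x \<Rightarrow> 'g set"
    and V :: "('k, 'v) module" and \<pi> :: "'g \<Rightarrow> 'v \<Rightarrow> 'v" +
  fixes B :: "('x + 'x set) set"
  assumes B_minimal: "minimal_support_ball X S B" and has_edge: "edges X \<noteq> {}"
begin

abbreviation r where "r \<equiv> support_radius X S"
abbreviation K where "K \<equiv> setwise_stabilizer G \<phi> B"
abbreviation W where "W \<equiv> sections_in X S B"

lemma B_ball: "is_ball X r B"
  using B_minimal unfolding minimal_support_ball_def by blast

lemma B_smaller: "is_ball X r' B' \<Longrightarrow> B' \<subset> B \<Longrightarrow> \<not> supports_nonzero_section X S B'"
  using B_minimal unfolding minimal_support_ball_def by blast

text \<open>The preimage of \<open>W\<close> under the localization isomorphism. It is easier to handle, being a subspace of the representation.\<close>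

definition W0 :: "'v set" where "W0 = {v \<in> carrier V. Inl ` vertex_support v \<subseteq> B}"

lemma W0_carrier: "v \<in> W0 \<Longrightarrow> v \<in> carrier V"
  unfolding W0_def by blast

lemma W0_vertex_support: "v \<in> W0 \<Longrightarrow> p \<in> vertex_support v \<Longrightarrow> Inl p \<in> B"
  unfolding W0_def by blast

lemma carrier_W: "carrier W = L ` W0"
proof
  show "L ` W0 \<subseteq> carrier W"
    using L_section support_in_ball_iff[OF _ B_ball] unfolding sections_in_def W0_def by auto
  show "carrier W \<subseteq> L ` W0"
  proof
    fix f assume "f \<in> carrier W"
    then have f: "f \<in> carrier (compact_sections X S)" "section_support X S f \<subseteq> B"
      unfolding sections_in_def by auto
    obtain v where v: "v \<in> carrier V" "L v = f" using L_surj[OF f(1)] by blast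
    then show "f \<in> L ` W0" using support_in_ball_iff[OF v(1) B_ball] f(2) unfolding W0_def by blast
  qed
qed

lemma W0_iff: "v \<in> W0 \<longleftrightarrow> v \<in> carrier V \<and> (\<forall>x\<in>verts X. Inl x \<notin> B \<longrightarrow> v \<in> Aug x)"
  unfolding W0_def vertex_support_def by auto

lemma W0_submodule: "submodule W0 k V"
  by (rule submoduleI)
    (auto simp: W0_iff intro: submodule_zero[OF Aug_submodule] submoduleE(3-5)[OF Aug_submodule])

text \<open>If \<open>B\<close> is centered at a vertex \<open>x\<close>, the support of a nonzero section in \<open>B\<close> reaches the boundary of \<open>B\<close> away
  from every neighbour \<open>y\<close> of \<open>x\<close>: otherwise the ball of radius \<open>r - 1\<close> around the edge \<open>{x, y}\<close> would contain it. For
  \<open>r = 0\<close> the point is \<open>x\<close> itself.\<close>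

lemma far_point_vertex:
  assumes Bx: "B = vertex_ball X x r" and e: "{x, y} \<in> edges X"
    and v: "v \<in> W0" "v \<noteq> \<zero>\<^bsub>V\<^esub>"
  obtains p where "p \<in> vertex_support v" "tree_dist X x p = r" "tree_dist X x p < tree_dist X y p"
proof (rule ccontr)
  assume "\<not> thesis"
  then have no: "\<not> (p \<in> vertex_support v \<and> tree_dist X x p = r \<and> tree_dist X x p < tree_dist X y p)" for p
    using that by blast
  note xy = edge_endpoints[OF e]
  note vV = W0_carrier[OF v(1)]
  have "vertex_support v \<noteq> {}" using vertex_support_empty[OF vV] v(2) by blast
  have near: "p \<in> verts X" "tree_dist X x p \<le> r" if "p \<in> vertex_support v" for p
  proof -
    have "Inl p \<in> vertex_ball X x r" using W0_vertex_support[OF v(1) that] unfolding Bx .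
    then show "p \<in> verts X" "tree_dist X x p \<le> r" by (simp_all add: Inl_in_vertex_ball)
  qed
  show False
  proof (cases r)
    case 0
    obtain p where p: "p \<in> vertex_support v" using \<open>vertex_support v \<noteq> {}\<close> by blast
    then have "p = x" using near[OF p] 0 tree_dist_eq_0[OF xy(1)] by auto
    then show False using no[of p] p 0 xy tree_dist_edge[of y x] e by (simp add: insert_commute)
  next
    case (Suc r')
    have "Inl p \<in> edge_ball X {x, y} r'" if p: "p \<in> vertex_support v" for p
      using near[OF p] no[of p] p Suc
      by (cases rule: edge_dist_cases[OF e near(1)[OF p]]) (auto simp: Inl_in_edge_ball)
    then have "r \<le> r'"
      using e by (intro support_radius_le[OF vV v(2), of r' "edge_ball X {x, y} r'"]) (auto simp: is_ball_def)
    then show False using Suc by simp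
  qed
qed

text \<open>If \<open>B\<close> is centered at an edge \<open>{x, y}\<close> and not at a vertex, the support of a nonzero section
  in \<open>B\<close> reaches the boundary of \<open>B\<close> beyond \<open>y\<close>: otherwise the ball around \<open>x\<close>, which is a proper
  part of \<open>B\<close>, would contain it.\<close>

lemma far_point_edge:
  assumes Be: "B = edge_ball X {x, y} r" and e: "{x, y} \<in> edges X"
    and nv: "\<And>x. x \<in> verts X \<Longrightarrow> B \<noteq> vertex_ball X x r"
    and v: "v \<in> W0" "v \<noteq> \<zero>\<^bsub>V\<^esub>"
  obtains p where "p \<in> vertex_support v" "tree_dist X y p = r" "tree_dist X y p < tree_dist X x p"
proof (rule ccontr)
  assume "\<not> thesis"
  then have no: "\<not> (p \<in> vertex_support v \<and> tree_dist X y p = r \<and> tree_dist X y p < tree_dist X x p)" for p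
    using that by blast
  note xy = edge_endpoints[OF e]
  note vV = W0_carrier[OF v(1)]
  have near: "p \<in> verts X" "tree_dist X x p \<le> r \<or> tree_dist X y p \<le> r" if "p \<in> vertex_support v" for p
  proof -
    have "Inl p \<in> edge_ball X {x, y} r" using W0_vertex_support[OF v(1) that] unfolding Be .
    then show "p \<in> verts X" "tree_dist X x p \<le> r \<or> tree_dist X y p \<le> r"
      by (simp_all add: Inl_in_edge_ball)
  qed
  have "Inl p \<in> vertex_ball X x r" if p: "p \<in> vertex_support v" for p
    using near[OF p] no[of p] p
    by (cases rule: edge_dist_cases[OF e near(1)[OF p]]) (auto simp: Inl_in_vertex_ball)
  then have sub: "Inl ` vertex_support v \<subseteq> vertex_ball X x r" by blast
  have ball: "is_ball X r (vertex_ball X x r)" using xy by (auto simp: is_ball_def)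
  have "L v \<in> carrier (sections_in X S (vertex_ball X x r))"
    using support_in_ball_iff[OF vV ball] sub L_section[OF vV] by (simp add: sections_in_def)
  then have "supports_nonzero_section X S (vertex_ball X x r)"
    unfolding supports_nonzero_section_def using L_nonzero[OF vV v(2)] by blast
  moreover have "vertex_ball X x r \<subset> B"
    using nv[OF xy(1)] unfolding Be edge_ball_def by auto
  ultimately show False using B_smaller[OF ball] by blast
qed

text \<open>Choose \<open>a\<close> such that the center of the translate of \<open>B\<close> by \<open>a\<close> is extreme: an edge at this center separates the
  boundary point \<open>p\<close> given by \<open>far_point_vertex\<close> or \<open>far_point_edge\<close> from all other centers. The path from another
  center to \<open>p\<close> crosses this edge, so it is longer than \<open>r\<close>.\<close>

lemma private_point:
  assumes A: "finite A" "A \<noteq> {}" "A \<subseteq> carrier G"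
    and dist: "\<And>a b. \<lbrakk>a \<in> A; b \<in> A; inv a \<otimes> b \<in> K\<rbrakk> \<Longrightarrow> a = b"
    and f: "\<And>a. a \<in> A \<Longrightarrow> f a \<in> W0" "\<And>a. a \<in> A \<Longrightarrow> f a \<noteq> \<zero>\<^bsub>V\<^esub>"
  obtains a p where "a \<in> A" "p \<in> vertex_support (\<pi> a (f a))"
    "\<And>b. \<lbrakk>b \<in> A; b \<noteq> a\<rbrakk> \<Longrightarrow> p \<notin> vertex_support (\<pi> b (f b))"
proof -
  have fV: "f a \<in> carrier V" if "a \<in> A" for a using W0_carrier f(1)[OF that] .
  have AG: "a \<in> carrier G" if "a \<in> A" for a using A(3) that by blast
  show ?thesis
  proof (cases "\<exists>x\<in>verts X. B = vertex_ball X x r")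
    case True
    then obtain x where x: "x \<in> verts X" "B = vertex_ball X x r" by blast
    obtain c y where c: "c \<in> (\<lambda>a. \<phi> a x) ` A" "{c, y} \<in> edges X"
        "\<And>c'. \<lbrakk>c' \<in> (\<lambda>a. \<phi> a x) ` A; c' \<noteq> c\<rbrakk> \<Longrightarrow> tree_dist X y c' < tree_dist X c c'"
    proof (rule extreme_vertex[of "(\<lambda>a. \<phi> a x) ` A"])
      show "(\<lambda>a. \<phi> a x) ` A \<subseteq> verts X" using vertex_image AG x by blast
    qed (use A has_edge in auto)
    obtain a where a: "a \<in> A" "c = \<phi> a x" using c(1) by blast
    note aG = AG[OF a(1)] and cy = edge_endpoints[OF c(2)]
    let ?y = "\<phi> (inv a) y"
    have y: "?y \<in> verts X" "\<phi> a ?y = y"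
      using vertex_image[of "inv a" y] vertex_image_inv(2)[OF aG cy(2)] aG cy by auto
    have "{x, ?y} \<in> edges X"
      using edge_image[OF _ c(2), of "inv a"] a vertex_image_inv(1)[OF aG x(1)] aG by simp
    then obtain q where q: "q \<in> vertex_support (f a)" "tree_dist X x q = r" "tree_dist X x q < tree_dist X ?y q"
      by (rule far_point_vertex[OF x(2) _ f(1)[OF a(1)] f(2)[OF a(1)]])
    let ?p = "\<phi> a q"
    have qX: "q \<in> verts X" using q(1) unfolding vertex_support_def by blast
    have pX: "?p \<in> verts X" by (rule vertex_image[OF aG qX])
    have p: "tree_dist X c ?p = r" "tree_dist X c ?p < tree_dist X y ?p"
      using tree_dist_image[OF aG x(1) qX] tree_dist_image[OF aG y(1) qX] q a y(2) by auto
    have "?p \<notin> vertex_support (\<pi> b (f b))" if b: "b \<in> A" "b \<noteq> a" for b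
    proof
      assume "?p \<in> vertex_support (\<pi> b (f b))"
      then obtain q' where q': "q' \<in> vertex_support (f b)" "?p = \<phi> b q'"
        using vertex_support_image[OF AG[OF b(1)] fV[OF b(1)]] by blast
      have q'X: "q' \<in> verts X" using q'(1) unfolding vertex_support_def by blast
      let ?c = "\<phi> b x"
      have cX: "?c \<in> verts X" by (rule vertex_image[OF AG[OF b(1)] x(1)])
      have "tree_dist X x q' \<le> r"
        using W0_vertex_support[OF f(1)[OF b(1)] q'(1)] unfolding x(2) by (auto simp: Inl_in_vertex_ball)
      then have le: "tree_dist X ?c ?p \<le> r"
        using tree_dist_image[OF AG[OF b(1)] x(1) q'X] q'(2) by simp
      \<comment> \<open>An element that fixes the center of \<open>B\<close> stabilizes \<open>B\<close>.\<close>
      have "?c \<noteq> c"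
      proof
        assume "?c = c"
        then have "\<phi> (inv a \<otimes> b) x = x"
          using vertices.composition_rule[OF x(1), of "inv a" b] a vertex_image_inv(1)[OF aG x(1)] aG AG[OF b(1)]
          by simp
        then have "inv a \<otimes> b \<in> K"
          unfolding x(2) using fixes_center_vertex[OF _ x(1)] aG AG[OF b(1)] by simp
        then show False using dist[OF a(1) b(1)] b(2) by blast
      qed
      then have "tree_dist X y ?c < tree_dist X c ?c" using c(3) b(1) by blast
      from dist_across_edge[OF c(2) pX cX p(2) this]
      have "tree_dist X ?p ?c > r" using tree_dist_commute[OF pX cy(1)] p(1) by simp
      then show False using le tree_dist_commute[OF pX cX] by simp
    qed
    then show ?thesis
      using that[OF a(1), of ?p] vertex_support_image[OF aG fV[OF a(1)]] q(1) by blast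
  next
    case False
    then obtain e where e: "e \<in> edges X" "B = edge_ball X e r" using B_ball unfolding is_ball_def by blast
    obtain x y where xy: "{x, y} \<in> (\<lambda>a. \<phi> a ` e) ` A"
        "\<And>e' c. \<lbrakk>e' \<in> (\<lambda>a. \<phi> a ` e) ` A; e' \<noteq> {x, y}; c \<in> e'\<rbrakk> \<Longrightarrow> tree_dist X x c < tree_dist X y c"
    proof (rule extreme_edge[of "(\<lambda>a. \<phi> a ` e) ` A"])
      show "(\<lambda>a. \<phi> a ` e) ` A \<subseteq> edges X" using edge_image AG e by blast
    qed (use A in auto)
    obtain a where a: "a \<in> A" "{x, y} = \<phi> a ` e" using xy(1) by blast
    note aG = AG[OF a(1)]
    have xyX: "{x, y} \<in> edges X" using edge_image[OF aG e(1)] a(2) by simp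
    note v = edge_endpoints[OF xyX]
    let ?x = "\<phi> (inv a) x" and ?y = "\<phi> (inv a) y"
    have x': "?x \<in> verts X" "\<phi> a ?x = x" and y': "?y \<in> verts X" "\<phi> a ?y = y"
      using vertex_image[of "inv a"] vertex_image_inv(2)[OF aG] aG v by auto
    have e': "e = {?x, ?y}" using edge_image_inv[OF aG e(1)] a(2)[symmetric] by simp
    have "{?x, ?y} \<in> edges X" "B = edge_ball X {?x, ?y} r" using e e' by simp_all
    then obtain q where q: "q \<in> vertex_support (f a)" "tree_dist X ?y q = r" "tree_dist X ?y q < tree_dist X ?x q"
      using far_point_edge[of ?x ?y "f a"] False f(1)[OF a(1)] f(2)[OF a(1)] by blast
    let ?p = "\<phi> a q"
    have qX: "q \<in> verts X" using q(1) unfolding vertex_support_def by blast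
    have pX: "?p \<in> verts X" by (rule vertex_image[OF aG qX])
    have p: "tree_dist X y ?p = r" "tree_dist X y ?p < tree_dist X x ?p"
      using tree_dist_image[OF aG x'(1) qX] tree_dist_image[OF aG y'(1) qX] q x'(2) y'(2) by auto
    have "?p \<notin> vertex_support (\<pi> b (f b))" if b: "b \<in> A" "b \<noteq> a" for b
    proof
      assume "?p \<in> vertex_support (\<pi> b (f b))"
      then obtain q' where q': "q' \<in> vertex_support (f b)" "?p = \<phi> b q'"
        using vertex_support_image[OF AG[OF b(1)] fV[OF b(1)]] by blast
      have q'X: "q' \<in> verts X" using q'(1) unfolding vertex_support_def by blast
      obtain c where c: "c \<in> e" "tree_dist X c q' \<le> r"
        using W0_vertex_support[OF f(1)[OF b(1)] q'(1)] unfolding e(2) by (auto simp: Inl_in_edge_ball)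
      note cX = edge_subset_verts[OF e(1) c(1)]
      let ?c = "\<phi> b c"
      have c'X: "?c \<in> verts X" by (rule vertex_image[OF AG[OF b(1)] cX])
      have le: "tree_dist X ?c ?p \<le> r"
        using tree_dist_image[OF AG[OF b(1)] cX q'X] q'(2) c(2) by simp
      \<comment> \<open>An element that stabilizes the central edge of \<open>B\<close> stabilizes \<open>B\<close>.\<close>
      have "\<phi> b ` e \<noteq> {x, y}"
      proof
        assume "\<phi> b ` e = {x, y}"
        then have "\<phi> (inv a) ` (\<phi> b ` e) = e" using edge_image_inv[OF aG e(1)] a(2) by simp
        then have "\<phi> (inv a \<otimes> b) ` e = e"
          using cell_image_mult[of "inv a" b "Inr e"] aG AG[OF b(1)] e(1) by simp
        then have "inv a \<otimes> b \<in> K"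
          unfolding e(2) using fixes_center_edge[OF _ e(1)] aG AG[OF b(1)] by simp
        then show False using dist[OF a(1) b(1)] b(2) by blast
      qed
      then have "tree_dist X x ?c < tree_dist X y ?c" using xy(2) b(1) c(1) by blast
      from dist_across_edge[OF xyX c'X pX this p(2)] show False using p(1) le by simp
    qed
    then show ?thesis
      using that[OF a(1), of ?p] vertex_support_image[OF aG fV[OF a(1)]] q(1) by blast
  qed
qed

lemma translates_independent:
  assumes A: "finite A" "A \<subseteq> carrier G"
    and dist: "\<And>a b. \<lbrakk>a \<in> A; b \<in> A; inv a \<otimes> b \<in> K\<rbrakk> \<Longrightarrow> a = b"
    and f: "\<And>a. a \<in> A \<Longrightarrow> f a \<in> W0" and z: "finsum V (\<lambda>a. \<pi> a (f a)) A = \<zero>\<^bsub>V\<^esub>"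
    and c: "c \<in> A"
  shows "f c = \<zero>\<^bsub>V\<^esub>"
proof (rule ccontr)
  assume "f c \<noteq> \<zero>\<^bsub>V\<^esub>"
  let ?A = "{a \<in> A. f a \<noteq> \<zero>\<^bsub>V\<^esub>}"
  obtain a p where a: "a \<in> ?A" and p: "p \<in> vertex_support (\<pi> a (f a))"
    and far: "\<And>b. \<lbrakk>b \<in> ?A; b \<noteq> a\<rbrakk> \<Longrightarrow> p \<notin> vertex_support (\<pi> b (f b))"
  proof (rule private_point[of ?A f])
    show "?A \<noteq> {}" using c \<open>f c \<noteq> \<zero>\<^bsub>V\<^esub>\<close> by blast
  qed (use A dist f in auto)
  have "(\<lambda>a. \<pi> a (f a)) \<in> A \<rightarrow> carrier V" using A(2) W0_carrier[OF f] by auto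
  then obtain b where b: "b \<in> A" "b \<noteq> a" "p \<in> vertex_support (\<pi> b (f b))"
    using sum_zero_support[OF A(1) _ z _ p] a by blast
  then have "f b = \<zero>\<^bsub>V\<^esub>" using far by blast
  then show False using b(3) pi_zero vertex_support_zero A(2) b(1) by auto
qed

end

section \<open>The minimal K-type\<close>

lemma module_image:
  assumes "module k M" and T: "T ` carrier M = carrier M'"
    and add: "\<And>x y. \<lbrakk>x \<in> carrier M; y \<in> carrier M\<rbrakk> \<Longrightarrow> T (x \<oplus>\<^bsub>M\<^esub> y) = T x \<oplus>\<^bsub>M'\<^esub> T y"
    and smult: "\<And>c x. \<lbrakk>c \<in> carrier k; x \<in> carrier M\<rbrakk> \<Longrightarrow> T (c \<odot>\<^bsub>M\<^esub> x) = c \<odot>\<^bsub>M'\<^esub> T x"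
    and zero: "T \<zero>\<^bsub>M\<^esub> = \<zero>\<^bsub>M'\<^esub>"
  shows "module k M'"
proof -
  interpret M: module k M by fact
  note [simp] = add[symmetric] smult[symmetric] zero[symmetric]
  show ?thesis
  proof (rule moduleI)
    show "cring k" by (rule M.R.is_cring)
    show "abelian_group M'"
    proof (rule abelian_groupI)
      show "\<exists>y\<in>carrier M'. y \<oplus>\<^bsub>M'\<^esub> x = \<zero>\<^bsub>M'\<^esub>" if "x \<in> carrier M'" for x
      proof -
        obtain u where "u \<in> carrier M" "x = T u" using \<open>x \<in> carrier M'\<close> unfolding T[symmetric] by blast
        then show ?thesis unfolding T[symmetric] by (intro bexI[of _ "T (\<ominus>\<^bsub>M\<^esub> u)"]) (auto simp: M.l_neg)
      qed
    qed (auto simp: T[symmetric] M.a_ac)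
  qed (auto simp: T[symmetric] M.smult_l_distr M.smult_r_distr M.smult_assoc1)
qed

lemma group_actionI:
  assumes "group H" and ext: "\<And>g. g \<in> carrier H \<Longrightarrow> \<sigma> g \<in> extensional E"
    and cl: "\<And>g x. \<lbrakk>g \<in> carrier H; x \<in> E\<rbrakk> \<Longrightarrow> \<sigma> g x \<in> E"
    and mult: "\<And>g h x. \<lbrakk>g \<in> carrier H; h \<in> carrier H; x \<in> E\<rbrakk> \<Longrightarrow> \<sigma> (g \<otimes>\<^bsub>H\<^esub> h) x = \<sigma> g (\<sigma> h x)"
    and one: "\<And>x. x \<in> E \<Longrightarrow> \<sigma> \<one>\<^bsub>H\<^esub> x = x"
  shows "group_action H E \<sigma>"
proof -
  interpret H: group H by fact
  have bij: "\<sigma> g \<in> Bij E" if g: "g \<in> carrier H" for g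
  proof -
    have "bij_betw (\<sigma> g) E E"
    proof (rule bij_betw_byWitness[of _ "\<sigma> (inv\<^bsub>H\<^esub> g)"])
      show "\<forall>a\<in>E. \<sigma> (inv\<^bsub>H\<^esub> g) (\<sigma> g a) = a" "\<forall>a\<in>E. \<sigma> g (\<sigma> (inv\<^bsub>H\<^esub> g) a) = a"
        using mult[symmetric] one g by auto
    qed (use cl g in auto)
    then show ?thesis using ext[OF g] unfolding Bij_def by blast
  qed
  have "\<sigma> \<in> hom H (BijGroup E)"
    unfolding hom_def BijGroup_def using bij mult ext[OF H.m_closed]
    by (auto simp: compose_def intro!: extensionalityI[of _ E])
  then show ?thesis
    using group_BijGroup by (intro group_action.intro group_hom.intro group_hom_axioms.intro) (auto simp: \<open>group H\<close>)
qed

context minimal_ball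
begin

lemma B_cells: "B \<subseteq> Inl ` verts X \<union> Inr ` edges X"
  by (rule ball_subset[OF B_ball])

lemmas K_subgroup = setwise_stabilizer_subgroup[OF B_cells]

lemma K_carrier: "h \<in> K \<Longrightarrow> h \<in> carrier G"
  using setwise_stabilizer_iff by blast

lemma W0_stable:
  assumes h: "h \<in> K" and v: "v \<in> W0" shows "\<pi> h v \<in> W0"
proof -
  note vV = W0_carrier[OF v] and hG = K_carrier[OF h]
  have "Inl (\<phi> h p) \<in> B" if "p \<in> vertex_support v" for p
  proof -
    have "cell_image h (Inl p) \<in> cell_image h ` B" using W0_vertex_support[OF v that] by (rule imageI)
    then show ?thesis using h setwise_stabilizer_iff by simp
  qed
  then show ?thesis unfolding W0_def using vertex_support_image[OF hG vV] vV hG by auto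
qed

lemma W_ops:
  "\<zero>\<^bsub>W\<^esub> = \<zero>\<^bsub>compact_sections X S\<^esub>" "(\<oplus>\<^bsub>W\<^esub>) = (\<oplus>\<^bsub>compact_sections X S\<^esub>)"
  "(\<odot>\<^bsub>W\<^esub>) = (\<odot>\<^bsub>compact_sections X S\<^esub>)"
  by (simp_all add: sections_in_def)

lemma L_W_add: "v \<in> W0 \<Longrightarrow> w \<in> W0 \<Longrightarrow> L (v \<oplus>\<^bsub>V\<^esub> w) = L v \<oplus>\<^bsub>W\<^esub> L w"
  and L_W_smult: "v \<in> W0 \<Longrightarrow> c \<in> carrier k \<Longrightarrow> L (c \<odot>\<^bsub>V\<^esub> v) = c \<odot>\<^bsub>W\<^esub> L v"
  and L_W_zero: "L \<zero>\<^bsub>V\<^esub> = \<zero>\<^bsub>W\<^esub>"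
  using L_add L_smult L_zero W0_carrier unfolding W_ops by blast+

lemma W_module: "module k W"
proof (rule module_image)
  show "module k (V\<lparr>carrier := W0\<rparr>)" by (rule submodule.submodule_is_module[OF W0_submodule md])
  show "L ` carrier (V\<lparr>carrier := W0\<rparr>) = carrier W" by (simp add: carrier_W)
qed (use L_W_add L_W_smult L_W_zero in auto)

abbreviation \<sigma> where "\<sigma> \<equiv> \<lambda>g. restrict (section_action G X \<phi> S g) (carrier W)"

lemma \<sigma>_L: "h \<in> K \<Longrightarrow> v \<in> W0 \<Longrightarrow> \<sigma> h (L v) = L (\<pi> h v)"
  using L_equivariant K_carrier W0_carrier by (simp add: carrier_W)

lemma W_representation: "representation k (G\<lparr>carrier := K\<rparr>) W \<sigma>"
  unfolding representation_def
proof (intro conjI ballI W_module)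
  show "field k" using rep unfolding representation_def by blast
  note st = W0_stable
  show "group_action (G\<lparr>carrier := K\<rparr>) (carrier W) \<sigma>"
  proof (rule group_actionI)
    show "group (G\<lparr>carrier := K\<rparr>)" by (rule subgroup.subgroup_is_group[OF K_subgroup G.is_group])
  next
    fix g x assume g: "g \<in> carrier (G\<lparr>carrier := K\<rparr>)" and x: "x \<in> carrier W"
    then obtain v where v: "v \<in> W0" "x = L v" unfolding carrier_W by blast
    then show "\<sigma> g x \<in> carrier W" using g \<sigma>_L[of g v] st[of g v] by (simp add: carrier_W)
  next
    fix g h x assume g: "g \<in> carrier (G\<lparr>carrier := K\<rparr>)" "h \<in> carrier (G\<lparr>carrier := K\<rparr>)"
      and x: "x \<in> carrier W"
    then have gh: "g \<in> K" "h \<in> K" "g \<otimes> h \<in> K"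
      using subgroup.m_closed[OF K_subgroup] by simp_all
    obtain v where v: "v \<in> W0" "x = L v" using x unfolding carrier_W by blast
    have "\<sigma> (g \<otimes> h) x = L (\<pi> (g \<otimes> h) v)" using \<sigma>_L[OF gh(3) v(1)] v(2) by simp
    also have "\<pi> (g \<otimes> h) v = \<pi> g (\<pi> h v)" using pi_mult gh K_carrier W0_carrier v by simp
    also have "L \<dots> = \<sigma> g (\<sigma> h x)"
      using \<sigma>_L[OF gh(1) st[OF gh(2) v(1)]] \<sigma>_L[OF gh(2) v(1)] v(2) by simp
    finally show "\<sigma> (g \<otimes>\<^bsub>G\<lparr>carrier := K\<rparr>\<^esub> h) x = \<sigma> g (\<sigma> h x)" by simp
  next
    fix x assume "x \<in> carrier W"
    then obtain v where v: "v \<in> W0" "x = L v" unfolding carrier_W by blast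
    have "\<pi> \<one> v = v" using pi_one W0_carrier[OF v(1)] by simp
    then show "\<sigma> \<one>\<^bsub>G\<lparr>carrier := K\<rparr>\<^esub> x = x"
      using \<sigma>_L[OF subgroup.one_closed[OF K_subgroup] v(1)] v(2) by simp
  qed simp
  fix h assume "h \<in> carrier (G\<lparr>carrier := K\<rparr>)"
  then have h: "h \<in> K" by simp
  note hG = K_carrier[OF h]
  have add: "\<sigma> h (L v \<oplus>\<^bsub>W\<^esub> L w) = \<sigma> h (L v) \<oplus>\<^bsub>W\<^esub> \<sigma> h (L w)" if v: "v \<in> W0" "w \<in> W0" for v w
  proof -
    have "v \<oplus>\<^bsub>V\<^esub> w \<in> W0" using submoduleE(5)[OF W0_submodule] v by blast
    then have "\<sigma> h (L v \<oplus>\<^bsub>W\<^esub> L w) = L (\<pi> h (v \<oplus>\<^bsub>V\<^esub> w))"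
      using \<sigma>_L[OF h] L_W_add[OF v] by metis
    also have "\<dots> = L (\<pi> h v) \<oplus>\<^bsub>W\<^esub> L (\<pi> h w)"
      using pi_add[OF hG] W0_carrier v L_W_add st[OF h] by simp
    finally show ?thesis using \<sigma>_L[OF h v(1)] \<sigma>_L[OF h v(2)] by simp
  qed
  have smult: "\<sigma> h (c \<odot>\<^bsub>W\<^esub> L v) = c \<odot>\<^bsub>W\<^esub> \<sigma> h (L v)" if c: "c \<in> carrier k" and v: "v \<in> W0" for c v
  proof -
    have "c \<odot>\<^bsub>V\<^esub> v \<in> W0" using submoduleE(4)[OF W0_submodule] c v by blast
    then have "\<sigma> h (c \<odot>\<^bsub>W\<^esub> L v) = L (\<pi> h (c \<odot>\<^bsub>V\<^esub> v))"
      using \<sigma>_L[OF h] L_W_smult[OF v c] by metis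
    also have "\<dots> = c \<odot>\<^bsub>W\<^esub> L (\<pi> h v)"
      using pi_smult[OF hG] W0_carrier v c L_W_smult st[OF h] by simp
    finally show ?thesis using \<sigma>_L[OF h v] by simp
  qed
  have closed: "\<sigma> h (L v) \<in> L ` W0" if "v \<in> W0" for v
    using \<sigma>_L[OF h that] st[OF h that] by simp
  show "\<sigma> h \<in> linear_maps k W W"
    unfolding linear_maps_def hom_def
  proof (intro CollectI conjI ballI)
    show "\<sigma> h \<in> carrier (add_monoid W) \<rightarrow> carrier (add_monoid W)"
    proof (rule funcsetI)
      fix x assume "x \<in> carrier (add_monoid W)"
      then obtain v where v: "v \<in> W0" "x = L v" by (auto simp: carrier_W)
      show "\<sigma> h x \<in> carrier (add_monoid W)" using closed[OF v(1)] unfolding v(2) by (simp only: carrier_W monoid.simps partial_object.select_convs)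
    qed
  next
    fix x y assume "x \<in> carrier (add_monoid W)" "y \<in> carrier (add_monoid W)"
    then obtain v w where v: "v \<in> W0" "x = L v" and w: "w \<in> W0" "y = L w" by (auto simp: carrier_W)
    show "\<sigma> h (x \<otimes>\<^bsub>add_monoid W\<^esub> y) = \<sigma> h x \<otimes>\<^bsub>add_monoid W\<^esub> \<sigma> h y"
      using add[OF v(1) w(1)] unfolding v(2) w(2) by (simp only: monoid.simps)
  next
    fix c x assume c: "c \<in> carrier k" and "x \<in> carrier W"
    then obtain v where v: "v \<in> W0" "x = L v" by (auto simp: carrier_W)
    show "\<sigma> h (c \<odot>\<^bsub>W\<^esub> x) = c \<odot>\<^bsub>W\<^esub> \<sigma> h x" using smult[OF c v(1)] unfolding v(2) .
  qed
qed

definition lift :: "('x \<Rightarrow> 'v set) \<Rightarrow> 'v" where "lift = inv_into W0 L"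

lemma L_inj_W0: "inj_on L W0"
  using L_inj W0_carrier by (blast intro: inj_on_subset)

lemma lift_L: "v \<in> W0 \<Longrightarrow> lift (L v) = v"
  unfolding lift_def by (rule inv_into_f_f[OF L_inj_W0])

lemma lift_W0: "w \<in> carrier W \<Longrightarrow> lift w \<in> W0" and L_lift: "w \<in> carrier W \<Longrightarrow> L (lift w) = w"
  unfolding carrier_W using lift_L by auto

lemma lift_linear: "lift \<in> linear_maps k W V"
proof -
  have add: "lift (L v \<oplus>\<^bsub>W\<^esub> L w) = lift (L v) \<oplus>\<^bsub>V\<^esub> lift (L w)" if "v \<in> W0" "w \<in> W0" for v w
    using that lift_L submoduleE(5)[OF W0_submodule] L_W_add[OF that, symmetric] by simp
  have smult: "lift (c \<odot>\<^bsub>W\<^esub> L v) = c \<odot>\<^bsub>V\<^esub> lift (L v)" if "v \<in> W0" "c \<in> carrier k" for c v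
    using that lift_L submoduleE(4)[OF W0_submodule] L_W_smult[OF that, symmetric] by simp
  show ?thesis
    unfolding linear_maps_def hom_def using add smult lift_L W0_carrier by (auto simp: carrier_W)
qed

text \<open>\<open>W\<close> is embedded into \<open>V\<close> by the inverse of the localization map.\<close>

lemma K_type_independent:
  assumes irr: "irreducible_representation k G V \<pi>"
  shows "independent_translates k G V \<pi> K W \<sigma> lift"
proof (intro independent_translates.intro rep_setup_axioms independent_translates_axioms.intro, goal_cases)
  case 1 show ?case by (rule irr)
next
  case 2 show ?case by (rule K_subgroup)
next
  case 3 show ?case by (rule W_representation)
next
  case 4
  have "supports_nonzero_section X S B" using B_minimal unfolding minimal_support_ball_def by blast
  then show ?case unfolding supports_nonzero_section_def W_ops by blast
next
  case 5 show ?case by (rule lift_linear)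
next
  case (6 h w)
  then obtain v where v: "v \<in> W0" "w = L v" unfolding carrier_W by blast
  then show ?case using \<sigma>_L[OF 6(1) v(1)] lift_L W0_stable[OF 6(1)] by simp
next
  case (7 A f c)
  have fW: "f a \<in> carrier W" if "a \<in> A" for a using 7(4) that by (rule Pi_mem)
  have "lift (f c) = \<zero>\<^bsub>V\<^esub>"
    using 7(3) by (intro translates_independent[OF 7(1,2) _ _ 7(5,6)] lift_W0 fW)
  then show ?case using L_lift[OF fW[OF 7(6)]] L_W_zero by simp
qed

end

theorem theorem6p3:
  fixes k :: "'k ring" and G :: "'g monoid" and X :: "'x graph"
    and \<phi> :: "'g \<Rightarrow> 'x \<Rightarrow> 'x" and N :: "'x \<Rightarrow> 'g set"
    and V :: "('k, 'v) module" and \<pi> :: "'g \<Rightarrow> 'v \<Rightarrow> 'v"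
    and S :: "('g, 'x, 'k, 'v set) sheaf_data"
    and B :: "('x + 'x set) set" and K :: "'g set"
    and W :: "('k, 'x \<Rightarrow> 'v set) module"
    and \<sigma> :: "'g \<Rightarrow> ('x \<Rightarrow> 'v set) \<Rightarrow> ('x \<Rightarrow> 'v set)"
  assumes "field k"
    and "tree X" and "locally_finite X" and "edges X \<noteq> {}"
    and "group G"
    and "group_action G (verts X) \<phi>"
    and "transitive_action G (edges X) (edge_action X \<phi>)"
    and "plumbing_system G X \<phi> N"
    and "irreducible_representation k G V \<pi>"
    and "N_compact k G X N V \<pi>"
    and "N_cogenerated k X N V \<pi>"
    and "N_characteristic k X N V \<pi>"
    and S: "S = localization k G N V \<pi>"
    and B: "minimal_support_ball X S B"
    and K: "K = setwise_stabilizer G \<phi> B"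
    and W: "W = sections_in X S B"
    and \<sigma>: "\<sigma> = (\<lambda>g. restrict (section_action G X \<phi> S g) (carrier W))"
  shows "irreducible_representation k (G\<lparr>carrier := K\<rparr>) W \<sigma> \<and>
    (\<exists>\<Phi>. rep_isomorphism k G (cInd G K W \<sigma>) (cInd_action G) V \<pi> \<Phi> \<and>
         (\<forall>g\<in>carrier G. \<forall>w\<in>carrier W.
            localization_map k X N V \<pi> (\<Phi> (cInd_tensor G K W \<sigma> g w))
              = section_action G X \<phi> S g w))"
proof -
  have rep: "representation k G V \<pi>"
    using assms(9) unfolding irreducible_representation_def by blast
  have edges: "group_action G (edges X) (edge_action X \<phi>)"
    using assms(7) by (rule transitive_action.axioms(1))
  interpret M: minimal_ball k G X \<phi> N V \<pi> B
    using assms edges rep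
    by (intro minimal_ball.intro localized_representation.intro plumbed_representation.intro
        tree_graph.intro rep_setup.intro plumbed_representation_axioms.intro
        localized_representation_axioms.intro minimal_ball_axioms.intro) simp_all
  interpret I: independent_translates k G V \<pi> K W \<sigma> M.lift
    unfolding \<sigma> K W S by (rule M.K_type_independent[OF assms(9)])
  show ?thesis
  proof (intro conjI exI ballI)
    show "irreducible_representation k (G\<lparr>carrier := K\<rparr>) W \<sigma>" by (rule I.W_irreducible)
    show "rep_isomorphism k G (cInd G K W \<sigma>) (cInd_action G) V \<pi> I.induced_map"
      by (rule I.induced_map_isomorphism)
    fix g w assume g: "g \<in> carrier G" and w: "w \<in> carrier W"
    have w': "w \<in> carrier M.W" using w W S by simp
    have "localization_map k X N V \<pi> (I.induced_map (cInd_tensor G K W \<sigma> g w)) =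
        localization_map k X N V \<pi> (\<pi> g (M.lift w))"
      using I.tensor_in_cInd(2)[OF g w] by simp
    also have "\<dots> = section_action G X \<phi> S g w"
      using M.L_equivariant[OF g M.W0_carrier[OF M.lift_W0[OF w']]] M.L_lift[OF w'] S by simp
    finally show "localization_map k X N V \<pi> (I.induced_map (cInd_tensor G K W \<sigma> g w)) =
        section_action G X \<phi> S g w" .
  qed
qed

end
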